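(* Assume that $\alpha h\le c$ for some small enough constant $c>0$ (independent of $h$ and $\alpha$), and let $f\in L^2(\Omega)$. Then the following holds, for $\mathbf P_p$ finite elements with any $p\ge1$ in dimension $d=2$, and for $\mathbf P_1$ finite elements in dimension $d=3$. (i) The discrete problem: find $(\underline u_h,\underline p_h)\in\mathcal V_h$ such that for all $\underline v_h=(v_{h,1},\dots,v_{h,K})\in\prod_{k=1}^KX_h^k$, $$\sum_{k=1}^K\int_{\Omega^k}(\nabla u_{h,k}\cdot\nabla v_{h,k}+u_{h,k}v_{h,k})\,dx-\sum_{k=1}^K\int_{\partial\Omega^k}p_{h,k}v_{h,k}\,ds=\sum_{k=1}^K\int_{\Omega^k}f_kv_{h,k}\,dx,$$ has a unique solution $(\underline u_h,\underline p_h)\in\mathcal V_h$. (ii) The iterative algorithm: given $(u_{h,k}^n,p_{h,k}^n)\in X_h^k\times\tilde W_h^k$, $1\le k\le K$, find $(u_{h,k}^{n+1},p_{h,k}^{n+1})\in X_h^k\times\tilde W_h^k$ such that $$\int_{\Omega^k}(\nabla u_{h,k}^{n+1}\cdot\nabla v_{h,k}+u_{h,k}^{n+1}v_{h,k})\,dx-\int_{\partial\Omega^k}p_{h,k}^{n+1}v_{h,k}\,ds=\int_{\Omega^k}f_kv_{h,k}\,dx\quad\forall v_{h,k}\in X_h^k,$$ $$\int_{\Gamma^{k,\ell}}(p_{h,k}^{n+1}+\alpha u_{h,k}^{n+1})\psi_{h,k,\ell}=\int_{\Gamma^{k,\ell}}(-p_{h,\ell}^n+\alpha u_{h,\ell}^n)\psi_{h,k,\ell}\quad\forall\psi_{h,k,\ell}\in\tilde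 W_h^{k,\ell},\ \forall\ell,$$ is well posed, and it converges in the sense that $$\lim_{n\to\infty}\Big(\|u_{h,k}^n-u_{h,k}\|_{H^1(\Omega^k)}+\sum_{\ell\ne k}\|p_{h,k,\ell}^n-p_{h,k,\ell}\|_{H^{-1/2}_*(\Gamma^{k,\ell})}\Big)=0,\qquad 1\le k\le K,$$ where $p_{h,k,\ell}^n$ and $p_{h,k,\ell}$ denote the components of $p_{h,k}^n$ and $p_{h,k}$ on $\Gamma^{k,\ell}$.
   Context: Domain decomposition. $\Omega\subset\mathbb R^d$, $d=2$ or $3$, is a $\mathcal C^{1,1}$ domain or a convex polygon (2D) or polyhedron (3D), decomposed into $K$ non-overlapping subdomains $\overline\Omega=\cup_{k=1}^K\overline{\Omega^k}$, each $\mathcal C^{1,1}$ or a polygon (2D) or polyhedron (3D). The decomposition is geometrically conforming: the intersection of the closures of two different subdomains, if not empty, is a common vertex, a common edge or (in 3D) a common face. $\Gamma^{k,\ell}=\partial\Omega^k\cap\partial\Omega^\ell$ is the interface of two adjacent subdomains (sharing an edge in 2D, a face in 3D); sums and products over $\ell$ run over the $\ell$ for which $\Omega^\ell$ is adjacent to $\Omega^k$. $f_k=f_{|\Omega^k}$, and $\alpha>0$ is a given real number. Discrete spaces. Let $p\ge1$ be an integer if $d=2$, and $p=1$ if $d=3$. Each $\Omega^k$ has its own simplicial mesh $\mathcal T_h^k$, $\overline{\Omega^k}=\cup_{T\in\mathcal T_h^k}T$ (meshes on the two sides of an interface need not match). With $h_T$ the diameter of $T$, $\rho_T$ the diameter of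 its inscribed circle (sphere in 3D), and $h=\max_k\max_{T\in\mathcal T_h^k}h_T$, the meshes are uniformly regular: there are $\sigma,\tau>0$ independent of $h$ with $h_T/\rho_T\le\sigma$ and $\tau h\le h_T$ for all $T$. $\mathbf P_p(T)$ is the space of polynomials on $T$ of total degree $\le p$. Set $Y_h^k=\{v\in\mathcal C^0(\overline{\Omega^k}): v_{|T}\in\mathbf P_p(T)\ \forall T\in\mathcal T_h^k\}$ and $X_h^k=\{v\in Y_h^k: v=0\text{ on }\partial\Omega^k\cap\partial\Omega\}$. The meshes fit the interfaces: the space $\mathcal Y_h^{k,\ell}$ of traces on $\Gamma^{k,\ell}$ of elements of $Y_h^k$ is a finite element space (continuous piecewise polynomials of degree $\le p$ for the trace mesh). Multiplier spaces. In 2D, let $x_0^{k,\ell},x_1^{k,\ell},\dots,x_{N-1}^{k,\ell},x_N^{k,\ell}$ be the vertices of the trace mesh, $x_0^{k,\ell},x_N^{k,\ell}$ being the end points of $\Gamma^{k,\ell}$; $\tilde W_h^{k,\ell}$ is the subspace of those elements of $\mathcal Y_h^{k,\ell}$ that are polynomials of degree $\le p-1$ on both $[x_0^{k,\ell},x_1^{k,\ell}]$ and $[x_{N-1}^{k,\ell},x_N^{k,\ell}]$. In 3D ($p=1$), $\tilde W_h^{k,\ell}$ is the subspace of $\mathcal Y_h^{k,\ell}$ used as multiplier space in the three-dimensional mortar element method (as in the work of Braess and Dahmen), for which the following two facts, which also hold in 2D, are known: (a) there is a constant $c_*$ such that for any $q\in\tilde W_h^{k,\ell}$ there is $w\in X_h^k$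 vanishing on $\partial\Omega^k\setminus\Gamma^{k,\ell}$ with $\int_{\Gamma^{k,\ell}}qw\ge\|q\|^2_{H^{-1/2}_*(\Gamma^{k,\ell})}$ and $\|w\|_{H^1(\Omega^k)}\le c_*\|q\|_{H^{-1/2}_*(\Gamma^{k,\ell})}$; (b) the $L^2(\Gamma^{k,\ell})$-orthogonal projection $\pi_{k,\ell}$ onto $\tilde W_h^{k,\ell}$ satisfies $\int_{\Gamma^{k,\ell}}(\pi_{k,\ell}(v)-v)^2\,ds\le Ch\|v\|^2_{H^{1/2}(\Gamma^{k,\ell})}$ for traces $v$ of elements of $X_h^k$, with $C$ independent of $h$. In both cases $\tilde W_h^k=\prod_\ell\tilde W_h^{k,\ell}$ (an element of $\tilde W_h^k$ is regarded as a function on the union of the interfaces of $\Omega^k$; integrals over $\partial\Omega^k$ against functions of $X_h^k$ only involve these interfaces). The discrete constrained space is $$\mathcal V_h=\Big\{(\underline u_h,\underline p_h)\in\prod_kX_h^k\times\prod_k\tilde W_h^k:\ \int_{\Gamma^{k,\ell}}\big((p_{h,k}+\alpha u_{h,k})-(-p_{h,\ell}+\alpha u_{h,\ell})\big)\psi=0\ \ \forall\psi\in\tilde W_h^{k,\ell},\ \forall k\neq\ell\Big\}$$ (the condition being imposed for both ordered pairs $(k,\ell)$ and $(\ell,k)$ of each interface). $\|\cdot\|_{H^{-1/2}_*(\Gamma^{k,\ell})}$ is the dual norm of $H^{1/2}_{00}(\Gamma^{k,\ell})$. *)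

theory Defs
  imports "HOL-Analysis.Analysis"
begin

section \<open>Surface measure\<close>

text \<open>
  The \<open>n\<close>-dimensional Hausdorff measure, normalised so that it agrees with Lebesgue measure on
  \<open>n\<close>-dimensional affine subspaces.  Only \<open>n \<ge> 1\<close> is used, so covering sets of diameter \<open>0\<close>
  contribute nothing.  Boundedness is required because \<^const>\<open>diameter\<close> is unspecified
  on unbounded sets.
\<close>

definition hausdorff_outer :: "nat \<Rightarrow> 'a::metric_space set \<Rightarrow> ennreal" where
  "hausdorff_outer n A =
     (SUP \<delta>\<in>{(0::real)<..}.
        INF C\<in>{C :: nat \<Rightarrow> 'a set. A \<subseteq> (\<Union>i. C i) \<and> (\<forall>i. bounded (C i) \<and> diameter (C i) \<le> \<delta>)}.
          \<Sum>i. ennreal (unit_ball_vol (real n) * (diameter (C i) / 2) ^ n))"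

definition hausdorff_measure :: "nat \<Rightarrow> 'a::metric_space measure" where
  "hausdorff_measure n = measure_of UNIV (sets borel) (hausdorff_outer n)"

definition surface_measure :: "'a::euclidean_space measure" where
  "surface_measure = hausdorff_measure (DIM('a) - 1)"

definition surface_integral :: "'a::euclidean_space set \<Rightarrow> ('a \<Rightarrow> real) \<Rightarrow> real" where
  "surface_integral S g = (LINT x:S|surface_measure. g x)"


section \<open>Sobolev spaces\<close>

definition square_integrable ::
    "'a measure \<Rightarrow> ('a \<Rightarrow> 'b::{real_normed_vector, second_countable_topology}) \<Rightarrow> bool" where
  "square_integrable M v \<longleftrightarrow> v \<in> borel_measurable M \<and> integrable M (\<lambda>x. (norm (v x))\<^sup>2)"

text \<open>Test functions are compactly supported in \<open>\<Omega>\<close> and of class \<open>C\<^sup>1\<close>.\<close>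

definition weak_gradient :: "'a::euclidean_space set \<Rightarrow> ('a \<Rightarrow> real) \<Rightarrow> ('a \<Rightarrow> 'a) \<Rightarrow> bool" where
  "weak_gradient \<Omega> v G \<longleftrightarrow>
     (\<forall>\<phi> \<phi>'. (\<forall>x. GDERIV \<phi> x :> \<phi>' x) \<and> continuous_on UNIV \<phi>' \<and>
        compact (closure {x. \<phi> x \<noteq> 0}) \<and> closure {x. \<phi> x \<noteq> 0} \<subseteq> \<Omega> \<longrightarrow>
        (LINT x|lebesgue_on \<Omega>. v x *\<^sub>R \<phi>' x) = - (LINT x|lebesgue_on \<Omega>. \<phi> x *\<^sub>R G x))"

definition H1 :: "'a::euclidean_space set \<Rightarrow> ('a \<Rightarrow> real) set" where
  "H1 \<Omega> = {v. square_integrable (lebesgue_on \<Omega>) v \<and>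
              (\<exists>G. square_integrable (lebesgue_on \<Omega>) G \<and> weak_gradient \<Omega> v G)}"

text \<open>The weak gradient is unique almost everywhere, so the choice does not affect integrals.\<close>

definition grad :: "'a::euclidean_space set \<Rightarrow> ('a \<Rightarrow> real) \<Rightarrow> 'a \<Rightarrow> 'a" where
  "grad \<Omega> v = (SOME G. square_integrable (lebesgue_on \<Omega>) G \<and> weak_gradient \<Omega> v G)"

definition h1_form :: "'a::euclidean_space set \<Rightarrow> ('a \<Rightarrow> real) \<Rightarrow> ('a \<Rightarrow> real) \<Rightarrow> real" where
  "h1_form \<Omega> u v = (LINT x|lebesgue_on \<Omega>. grad \<Omega> u x \<bullet> grad \<Omega> v x + u x * v x)"

definition h1_norm :: "'a::euclidean_space set \<Rightarrow> ('a \<Rightarrow> real) \<Rightarrow> real" where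
  "h1_norm \<Omega> v = sqrt (h1_form \<Omega> v v)"

text \<open>
  \<open>\<gamma>\<close> is the trace on \<open>\<partial>\<Omega>\<close> of \<open>v \<in> H\<^sup>1(\<Omega>)\<close>: the trace operator is the continuous extension,
  from \<open>H\<^sup>1(\<Omega>) \<inter> C\<^sup>0\<close> of the closed domain to \<open>H\<^sup>1(\<Omega>)\<close>, of the restriction to the boundary.
\<close>

definition has_trace :: "'a::euclidean_space set \<Rightarrow> ('a \<Rightarrow> real) \<Rightarrow> ('a \<Rightarrow> real) \<Rightarrow> bool" where
  "has_trace \<Omega> v \<gamma> \<longleftrightarrow>
     \<gamma> \<in> borel_measurable (restrict_space surface_measure (frontier \<Omega>)) \<and>
     (\<exists>w :: nat \<Rightarrow> 'a \<Rightarrow> real.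
        (\<forall>n. w n \<in> H1 \<Omega> \<and> continuous_on (closure \<Omega>) (w n)) \<and>
        (\<lambda>n. h1_norm \<Omega> (\<lambda>x. w n x - v x)) \<longlonglongrightarrow> 0 \<and>
        (\<lambda>n. \<integral>\<^sup>+x\<in>frontier \<Omega>. ennreal ((w n x - \<gamma> x)\<^sup>2) \<partial>surface_measure) \<longlonglongrightarrow> 0)"

text \<open>
  For \<open>S\<close> a part of \<open>\<partial>\<Omega>\<close>, the quotient norm of \<open>H\<^sup>1\<^sup>/\<^sup>2(S)\<close>, the space of traces on \<open>S\<close> of
  \<open>H\<^sup>1(\<Omega>)\<close>.  The value is \<open>\<infinity>\<close> exactly when \<open>g\<close> is not such a trace.
\<close>

definition h_half_norm :: "'a::euclidean_space set \<Rightarrow> 'a set \<Rightarrow> ('a \<Rightarrow> real) \<Rightarrow> ennreal" where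
  "h_half_norm \<Omega> S g =
     (INF v\<in>{v \<in> H1 \<Omega>. \<exists>\<gamma>. has_trace \<Omega> v \<gamma> \<and> (\<forall>x\<in>S. \<gamma> x = g x)}. ennreal (h1_norm \<Omega> v))"

text \<open>\<open>H\<^sup>1\<^sup>/\<^sup>2\<^sub>0\<^sub>0(\<Gamma>)\<close>: functions whose extension by zero to \<open>\<partial>\<Omega>\<close> is in \<open>H\<^sup>1\<^sup>/\<^sup>2(\<partial>\<Omega>)\<close>.\<close>

definition h_half00_norm :: "'a::euclidean_space set \<Rightarrow> 'a set \<Rightarrow> ('a \<Rightarrow> real) \<Rightarrow> ennreal" where
  "h_half00_norm \<Omega> \<Gamma> g = h_half_norm \<Omega> (frontier \<Omega>) (\<lambda>x. if x \<in> \<Gamma> then g x else 0)"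

text \<open>Dual norm with respect to the \<open>L\<^sup>2(\<Gamma>)\<close> pairing (supremum over the unit ball).\<close>

definition h_minus_half_norm :: "'a::euclidean_space set \<Rightarrow> 'a set \<Rightarrow> ('a \<Rightarrow> real) \<Rightarrow> ennreal" where
  "h_minus_half_norm \<Omega> \<Gamma> q =
     (SUP g\<in>{g. h_half00_norm \<Omega> \<Gamma> g \<le> 1}. ennreal \<bar>surface_integral \<Gamma> (\<lambda>x. q x * g x)\<bar>)"


section \<open>Domains and their faces\<close>

definition bounded_domain :: "'a::euclidean_space set \<Rightarrow> bool" where
  "bounded_domain \<Omega> \<longleftrightarrow> open \<Omega> \<and> connected \<Omega> \<and> bounded \<Omega> \<and> \<Omega> \<noteq> {}"

text \<open>
  Locally, \<open>\<Omega>\<close> is the strict epigraph in direction \<open>\<nu>\<close> of a \<open>C\<^sup>1\<^sup>,\<^sup>1\<close> function on the orthogonal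
  complement of \<open>\<nu>\<close> (extended to the whole space).
\<close>

definition C11_domain :: "'a::euclidean_space set \<Rightarrow> bool" where
  "C11_domain \<Omega> \<longleftrightarrow> bounded_domain \<Omega> \<and>
     (\<forall>x\<in>frontier \<Omega>. \<exists>r>0. \<exists>\<nu> \<phi> \<phi>' L.
        norm \<nu> = 1 \<and> (\<forall>y. GDERIV \<phi> y :> \<phi>' y) \<and> L-lipschitz_on UNIV \<phi>' \<and>
        (\<forall>y\<in>ball x r. y \<in> \<Omega> \<longleftrightarrow> \<phi> (y - (y \<bullet> \<nu>) *\<^sub>R \<nu>) < y \<bullet> \<nu>))"

text \<open>Polygons in dimension 2, polyhedra in dimension 3; not necessarily convex.\<close>

definition polyhedral_domain :: "'a::euclidean_space set \<Rightarrow> bool" where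
  "polyhedral_domain \<Omega> \<longleftrightarrow> bounded_domain \<Omega> \<and>
     (\<exists>\<P>. finite \<P> \<and> (\<forall>P\<in>\<P>. polytope P \<and> aff_dim P = int DIM('a)) \<and> \<Omega> = interior (\<Union>\<P>))"

text \<open>
  The library's \<^const>\<open>face_of\<close> only applies to convex sets.  For a polyhedral domain, a boundary
  point lies in a relatively open \<open>j\<close>-dimensional face iff the directions along which \<open>\<Omega>\<close> is
  translation invariant near that point form a space of dimension \<open>j\<close>.  A \<open>C\<^sup>1\<^sup>,\<^sup>1\<close> domain has no
  vertices (and, in dimension 3, no edges); its faces of codimension one are the components of
  its boundary.
\<close>

definition invariance_directions :: "'a::euclidean_space set \<Rightarrow> 'a \<Rightarrow> 'a set" where
  "invariance_directions \<Omega> x =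
     {v. \<exists>e>0. \<forall>y\<in>ball x e. \<forall>t. y + t *\<^sub>R v \<in> ball x e \<longrightarrow> (y \<in> \<Omega> \<longleftrightarrow> y + t *\<^sub>R v \<in> \<Omega>)}"

definition domain_faces :: "nat \<Rightarrow> 'a::euclidean_space set \<Rightarrow> 'a set set" where
  "domain_faces j \<Omega> =
     {F. polyhedral_domain \<Omega> \<and>
         F \<in> closure ` components {x \<in> frontier \<Omega>. dim (invariance_directions \<Omega> x) = j}} \<union>
     {F. C11_domain \<Omega> \<and> j + 1 = DIM('a) \<and> F \<in> components (frontier \<Omega>)}"

definition interface :: "('k \<Rightarrow> 'a::euclidean_space set) \<Rightarrow> 'k \<Rightarrow> 'k \<Rightarrow> 'a set" where
  "interface D k l = frontier (D k) \<inter> frontier (D l)"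

definition adjacent :: "('k \<Rightarrow> 'a::euclidean_space set) \<Rightarrow> 'k \<Rightarrow> 'k \<Rightarrow> bool" where
  "adjacent D k l \<longleftrightarrow> k \<noteq> l \<and>
     interface D k l \<in> domain_faces (DIM('a) - 1) (D k) \<inter> domain_faces (DIM('a) - 1) (D l)"

definition conforming_decomposition ::
    "'a::euclidean_space set \<Rightarrow> ('k::finite \<Rightarrow> 'a set) \<Rightarrow> bool" where
  "conforming_decomposition \<Omega> D \<longleftrightarrow>
     (C11_domain \<Omega> \<or> polyhedral_domain \<Omega> \<and> convex \<Omega>) \<and>
     (\<forall>k. (C11_domain (D k) \<or> polyhedral_domain (D k)) \<and> D k \<subseteq> \<Omega>) \<and>
     closure \<Omega> = (\<Union>k. closure (D k)) \<and>
     (\<forall>k l. k \<noteq> l \<longrightarrow> D k \<inter> D l = {} \<and>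
        (closure (D k) \<inter> closure (D l) = {} \<or>
         (\<exists>j<DIM('a). closure (D k) \<inter> closure (D l) \<in> domain_faces j (D k) \<inter> domain_faces j (D l))))"


section \<open>Meshes and finite element spaces\<close>

definition insphere_diameter :: "'a::euclidean_space set \<Rightarrow> real" where
  "insphere_diameter T = 2 * Sup {r. 0 \<le> r \<and> (\<exists>x. cball x r \<subseteq> T)}"

definition mesh_size :: "('k::finite \<Rightarrow> 'a::euclidean_space set set) \<Rightarrow> real" where
  "mesh_size \<T> = Max (\<Union>k. diameter ` \<T> k)"

definition uniformly_regular_meshes ::
    "real \<Rightarrow> real \<Rightarrow> ('k::finite \<Rightarrow> 'a::euclidean_space set) \<Rightarrow> ('k \<Rightarrow> 'a set set) \<Rightarrow> bool" where
  "uniformly_regular_meshes \<sigma> \<tau> D \<T> \<longleftrightarrow>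
     (\<forall>k. triangulation (\<T> k) \<and> (\<forall>T\<in>\<T> k. int DIM('a) simplex T) \<and> closure (D k) = \<Union>(\<T> k) \<and>
        (\<forall>T\<in>\<T> k. diameter T / insphere_diameter T \<le> \<sigma> \<and> \<tau> * mesh_size \<T> \<le> diameter T))"

text \<open>Polynomials of total degree at most \<open>n\<close>; \<open>m\<close> ranges over the exponents of monomials.\<close>

definition polys :: "nat \<Rightarrow> ('a::euclidean_space \<Rightarrow> real) set" where
  "polys n = {q. \<exists>c :: ('a \<Rightarrow> nat) \<Rightarrow> real. \<forall>x.
     q x = (\<Sum>m\<in>{m \<in> Basis \<rightarrow>\<^sub>E {..n}. (\<Sum>b\<in>Basis. m b) \<le> n}. c m * (\<Prod>b\<in>Basis. (x \<bullet> b) ^ m b))}"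

text \<open>
  A function on a set \<open>S\<close> is represented by its extension by zero to the whole space, so that
  equality in the spaces below is equality of functions on \<open>S\<close>.
\<close>

definition restrict0 :: "'a set \<Rightarrow> ('a \<Rightarrow> real) \<Rightarrow> 'a \<Rightarrow> real" where
  "restrict0 S v = (\<lambda>x. if x \<in> S then v x else 0)"

definition fe_space :: "nat \<Rightarrow> 'a::euclidean_space set \<Rightarrow> 'a set set \<Rightarrow> ('a \<Rightarrow> real) set" where
  "fe_space n S \<M> = {v. continuous_on S v \<and> (\<forall>x. x \<notin> S \<longrightarrow> v x = 0) \<and>
                        (\<forall>T\<in>\<M>. \<exists>q\<in>polys n. \<forall>x\<in>T. v x = q x)}"

definition Yh :: "nat \<Rightarrow> ('k \<Rightarrow> 'a::euclidean_space set) \<Rightarrow> ('k \<Rightarrow> 'a set set) \<Rightarrow> 'k \<Rightarrow> ('a \<Rightarrow> real) set"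
  where "Yh n D \<T> k = fe_space n (closure (D k)) (\<T> k)"

definition Xh ::
    "nat \<Rightarrow> 'a::euclidean_space set \<Rightarrow> ('k \<Rightarrow> 'a set) \<Rightarrow> ('k \<Rightarrow> 'a set set) \<Rightarrow> 'k \<Rightarrow> ('a \<Rightarrow> real) set"
  where "Xh n \<Omega> D \<T> k = {v \<in> Yh n D \<T> k. \<forall>x\<in>frontier (D k) \<inter> frontier \<Omega>. v x = 0}"

definition trace_mesh ::
    "('k \<Rightarrow> 'a::euclidean_space set) \<Rightarrow> ('k \<Rightarrow> 'a set set) \<Rightarrow> 'k \<Rightarrow> 'k \<Rightarrow> 'a set set" where
  "trace_mesh D \<T> k l = {F. F \<subseteq> interface D k l \<and> (\<exists>T\<in>\<T> k. F facet_of T)}"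

definition trace_space ::
    "nat \<Rightarrow> ('k \<Rightarrow> 'a::euclidean_space set) \<Rightarrow> ('k \<Rightarrow> 'a set set) \<Rightarrow> 'k \<Rightarrow> 'k \<Rightarrow> ('a \<Rightarrow> real) set" where
  "trace_space n D \<T> k l = restrict0 (interface D k l) ` Yh n D \<T> k"

definition meshes_fit_interfaces ::
    "nat \<Rightarrow> ('k \<Rightarrow> 'a::euclidean_space set) \<Rightarrow> ('k \<Rightarrow> 'a set set) \<Rightarrow> bool" where
  "meshes_fit_interfaces n D \<T> \<longleftrightarrow>
     (\<forall>k l. adjacent D k l \<longrightarrow>
        interface D k l = \<Union>(trace_mesh D \<T> k l) \<and>
        trace_space n D \<T> k l = fe_space n (interface D k l) (trace_mesh D \<T> k l))"


section \<open>Multiplier spaces\<close>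

text \<open>
  In dimension 2 the end points of the interface, a segment, are its extreme points, so the
  elements of the trace mesh containing one of them are the first and the last one.
\<close>

definition multiplier_space_2d ::
    "nat \<Rightarrow> ('k \<Rightarrow> 'a::euclidean_space set) \<Rightarrow> ('k \<Rightarrow> 'a set set) \<Rightarrow> 'k \<Rightarrow> 'k \<Rightarrow> ('a \<Rightarrow> real) set" where
  "multiplier_space_2d n D \<T> k l =
     {q \<in> trace_space n D \<T> k l.
        \<forall>F\<in>trace_mesh D \<T> k l. (\<exists>x\<in>F. x extreme_point_of interface D k l) \<longrightarrow>
          (\<exists>r\<in>polys (n - 1). \<forall>x\<in>F. q x = r x)}"

definition function_subspace :: "('a \<Rightarrow> real) set \<Rightarrow> bool" where
  "function_subspace S \<longleftrightarrow> (\<lambda>x. 0) \<in> S \<and> (\<forall>u\<in>S. \<forall>v\<in>S. (\<lambda>x. u x + v x) \<in> S) \<and>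
     (\<forall>c. \<forall>u\<in>S. (\<lambda>x. c * u x) \<in> S)"

text \<open>
  In dimension 3 the multiplier space is a linear subspace of the trace space which is only
  specified by the properties \<open>multiplier_stability\<close> and \<open>multiplier_approximation\<close> below.
\<close>

definition multiplier_spaces ::
    "nat \<Rightarrow> ('k \<Rightarrow> 'a::euclidean_space set) \<Rightarrow> ('k \<Rightarrow> 'a set set) \<Rightarrow> ('k \<Rightarrow> 'k \<Rightarrow> ('a \<Rightarrow> real) set) \<Rightarrow> bool"
  where
  "multiplier_spaces n D \<T> W \<longleftrightarrow>
     (\<forall>k l. adjacent D k l \<longrightarrow>
        function_subspace (W k l) \<and> W k l \<subseteq> trace_space n D \<T> k l \<and>
        (DIM('a) = 2 \<longrightarrow> W k l = multiplier_space_2d n D \<T> k l))"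

definition multiplier_stability ::
    "real \<Rightarrow> nat \<Rightarrow> 'a::euclidean_space set \<Rightarrow> ('k \<Rightarrow> 'a set) \<Rightarrow> ('k \<Rightarrow> 'a set set) \<Rightarrow>
     ('k \<Rightarrow> 'k \<Rightarrow> ('a \<Rightarrow> real) set) \<Rightarrow> bool" where
  "multiplier_stability cs n \<Omega> D \<T> W \<longleftrightarrow>
     (\<forall>k l. adjacent D k l \<longrightarrow> (\<forall>q\<in>W k l. \<exists>w\<in>Xh n \<Omega> D \<T> k.
        (\<forall>x\<in>frontier (D k) - interface D k l. w x = 0) \<and>
        (h_minus_half_norm (D k) (interface D k l) q)\<^sup>2
          \<le> ennreal (surface_integral (interface D k l) (\<lambda>x. q x * w x)) \<and>
        ennreal (h1_norm (D k) w) \<le> ennreal cs * h_minus_half_norm (D k) (interface D k l) q))"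

definition is_L2_projection ::
    "'a::euclidean_space set \<Rightarrow> ('a \<Rightarrow> real) set \<Rightarrow> ('a \<Rightarrow> real) \<Rightarrow> ('a \<Rightarrow> real) \<Rightarrow> bool" where
  "is_L2_projection \<Gamma> S v w \<longleftrightarrow>
     w \<in> S \<and> (\<forall>\<psi>\<in>S. surface_integral \<Gamma> (\<lambda>x. (w x - v x) * \<psi> x) = 0)"

definition multiplier_approximation ::
    "real \<Rightarrow> nat \<Rightarrow> 'a::euclidean_space set \<Rightarrow> ('k::finite \<Rightarrow> 'a set) \<Rightarrow> ('k \<Rightarrow> 'a set set) \<Rightarrow>
     ('k \<Rightarrow> 'k \<Rightarrow> ('a \<Rightarrow> real) set) \<Rightarrow> bool" where
  "multiplier_approximation C n \<Omega> D \<T> W \<longleftrightarrow>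
     (\<forall>k l. adjacent D k l \<longrightarrow> (\<forall>v\<in>Xh n \<Omega> D \<T> k. \<forall>w.
        is_L2_projection (interface D k l) (W k l) v w \<longrightarrow>
        ennreal (surface_integral (interface D k l) (\<lambda>x. (w x - v x)\<^sup>2))
          \<le> ennreal (C * mesh_size \<T>) * (h_half_norm (D k) (interface D k l) v)\<^sup>2))"


section \<open>The discrete problem and the iterative algorithm\<close>

text \<open>
  An element of the product over \<open>l\<close> of the spaces \<open>W k l\<close> is a family indexed by all \<open>l\<close>, with
  zero components for the \<open>l\<close> that are not adjacent to \<open>k\<close>.
\<close>

definition Wh ::
    "('k \<Rightarrow> 'a::euclidean_space set) \<Rightarrow> ('k \<Rightarrow> 'k \<Rightarrow> ('a \<Rightarrow> real) set) \<Rightarrow> 'k \<Rightarrow> ('k \<Rightarrow> 'a \<Rightarrow> real) set"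
  where
  "Wh D W k = {q. \<forall>l. if adjacent D k l then q l \<in> W k l else q l = (\<lambda>x. 0)}"

definition boundary_pairing ::
    "('k::finite \<Rightarrow> 'a::euclidean_space set) \<Rightarrow> 'k \<Rightarrow> ('k \<Rightarrow> 'a \<Rightarrow> real) \<Rightarrow> ('a \<Rightarrow> real) \<Rightarrow> real" where
  "boundary_pairing D k q v =
     (\<Sum>l\<in>{l. adjacent D k l}. surface_integral (interface D k l) (\<lambda>x. q l x * v x))"

definition Vh ::
    "nat \<Rightarrow> 'a::euclidean_space set \<Rightarrow> ('k::finite \<Rightarrow> 'a set) \<Rightarrow> ('k \<Rightarrow> 'a set set) \<Rightarrow>
     ('k \<Rightarrow> 'k \<Rightarrow> ('a \<Rightarrow> real) set) \<Rightarrow> real \<Rightarrow> (('k \<Rightarrow> 'a \<Rightarrow> real) \<times> ('k \<Rightarrow> 'k \<Rightarrow> 'a \<Rightarrow> real)) set" where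
  "Vh n \<Omega> D \<T> W \<alpha> =
     {(u, p). (\<forall>k. u k \<in> Xh n \<Omega> D \<T> k) \<and> (\<forall>k. p k \<in> Wh D W k) \<and>
        (\<forall>k l. adjacent D k l \<longrightarrow> (\<forall>\<psi>\<in>W k l.
           surface_integral (interface D k l)
             (\<lambda>x. ((p k l x + \<alpha> * u k x) - (- p l k x + \<alpha> * u l x)) * \<psi> x) = 0))}"

definition discrete_solutions ::
    "nat \<Rightarrow> 'a::euclidean_space set \<Rightarrow> ('k::finite \<Rightarrow> 'a set) \<Rightarrow> ('k \<Rightarrow> 'a set set) \<Rightarrow>
     ('k \<Rightarrow> 'k \<Rightarrow> ('a \<Rightarrow> real) set) \<Rightarrow> real \<Rightarrow> ('a \<Rightarrow> real) \<Rightarrow>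
     (('k \<Rightarrow> 'a \<Rightarrow> real) \<times> ('k \<Rightarrow> 'k \<Rightarrow> 'a \<Rightarrow> real)) set" where
  "discrete_solutions n \<Omega> D \<T> W \<alpha> f =
     {(u, p) \<in> Vh n \<Omega> D \<T> W \<alpha>.
        \<forall>v. (\<forall>k. v k \<in> Xh n \<Omega> D \<T> k) \<longrightarrow>
          (\<Sum>k\<in>UNIV. h1_form (D k) (u k) (v k)) - (\<Sum>k\<in>UNIV. boundary_pairing D k (p k) (v k))
            = (\<Sum>k\<in>UNIV. LINT x|lebesgue_on (D k). f x * v k x)}"

text \<open>
  The possible new iterates on subdomain \<open>k\<close>, where \<open>u\<close> and \<open>p\<close> are the previous iterates on all
  subdomains.
\<close>

definition next_iterates ::
    "nat \<Rightarrow> 'a::euclidean_space set \<Rightarrow> ('k::finite \<Rightarrow> 'a set) \<Rightarrow> ('k \<Rightarrow> 'a set set) \<Rightarrow>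
     ('k \<Rightarrow> 'k \<Rightarrow> ('a \<Rightarrow> real) set) \<Rightarrow> real \<Rightarrow> ('a \<Rightarrow> real) \<Rightarrow>
     ('k \<Rightarrow> 'a \<Rightarrow> real) \<Rightarrow> ('k \<Rightarrow> 'k \<Rightarrow> 'a \<Rightarrow> real) \<Rightarrow> 'k \<Rightarrow> (('a \<Rightarrow> real) \<times> ('k \<Rightarrow> 'a \<Rightarrow> real)) set" where
  "next_iterates n \<Omega> D \<T> W \<alpha> f u p k =
     {(u', p'). u' \<in> Xh n \<Omega> D \<T> k \<and> p' \<in> Wh D W k \<and>
        (\<forall>v\<in>Xh n \<Omega> D \<T> k.
           h1_form (D k) u' v - boundary_pairing D k p' v = (LINT x|lebesgue_on (D k). f x * v x)) \<and>
        (\<forall>l. adjacent D k l \<longrightarrow> (\<forall>\<psi>\<in>W k l.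
           surface_integral (interface D k l) (\<lambda>x. (p' l x + \<alpha> * u' x) * \<psi> x) =
           surface_integral (interface D k l) (\<lambda>x. (- p l k x + \<alpha> * u l x) * \<psi> x)))}"

end

theory Submission
  imports Defs "HOL-Library.Function_Algebras"
begin

text \<open>
  On an interface \<open>\<Gamma>\<close> of \<open>D k\<close> and \<open>D l\<close>, with \<open>\<pi>\<close> the \<open>L\<^sup>2\<close> projection onto the multiplier space,
  \<open>4\<alpha> \<integral> p u = \<integral> (p + \<alpha> \<pi> u)\<^sup>2 - \<integral> (- p + \<alpha> \<pi> u)\<^sup>2\<close>.  Inserting this in the energy identity of the
  error and using that \<open>p + \<alpha> \<pi> u\<close> is the projection of the data \<open>- p' + \<alpha> u'\<close> sent by the neighbour
  in the previous step, whose distance from \<open>- p' + \<alpha> \<pi> u'\<close> is controlled by \<open>\<alpha>\<^sup>2 h \<parallel>u'\<parallel>\<^sup>2\<close>, one gets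
  \<open>E' + B' \<le> B + \<theta> E\<close> with \<open>E\<close> the sum of the squared \<open>H\<^sup>1\<close> norms, \<open>B\<close> the outgoing Robin data and
  \<open>\<theta> = O(\<alpha> h) < 1\<close>.  Hence \<open>E\<close> is summable along the iteration; for a fixed point it vanishes, which
  gives uniqueness and, the problems being finite-dimensional and square, existence.  The
  multipliers are controlled by the stability property (a).

  This requires that all integrals involved are well behaved.  Interfaces are unions of facets of
  simplices; the Hausdorff measure is a Borel measure, finite and positive on them, and two
  interfaces of a subdomain overlap in a null set, since at almost every point of an interface
  the two subdomains are half balls.  Finite element functions are in \<open>H\<^sup>1\<close>, and weak gradients are
  unique.
\<close>

section \<open>Hausdorff measure as a Borel measure\<close>

text \<open>The meshes on the two sides of an interface need not match, so the datum sent by a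
  neighbour in general lies in neither multiplier space. The sender splits off its projection error,
  which costs a term of order \<alpha>\<alpha>h; the receiver projects what arrives, which only
  decreases the norm. The energy carries the factor 4\<alpha>, hence the condition on \<alpha>h:
  with at most \<open>CARD('k)\<close> neighbours, each costing \<open>\<bar>C\<bar>\<close>, the
  error uses up at most one of the four \<alpha>. The outgoing data need not shrink by a factor, so
  the estimate gives summability without a rate. Solvability rests on injectivity. The energy forces
  u = 0, then (a) forces the dual norm of p to vanish, and p = 0 follows because this norm separates
  continuous functions. The separating function is a bump that vanishes on the rest of the boundary,
  a second use of the half balls. \<open>grad\<close> is a choice and
  \<open>hausdorff_measure\<close> is built by \<open>measure_of\<close>, so bilinearity of the H1
  form and the values of the measure must be established first.\<close>

theorem metric_outer_measure_borel:
  fixes f :: "'a::metric_space set \<Rightarrow> ennreal"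
  assumes empty: "f {} = 0" and mono: "\<And>A B. A \<subseteq> B \<Longrightarrow> f A \<le> f B"
    and subadd: "\<And>A :: nat \<Rightarrow> 'a set. f (\<Union>i. A i) \<le> (\<Sum>i. f (A i))"
    and metric: "\<And>A B e. \<lbrakk>e > 0; \<And>x y. \<lbrakk>x \<in> A; y \<in> B\<rbrakk> \<Longrightarrow> e \<le> dist x y\<rbrakk> \<Longrightarrow> f A + f B \<le> f (A \<union> B)"
  shows "measure_space UNIV (sets borel) f"
proof -
  have oms: "outer_measure_space (Pow UNIV) f"
    unfolding outer_measure_space_def positive_def increasing_def countably_subadditive_def
    using empty mono subadd by simp
  interpret P: sigma_algebra UNIV "Pow UNIV :: 'a set set" by (rule sigma_algebra_Pow)
  let ?L = "lambda_system UNIV (Pow UNIV) f"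
  have ms: "measure_space UNIV ?L f"
    using P.caratheodory_lemma[OF oms] .
  have un2: "f (A \<union> B) \<le> f A + f B" for A B
  proof -
    have "f (A \<union> B) \<le> f (\<Union>i::nat. binaryset A B i)" by (simp add: UN_binaryset_eq)
    also have "\<dots> \<le> (\<Sum>i. f (binaryset A B i))" by (rule subadd)
    also have "\<dots> = f A + f B"
      using suminf_binaryset_eq[of f A B] empty by simp
    finally show ?thesis .
  qed
  \<comment> \<open>Caratheodory's criterion for a closed set, the converse of subadditivity.
    \<open>A - F\<close> may touch \<open>F\<close>, so it is exhausted by the sets
    \<open>E n\<close> at distance at least \<open>s n\<close> from \<open>F\<close>, to which the
    metric property applies.\<close>
  have key: "f (A \<inter> F) + f (A - F) \<le> f A" if F: "closed F" "F \<noteq> {}" for A F :: "'a set"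
  proof (cases "f A = top")
    case True then show ?thesis by simp
  next
    case False
    define s where "s k = 1 / real (Suc k)" for k
    have s_pos: "s k > 0" for k by (simp add: s_def)
    have s_dec: "s (Suc k) < s k" for k by (simp add: s_def divide_simps)
    have s_anti: "s j \<le> s k" if "k \<le> j" for j k using that by (simp add: s_def divide_simps)
    \<comment> \<open>The shells left out by the sets \<open>E n\<close>. Two shells of the same
      parity are separated by the shell between them, so the even and the odd shells sum to at most
      \<open>f A\<close> each. The tail of this convergent series bounds what \<open>E N\<close>
      misses.\<close>
    define R where "R k = {x \<in> A. s (Suc k) \<le> infdist x F \<and> infdist x F < s k}" for k
    define E where "E n = {x \<in> A. s n \<le> infdist x F}" for n
    have sep: "infdist x F - infdist y F \<le> dist x y" for x y
      using infdist_triangle[of x F y] by simp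
    have metE: "f (A \<inter> F) + f (E n) \<le> f A" for n
    proof -
      have "f (E n) + f (A \<inter> F) \<le> f (E n \<union> (A \<inter> F))"
      proof (rule metric[OF s_pos[of n]])
        fix x y assume "x \<in> E n" "y \<in> A \<inter> F"
        then show "s n \<le> dist x y" using sep[of x y] by (simp add: E_def)
      qed
      also have "\<dots> \<le> f A" by (rule mono) (auto simp: E_def)
      finally show ?thesis by (simp add: add.commute)
    qed
    have tails: "(\<Sum>k<N. f (R (2 * k + b))) \<le> f (\<Union>k<N. R (2 * k + b))" for N b
    proof (induction N)
      case 0 then show ?case by simp
    next
      case (Suc N)
      have "(\<Sum>k<Suc N. f (R (2 * k + b))) \<le> f (\<Union>k<N. R (2 * k + b)) + f (R (2 * N + b))"
        using Suc by (simp add: add_right_mono)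
      also have "\<dots> \<le> f ((\<Union>k<N. R (2 * k + b)) \<union> R (2 * N + b))"
      proof (rule metric)
        \<comment> \<open>For \<open>N = 0\<close> the union is empty and any positive gap serves;
          with \<open>b = 0\<close> the truncated index would make the difference 0.\<close>
        show "0 < (if N = 0 then 1 else s (2 * N + b - 1) - s (2 * N + b))"
          using s_dec[of "2 * N + b - 1"] by (cases "2 * N + b") auto
        fix x y assume x: "x \<in> (\<Union>k<N. R (2 * k + b))" and y: "y \<in> R (2 * N + b)"
        then obtain k where k: "k < N" "x \<in> R (2 * k + b)" by auto
        then have "s (2 * N + b - 1) \<le> s (Suc (2 * k + b))" by (intro s_anti) auto
        then show "(if N = 0 then 1 else s (2 * N + b - 1) - s (2 * N + b)) \<le> dist x y"
          using sep[of x y] k y by (auto simp: R_def)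
      qed
      also have "\<dots> = f (\<Union>k<Suc N. R (2 * k + b))" by (simp add: lessThan_Suc Un_commute)
      finally show ?case .
    qed
    have bnd: "(\<Sum>k<N. f (R (2 * k + b))) \<le> f A" for N b
      by (rule order_trans[OF tails]) (auto intro!: mono simp: R_def)
    have fR: "f (R k) < top" for k
      using mono[of "R k" A] False by (auto simp: R_def less_top intro: le_less_trans)
    define r where "r k = enn2real (f (R k))" for k
    have r: "f (R k) = ennreal (r k)" "0 \<le> r k" for k
      using fR[of k] by (auto simp: r_def)
    obtain a where a: "f A = ennreal a" "0 \<le> a" using False by (cases "f A") auto
    have "(\<Sum>k<2 * N. r k) = (\<Sum>k<N. r (2 * k)) + (\<Sum>k<N. r (2 * k + 1))" for N
      by (induction N) (auto simp: algebra_simps)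
    moreover have "(\<Sum>k<N. r (2 * k + b)) \<le> a" for N b
      using bnd[where N=N and b=b] a r by (simp add: sum_nonneg)
    from this[where b=0] this[where b=1] have "(\<Sum>k<N. r (2 * k)) + (\<Sum>k<N. r (2 * k + 1)) \<le> a + a" for N
      by (intro add_mono) simp_all
    moreover have "(\<Sum>k<N. r k) \<le> (\<Sum>k<2 * N. r k)" for N
      by (intro sum_mono2) (auto simp: r)
    ultimately have "(\<Sum>k<N. r k) \<le> a + a" for N by (metis order_trans)
    then have summ: "summable r" by (intro summableI_nonneg_bounded r)
    show ?thesis
    proof (rule ennreal_le_epsilon)
      fix e :: real assume e: "0 < e"
      obtain N where N: "norm (\<Sum>i. r (i + N)) < e"
        using suminf_exist_split[OF e summ] by blast
      have cover: "A - F \<subseteq> E N \<union> (\<Union>i. R (i + N))"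
      proof
        fix x assume x: "x \<in> A - F"
        then have p: "infdist x F > 0"
          using F infdist_pos_not_in_closed by blast
        show "x \<in> E N \<union> (\<Union>i. R (i + N))"
        proof (cases "s N \<le> infdist x F")
          case True then show ?thesis using x by (simp add: E_def)
        next
          case less: False
          obtain m where m: "s m < infdist x F"
            using reals_Archimedean[OF p] by (auto simp: s_def inverse_eq_divide)
          \<comment> \<open>The first radius not exceeding the distance puts \<open>x\<close> in
            shell \<open>j - 1\<close>. It comes after \<open>N\<close>, because \<open>s N\<close>
            still exceeds the distance.\<close>
          define j where "j = (LEAST j. s j \<le> infdist x F)"
          have j: "s j \<le> infdist x F" unfolding j_def by (rule LeastI[of _ m]) (use m in simp)
          have jN: "N < j" using less j s_anti[of j N] by (meson linorder_not_less order_trans)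
          have "\<not> s (j - 1) \<le> infdist x F"
            using not_less_Least[of "j - 1" "\<lambda>j. s j \<le> infdist x F"] jN unfolding j_def by simp
          then have "x \<in> R (j - 1)" using j jN x by (auto simp: R_def)
          then have "x \<in> R ((j - 1 - N) + N)" using jN by simp
          then show ?thesis by blast
        qed
      qed
      have "f (A - F) \<le> f (E N) + f (\<Union>i. R (i + N))"
        using mono[OF cover] un2 order_trans by blast
      also have "f (\<Union>i. R (i + N)) \<le> (\<Sum>i. f (R (i + N)))" by (rule subadd)
      also have "\<dots> = ennreal (\<Sum>i. r (i + N))"
        unfolding r(1) by (rule suminf_ennreal2) (auto simp: r summ summable_ignore_initial_segment)
      also have "\<dots> \<le> ennreal e" using N by (intro ennreal_leI) auto
      finally have "f (A - F) \<le> f (E N) + ennreal e" by (simp add: add_left_mono)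
      then have "f (A \<inter> F) + f (A - F) \<le> (f (A \<inter> F) + f (E N)) + ennreal e"
        by (metis add.assoc add_left_mono)
      also have "\<dots> \<le> f A + ennreal e" using metE by (rule add_right_mono)
      finally show "f (A \<inter> F) + f (A - F) \<le> f A + ennreal e" .
    qed
  qed
  have closed_L: "F \<in> ?L" if "closed F" for F
  proof -
    have "f (F \<inter> x) + f ((UNIV - F) \<inter> x) = f x" for x
    proof (cases "F = {}")
      case True then show ?thesis using empty by simp
    next
      case False
      have "f x \<le> f (x \<inter> F) + f (x - F)" using un2[of "x \<inter> F" "x - F"] by (simp add: Int_Diff_Un)
      with key[OF that False, of x] have "f (x \<inter> F) + f (x - F) = f x" by simp
      moreover have "(UNIV - F) \<inter> x = x - F" by auto
      ultimately show ?thesis by (simp add: Int_commute)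
    qed
    then show ?thesis by (simp add: lambda_system_def)
  qed
  interpret L: sigma_algebra UNIV ?L using ms by (simp add: measure_space_def)
  have "sets (borel :: 'a measure) = sigma_sets UNIV (Collect closed)"
    by (simp add: borel_eq_closed)
  also have "\<dots> \<subseteq> ?L"
    using closed_L by (intro L.sigma_sets_subset subsetI) (simp only: mem_Collect_eq)
  finally show ?thesis
    using measure_down[OF ms] sets.sigma_algebra_axioms[of "borel :: 'a measure"] by simp
qed

text \<open>The outer measure at the fixed scale \<open>\<delta>\<close>. Covers can be merged and
  cut apart at a fixed scale, so subadditivity and separation are proved here before the supremum is
  taken.\<close>

definition hausdorff_content :: "nat \<Rightarrow> real \<Rightarrow> 'a::metric_space set \<Rightarrow> ennreal" where
  "hausdorff_content n \<delta> A =
     (INF C\<in>{C :: nat \<Rightarrow> 'a set. A \<subseteq> (\<Union>i. C i) \<and> (\<forall>i. bounded (C i) \<and> diameter (C i) \<le> \<delta>)}.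
        \<Sum>i. ennreal (unit_ball_vol (real n) * (diameter (C i) / 2) ^ n))"

lemma hausdorff_outer_content: "hausdorff_outer n A = (SUP \<delta>\<in>{0<..}. hausdorff_content n \<delta> A)"
  unfolding hausdorff_outer_def hausdorff_content_def ..

lemma hausdorff_content_le:
  assumes "A \<subseteq> (\<Union>i. C i)" "\<And>i. bounded (C i)" "\<And>i. diameter (C i) \<le> \<delta>"
  shows "hausdorff_content n \<delta> A \<le> (\<Sum>i. ennreal (unit_ball_vol (real n) * (diameter (C i) / 2) ^ n))"
  unfolding hausdorff_content_def by (rule INF_lower) (use assms in auto)

lemma hausdorff_content_mono:
  assumes "A \<subseteq> B" shows "hausdorff_content n \<delta> A \<le> hausdorff_content n \<delta> B"
  unfolding hausdorff_content_def by (rule INF_superset_mono) (use assms in auto)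

lemma hausdorff_content_antimono:
  assumes "\<delta> \<le> \<delta>'" shows "hausdorff_content n \<delta>' A \<le> hausdorff_content n \<delta> A"
  unfolding hausdorff_content_def using assms
  by (intro INF_superset_mono) (auto intro: order_trans)

lemma hausdorff_content_less:
  assumes "hausdorff_content n \<delta> A < b"
  obtains C where "A \<subseteq> (\<Union>i. C i)" "\<And>i. bounded (C i)" "\<And>i. diameter (C i) \<le> \<delta>"
    "(\<Sum>i. ennreal (unit_ball_vol (real n) * (diameter (C i) / 2) ^ n)) < b"
  using assms unfolding hausdorff_content_def INF_less_iff by auto

text \<open>Covers of the single sets, optimal up to \<open>e * (1/2)^Suc i\<close>, are merged into
  one sequence by \<open>prod_decode\<close>.\<close>

lemma hausdorff_content_Union:
  "hausdorff_content n \<delta> (\<Union>i. A i) \<le> (\<Sum>i. hausdorff_content n \<delta> (A i))"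
proof (rule ennreal_le_epsilon)
  fix e :: real assume "0 < e" and fin: "(\<Sum>i. hausdorff_content n \<delta> (A i)) < top"
  let ?w = "\<lambda>C. ennreal (unit_ball_vol (real n) * (diameter C / 2) ^ n)"
  have lt: "hausdorff_content n \<delta> (A i) < hausdorff_content n \<delta> (A i) + e * (1/2)^Suc i" for i
    using fin \<open>0 < e\<close> by (auto simp add: less_top dest!: ennreal_suminf_lessD)
  have "\<exists>C. A i \<subseteq> (\<Union>j. C j) \<and> (\<forall>j. bounded (C j) \<and> diameter (C j) \<le> \<delta>) \<and>
      (\<Sum>j. ?w (C j)) \<le> hausdorff_content n \<delta> (A i) + e * (1/2)^Suc i" for i
    using hausdorff_content_less[OF lt[of i]] by (metis less_imp_le)
  then obtain B where B: "\<And>i. A i \<subseteq> (\<Union>j. B i j)" "\<And>i j. bounded (B i j)"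
      "\<And>i j. diameter (B i j) \<le> \<delta>"
      "\<And>i. (\<Sum>j. ?w (B i j)) \<le> hausdorff_content n \<delta> (A i) + e * (1/2)^Suc i"
    by metis
  define C where "C = case_prod B o prod_decode"
  have "(\<Union>i. A i) \<subseteq> (\<Union>i. C i)"
  proof
    fix x assume "x \<in> (\<Union>i. A i)"
    then obtain i j where "x \<in> B i j" using B(1) by blast
    then have "x \<in> C (prod_encode (i, j))" by (simp add: C_def)
    then show "x \<in> (\<Union>i. C i)" by blast
  qed
  then have "hausdorff_content n \<delta> (\<Union>i. A i) \<le> (\<Sum>i. ?w (C i))"
    by (intro hausdorff_content_le) (auto simp: C_def B split: prod.split)
  also have "\<dots> = (\<Sum>i. (\<lambda>(i, j). ?w (B i j)) (prod_decode i))"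
    by (simp add: C_def case_prod_unfold)
  also have "\<dots> = (\<Sum>i. \<Sum>j. ?w (B i j))"
    by (rule suminf_ennreal_2dimen) simp
  also have "\<dots> \<le> (\<Sum>i. hausdorff_content n \<delta> (A i) + e * (1/2)^Suc i)"
    by (intro suminf_le allI B) auto
  also have "\<dots> = (\<Sum>i. hausdorff_content n \<delta> (A i)) + (\<Sum>i. ennreal e * ennreal ((1/2) ^ Suc i))"
    using \<open>0 < e\<close> by (subst suminf_add[symmetric])
      (auto simp del: ennreal_suminf_cmult simp add: ennreal_mult[symmetric])
  also have "\<dots> = (\<Sum>i. hausdorff_content n \<delta> (A i)) + e"
    unfolding ennreal_suminf_cmult
    by (subst suminf_ennreal_eq[OF zero_le_power power_half_series]) auto
  finally show "hausdorff_content n \<delta> (\<Union>i. A i) \<le> (\<Sum>i. hausdorff_content n \<delta> (A i)) + e" .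
qed

text \<open>A set of diameter at most \<open>\<delta> < e\<close> cannot meet both \<open>A\<close>
  and \<open>B\<close>, so a cover of the union splits into a cover of \<open>A\<close> and one of
  \<open>B\<close> that share no index.\<close>

lemma hausdorff_content_separated:
  assumes "\<delta> < e" "n \<ge> 1" and sep: "\<And>x y. \<lbrakk>x \<in> A; y \<in> B\<rbrakk> \<Longrightarrow> e \<le> dist x y"
  shows "hausdorff_content n \<delta> A + hausdorff_content n \<delta> B \<le> hausdorff_content n \<delta> (A \<union> B)"
  unfolding hausdorff_content_def[of n \<delta> "A \<union> B"]
proof (rule INF_greatest)
  fix C :: "nat \<Rightarrow> 'a set"
  assume "C \<in> {C. A \<union> B \<subseteq> (\<Union>i. C i) \<and> (\<forall>i. bounded (C i) \<and> diameter (C i) \<le> \<delta>)}"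
  then have C: "A \<union> B \<subseteq> (\<Union>i. C i)" "\<And>i. bounded (C i)" "\<And>i. diameter (C i) \<le> \<delta>" by auto
  let ?w = "\<lambda>C. ennreal (unit_ball_vol (real n) * (diameter C / 2) ^ n)"
  \<comment> \<open>Discarded sets are replaced by \<open>{}\<close>, whose weight is 0 because
    \<open>n \<ge> 1\<close>.\<close>
  define P where "P S i = (if C i \<inter> S = {} then {} else C i)" for S i
  have \<delta>0: "0 \<le> \<delta>" using C(3)[of 0] diameter_ge_0[OF C(2)[of 0]] by linarith
  have le: "hausdorff_content n \<delta> S \<le> (\<Sum>i. ?w (P S i))" if "S \<subseteq> A \<union> B" for S
  proof (rule hausdorff_content_le)
    show "S \<subseteq> (\<Union>i. P S i)"
    proof
      fix x assume "x \<in> S"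
      then have "x \<in> (\<Union>i. C i)" using subset_trans[OF that C(1)] by (rule rev_subsetD)
      then obtain i where "x \<in> C i" by (rule UN_E)
      then show "x \<in> (\<Union>i. P S i)" using \<open>x \<in> S\<close> by (auto simp: P_def intro!: exI[of _ i])
    qed
    show "bounded (P S i)" "diameter (P S i) \<le> \<delta>" for i
      using C(2,3)[of i] \<delta>0 by (auto simp: P_def)
  qed
  have w0: "?w {} = 0" using assms(2) by simp
  have "?w (P A i) + ?w (P B i) \<le> ?w (C i)" for i
  proof (cases "C i \<inter> A = {} \<or> C i \<inter> B = {}")
    case True then show ?thesis by (auto simp: P_def w0 simp del: diameter_empty)
  next
    case False
    then obtain x y where "x \<in> C i" "x \<in> A" "y \<in> C i" "y \<in> B" by blast
    then have "e \<le> \<delta>" using sep[of x y] diameter_bounded_bound[OF C(2), of x i y] C(3)[of i] by linarith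
    with assms(1) show ?thesis by simp
  qed
  then have "(\<Sum>i. ?w (P A i) + ?w (P B i)) \<le> (\<Sum>i. ?w (C i))"
    by (intro suminf_le) auto
  moreover have "(\<Sum>i. ?w (P A i) + ?w (P B i)) = (\<Sum>i. ?w (P A i)) + (\<Sum>i. ?w (P B i))"
    by (rule suminf_add[symmetric]) auto
  ultimately show "hausdorff_content n \<delta> A + hausdorff_content n \<delta> B \<le> (\<Sum>i. ?w (C i))"
    using add_mono[OF le[of A] le[of B]] by simp
qed

lemma measure_space_hausdorff_outer:
  assumes n: "n \<ge> 1"
  shows "measure_space UNIV (sets (borel :: 'a::metric_space measure)) (hausdorff_outer n)"
proof (rule metric_outer_measure_borel)
  have "hausdorff_content n \<delta> ({} :: 'a set) \<le> 0" if "\<delta> > 0" for \<delta>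
  proof -
    have "hausdorff_content n \<delta> ({} :: 'a set) \<le>
        (\<Sum>i::nat. ennreal (unit_ball_vol (real n) * (diameter ({} :: 'a set) / 2) ^ n))"
      by (rule hausdorff_content_le) (use that in auto)
    also have "\<dots> = 0" using n by (simp add: power_0_left)
    finally show ?thesis .
  qed
  then show "hausdorff_outer n ({} :: 'a set) = 0"
    unfolding hausdorff_outer_content by (auto intro!: SUP_eqI)
next
  fix A B :: "'a set" assume "A \<subseteq> B"
  then show "hausdorff_outer n A \<le> hausdorff_outer n B"
    unfolding hausdorff_outer_content by (intro SUP_mono') (rule hausdorff_content_mono)
next
  fix A :: "nat \<Rightarrow> 'a set"
  show "hausdorff_outer n (\<Union>i. A i) \<le> (\<Sum>i. hausdorff_outer n (A i))"
    unfolding hausdorff_outer_content[of n "\<Union>i. A i"]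
  proof (rule SUP_least)
    fix \<delta> :: real assume "\<delta> \<in> {0<..}"
    then have "hausdorff_content n \<delta> (A i) \<le> hausdorff_outer n (A i)" for i
      unfolding hausdorff_outer_content by (rule SUP_upper)
    then have "(\<Sum>i. hausdorff_content n \<delta> (A i)) \<le> (\<Sum>i. hausdorff_outer n (A i))"
      by (intro suminf_le) auto
    with hausdorff_content_Union show "hausdorff_content n \<delta> (\<Union>i. A i) \<le> (\<Sum>i. hausdorff_outer n (A i))"
      by (rule order_trans)
  qed
next
  fix A B :: "'a set" and e :: real
  assume e: "e > 0" and sep: "\<And>x y. \<lbrakk>x \<in> A; y \<in> B\<rbrakk> \<Longrightarrow> e \<le> dist x y"
  have *: "hausdorff_content n \<delta>1 A + hausdorff_content n \<delta>2 B \<le> hausdorff_outer n (A \<union> B)"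
    if "\<delta>1 > 0" "\<delta>2 > 0" for \<delta>1 \<delta>2
  proof -
    \<comment> \<open>Separation is available only below the scale \<open>e\<close>. Contents grow
      as the scale shrinks, so a common smaller scale serves for independent
      \<open>\<delta>1\<close> and \<open>\<delta>2\<close>, and both suprema can be taken.\<close>
    define \<delta> where "\<delta> = min (e/2) (min \<delta>1 \<delta>2)"
    have \<delta>: "0 < \<delta>" "\<delta> < e" "\<delta> \<le> \<delta>1" "\<delta> \<le> \<delta>2" using that e by (auto simp: \<delta>_def)
    have "hausdorff_content n \<delta>1 A + hausdorff_content n \<delta>2 B \<le>
        hausdorff_content n \<delta> A + hausdorff_content n \<delta> B"
      using \<delta> by (intro add_mono hausdorff_content_antimono) auto
    also have "\<dots> \<le> hausdorff_content n \<delta> (A \<union> B)"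
      by (rule hausdorff_content_separated[OF \<delta>(2) n sep])
    also have "\<dots> \<le> hausdorff_outer n (A \<union> B)"
      unfolding hausdorff_outer_content by (rule SUP_upper) (use \<delta> in simp)
    finally show ?thesis .
  qed
  have ne: "{0::real<..} \<noteq> {}" by (simp add: greaterThan_non_empty)
  show "hausdorff_outer n A + hausdorff_outer n B \<le> hausdorff_outer n (A \<union> B)"
    unfolding hausdorff_outer_content[of n A] hausdorff_outer_content[of n B]
      ennreal_SUP_add_left[OF ne, symmetric]
  proof (rule SUP_least)
    fix \<delta>1 :: real assume "\<delta>1 \<in> {0<..}"
    then show "hausdorff_content n \<delta>1 A + (SUP \<delta>\<in>{0<..}. hausdorff_content n \<delta> B) \<le> hausdorff_outer n (A \<union> B)"
      using *[of \<delta>1] unfolding add.commute[of "hausdorff_content n \<delta>1 A"] ennreal_SUP_add_left[OF ne, symmetric]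
      by (intro SUP_least) (metis add.commute greaterThan_iff)
  qed
qed

lemma sets_hausdorff_measure [simp, measurable_cong]: "sets (hausdorff_measure n) = sets borel"
  unfolding hausdorff_measure_def by (metis sets.sigma_sets_eq space_borel sets_measure_of subset_UNIV Pow_UNIV)

lemma space_hausdorff_measure [simp]: "space (hausdorff_measure n) = UNIV"
  unfolding hausdorff_measure_def by (simp add: space_measure_of_conv)

text \<open>\<open>measure_of\<close> returns the given set function only if it is a measure on the
  \<sigma>-algebra, which is what \<open>measure_space_hausdorff_outer\<close> provides.\<close>

lemma emeasure_hausdorff_measure:
  fixes A :: "'a::metric_space set"
  assumes "n \<ge> 1" "A \<in> sets borel"
  shows "emeasure (hausdorff_measure n) A = hausdorff_outer n A"
proof -
  have "measure_space UNIV (sets (borel :: 'a measure)) (hausdorff_outer n)"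
    by (rule measure_space_hausdorff_outer[OF assms(1)])
  then show ?thesis
    unfolding hausdorff_measure_def using assms(2)
    by (intro emeasure_measure_of_sigma) (simp_all add: measure_space_def)
qed

section \<open>Hausdorff measure of flat sets\<close>

lemma hausdorff_content_le_finite:
  assumes "finite \<C>" "A \<subseteq> \<Union>\<C>" "\<And>C. C \<in> \<C> \<Longrightarrow> bounded C \<and> diameter C \<le> d"
    and "0 \<le> d" "d \<le> \<delta>" "n \<ge> 1"
  shows "hausdorff_content n \<delta> A \<le> of_nat (card \<C>) * ennreal (unit_ball_vol (real n) * (d / 2) ^ n)"
proof -
  obtain h where h: "bij_betw h {0..<card \<C>} \<C>"
    using ex_bij_betw_nat_finite[OF assms(1)] by blast
  define C where "C i = (if i < card \<C> then h i else {})" for i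
  let ?w = "\<lambda>C. ennreal (unit_ball_vol (real n) * (diameter C / 2) ^ n)"
  have hC: "h i \<in> \<C>" if "i < card \<C>" for i using h that by (auto simp: bij_betw_def)
  have "hausdorff_content n \<delta> A \<le> (\<Sum>i. ?w (C i))"
  proof (rule hausdorff_content_le)
    have "\<Union>\<C> = (\<Union>i<card \<C>. h i)" using h by (auto simp: bij_betw_def atLeast0LessThan)
    also have "\<dots> \<subseteq> (\<Union>i. C i)" by (auto simp: C_def)
    finally show "A \<subseteq> (\<Union>i. C i)" by (rule subset_trans[OF assms(2)])
    show "bounded (C i)" for i using assms(3)[OF hC, of i] by (simp add: C_def)
    show "diameter (C i) \<le> \<delta>" for i
      using assms(3)[OF hC, of i] assms(4,5) by (auto simp: C_def)
  qed
  also have "\<dots> = (\<Sum>i<card \<C>. ?w (C i))"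
    using assms(6) by (intro suminf_finite) (auto simp: C_def power_0_left)
  also have "\<dots> \<le> (\<Sum>i<card \<C>. ennreal (unit_ball_vol (real n) * (d / 2) ^ n))"
  proof (intro sum_mono ennreal_leI mult_left_mono power_mono)
    fix i assume "i \<in> {..<card \<C>}"
    then have i: "bounded (C i)" "diameter (C i) \<le> d" using assms(3)[OF hC, of i] by (auto simp: C_def)
    show "diameter (C i) / 2 \<le> d / 2" "0 \<le> diameter (C i) / 2"
      using i diameter_ge_0[OF i(1)] by auto
  qed auto
  finally show ?thesis by simp
qed

text \<open>In orthonormal coordinates of its direction space, of dimension at most
  \<open>m\<close>, the set lies in a cube that is cut into a grid with \<open>N\<close> cells in
  each direction.\<close>

lemma flat_cover:
  fixes S :: "'a::euclidean_space set"
  assumes bS: "bounded S" and dS: "aff_dim S \<le> int m"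
  obtains c where "c \<ge> 0"
    "\<And>N. N \<ge> 1 \<Longrightarrow> \<exists>\<C>. finite \<C> \<and> card \<C> \<le> N ^ m \<and> S \<subseteq> \<Union>\<C> \<and>
       (\<forall>C\<in>\<C>. bounded C \<and> diameter C \<le> c / real N)"
proof (cases "S = {}")
  case True
  show ?thesis by (rule that[of 0]) (auto simp: True intro!: exI[of _ "{}"])
next
  case False
  then obtain x0 where x0: "x0 \<in> S" by blast
  define V where "V = span ((\<lambda>x. x - x0) ` S)"
  obtain B where B: "B \<subseteq> V" "pairwise orthogonal B" "\<And>b. b \<in> B \<Longrightarrow> norm b = 1"
      "independent B" "card B = dim V" "span B = V"
    using orthonormal_basis_subspace[of V] unfolding V_def by (metis subspace_span)
  have finB: "finite B" using B(4) by (rule independent_imp_finite)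
  have "aff_dim S = int (dim ((\<lambda>x. x - x0) ` S))"
    using aff_dim_eq_dim_subtract[of x0 S] x0 by (simp add: hull_inc)
  then have cardB: "card B \<le> m" using B(5) dS by (simp add: V_def)
  obtain R0 where R0: "\<And>x. x \<in> S \<Longrightarrow> norm (x - x0) \<le> R0"
    using bS x0 bounded_any_center[of S x0] by (auto simp: dist_norm norm_minus_commute)
  \<comment> \<open>The extra 1 makes the coordinates strictly smaller than \<open>R\<close>, so
    that the rescaled ones stay below \<open>N\<close> and their floors are legal cell
    indices.\<close>
  define R where "R = R0 + 1"
  have Rpos: "R > 0" using R0[OF x0] by (simp add: R_def)
  have coord: "\<bar>(x - x0) \<bullet> b\<bar> < R" if "x \<in> S" "b \<in> B" for x b
    using Cauchy_Schwarz_ineq2[of "x - x0" b] R0[OF that(1)] B(3)[OF that(2)] by (simp add: R_def)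
  have expand: "z = (\<Sum>b\<in>B. (z \<bullet> b) *\<^sub>R b)" if "z \<in> V" for z
  proof -
    have *: "w \<bullet> b = 0" if w: "w = z - (\<Sum>b\<in>B. (z \<bullet> b) *\<^sub>R b)" and b: "b \<in> B" for w b
    proof -
      have "(\<Sum>b'\<in>B. (z \<bullet> b') * (b' \<bullet> b)) = (\<Sum>b'\<in>B. if b' = b then z \<bullet> b else 0)"
      proof (rule sum.cong[OF refl])
        fix b' assume "b' \<in> B"
        then show "(z \<bullet> b') * (b' \<bullet> b) = (if b' = b then z \<bullet> b else 0)"
          using B(2) B(3)[OF b] b by (auto simp: pairwise_def orthogonal_def dot_square_norm)
      qed
      also have "\<dots> = z \<bullet> b" using finB b by (simp add: sum.delta)
      finally show ?thesis by (simp add: w inner_diff_left inner_sum_left)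
    qed
    define w where "w = z - (\<Sum>b\<in>B. (z \<bullet> b) *\<^sub>R b)"
    have "w \<in> span B" unfolding w_def using that B(6)
      by (intro span_diff span_sum span_scale) (auto intro: span_base)
    moreover have "\<And>b. b \<in> B \<Longrightarrow> orthogonal w b" using *[OF w_def] by (simp add: orthogonal_def)
    ultimately have "orthogonal w w" by (rule orthogonal_to_span)
    then show ?thesis by (simp add: w_def orthogonal_self)
  qed
  show ?thesis
  \<comment> \<open>Within a cell each of the at most \<open>m\<close> coordinates varies by at most
    \<open>2 * R / N\<close>; the diameter is bounded by the sum of these variations.\<close>
  proof (rule that[of "real m * (2 * R)"])
    show "0 \<le> real m * (2 * R)" using Rpos by simp
    fix N :: nat assume N: "N \<ge> 1"
    define cell where "cell \<kappa> = {x \<in> S. \<forall>b\<in>B. real (\<kappa> b) \<le> ((x - x0) \<bullet> b + R) / (2 * R) * N \<and>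
        ((x - x0) \<bullet> b + R) / (2 * R) * N \<le> real (\<kappa> b) + 1}" for \<kappa>
    let ?K = "B \<rightarrow>\<^sub>E {..<N}"
    have "S \<subseteq> \<Union>(cell ` ?K)"
    proof
      fix x assume x: "x \<in> S"
      define t where "t b = ((x - x0) \<bullet> b + R) / (2 * R) * N" for b
      have t: "0 \<le> t b" "t b < N" if "b \<in> B" for b
      proof -
        have "0 \<le> ((x - x0) \<bullet> b + R) / (2 * R)" "((x - x0) \<bullet> b + R) / (2 * R) < 1"
          using coord[OF x that] Rpos by (auto simp: divide_simps abs_if split: if_splits)
        then show "0 \<le> t b" "t b < N" unfolding t_def using N mult_strict_right_mono[of _ 1 "real N"]
          by (simp_all only: mult_1 zero_le_mult_iff of_nat_0_le_iff) (simp_all add: Suc_le_eq)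
      qed
      define \<kappa> where "\<kappa> = restrict (\<lambda>b. nat \<lfloor>t b\<rfloor>) B"
      have "\<kappa> \<in> ?K" using t by (auto simp: \<kappa>_def nat_less_iff floor_less_iff)
      moreover have "real (\<kappa> b) \<le> t b \<and> t b \<le> real (\<kappa> b) + 1" if "b \<in> B" for b
      proof -
        have "real (\<kappa> b) = of_int \<lfloor>t b\<rfloor>" using t(1)[OF that] that by (simp add: \<kappa>_def)
        then show ?thesis by linarith
      qed
      then have "x \<in> cell \<kappa>" using x unfolding cell_def t_def by blast
      ultimately show "x \<in> \<Union>(cell ` ?K)" by blast
    qed
    moreover have "bounded (cell \<kappa>)" for \<kappa>
      by (rule bounded_subset[OF bS]) (auto simp: cell_def)
    moreover have "diameter (cell \<kappa>) \<le> real m * (2 * R) / real N" for \<kappa>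
    proof (rule diameter_le)
      show "cell \<kappa> \<noteq> {} \<or> 0 \<le> real m * (2 * R) / real N" using Rpos by simp
      fix x y assume xy: "x \<in> cell \<kappa>" "y \<in> cell \<kappa>"
      have "(x - x0) \<in> V" "(y - x0) \<in> V" using xy by (auto simp: cell_def V_def intro: span_base)
      then have "x - y \<in> V" unfolding V_def using span_diff by fastforce
      then have "norm (x - y) = norm (\<Sum>b\<in>B. ((x - y) \<bullet> b) *\<^sub>R b)" using expand by metis
      also have "\<dots> \<le> (\<Sum>b\<in>B. norm (((x - y) \<bullet> b) *\<^sub>R b))" by (rule norm_sum)
      also have "\<dots> \<le> (\<Sum>b\<in>B. 2 * R / N)"
      proof (rule sum_mono)
        fix b assume b: "b \<in> B"
        let ?s = "((x - x0) \<bullet> b + R) / (2 * R) * N" and ?t = "((y - x0) \<bullet> b + R) / (2 * R) * N"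
        have "\<bar>?s - ?t\<bar> \<le> 1" using xy b by (auto simp: cell_def abs_le_iff) (smt (verit))+
        moreover have "?s - ?t = ((x - y) \<bullet> b) * N / (2 * R)"
          using Rpos by (simp add: field_simps inner_diff_left)
        ultimately have "\<bar>(x - y) \<bullet> b\<bar> \<le> 2 * R / N"
          using Rpos N by (simp add: abs_mult divide_simps)
        then show "norm (((x - y) \<bullet> b) *\<^sub>R b) \<le> 2 * R / N" using B(3)[OF b] by simp
      qed
      also have "\<dots> \<le> real m * (2 * R) / N"
        using cardB Rpos N by (simp add: divide_simps mult_right_mono)
      finally show "norm (x - y) \<le> real m * (2 * R) / real N" .
    qed
    moreover have "finite (cell ` ?K)" by (intro finite_imageI finite_PiE finB) simp
    moreover have "card (cell ` ?K) \<le> N ^ m"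
    proof -
      have "card (cell ` ?K) \<le> card ?K" by (intro card_image_le finite_PiE finB) simp
      also have "\<dots> = N ^ card B" using finB by (simp add: card_PiE)
      also have "\<dots> \<le> N ^ m" using cardB N by (intro power_increasing) auto
      finally show ?thesis .
    qed
    ultimately show "\<exists>\<C>. finite \<C> \<and> card \<C> \<le> N ^ m \<and> S \<subseteq> \<Union>\<C> \<and>
       (\<forall>C\<in>\<C>. bounded C \<and> diameter C \<le> real m * (2 * R) / real N)"
      by (intro exI[of _ "cell ` ?K"]) auto
  qed
qed

text \<open>There are at most \<open>N ^ m\<close> cells, each of weight proportional to
  \<open>1 / N ^ n\<close>: the bound is constant in \<open>N\<close> for \<open>m = n\<close> and
  tends to 0 for \<open>m < n\<close>. The condition \<open>c \<le> \<delta> * real N\<close> makes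
  the cells admissible at scale \<open>\<delta>\<close>.\<close>

lemma hausdorff_content_flat:
  fixes S :: "'a::euclidean_space set"
  assumes "bounded S" "aff_dim S \<le> int m"
  obtains c where "c \<ge> 0"
    "\<And>n \<delta> N. \<lbrakk>n \<ge> 1; N \<ge> 1; c \<le> \<delta> * real N\<rbrakk> \<Longrightarrow>
       hausdorff_content n \<delta> S \<le> ennreal (real N ^ m * (unit_ball_vol (real n) * (c / (2 * real N)) ^ n))"
proof -
  obtain c where c: "c \<ge> 0"
    "\<And>N. N \<ge> 1 \<Longrightarrow> \<exists>\<C>. finite \<C> \<and> card \<C> \<le> N ^ m \<and> S \<subseteq> \<Union>\<C> \<and>
       (\<forall>C\<in>\<C>. bounded C \<and> diameter C \<le> c / real N)"
    using flat_cover[OF assms] by blast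
  show ?thesis
  proof (rule that[OF c(1)])
    fix n N :: nat and \<delta> :: real assume n: "n \<ge> 1" and N: "N \<ge> 1" and \<delta>: "c \<le> \<delta> * real N"
    obtain \<C> where \<C>: "finite \<C>" "card \<C> \<le> N ^ m" "S \<subseteq> \<Union>\<C>"
       "\<And>C. C \<in> \<C> \<Longrightarrow> bounded C \<and> diameter C \<le> c / real N"
      using c(2)[OF N] by blast
    let ?b = "unit_ball_vol (real n) * (c / real N / 2) ^ n"
    have "hausdorff_content n \<delta> S \<le> of_nat (card \<C>) * ennreal ?b"
      using c(1) N n \<delta> by (intro hausdorff_content_le_finite \<C>) (auto simp: divide_simps)
    also have "\<dots> = ennreal (real (card \<C>) * ?b)"
      using c(1) by (simp add: ennreal_mult ennreal_of_nat_eq_real_of_nat)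
    also have "\<dots> \<le> ennreal (real N ^ m * ?b)"
    proof (intro ennreal_leI mult_right_mono)
      show "real (card \<C>) \<le> real N ^ m" using \<C>(2) by (metis of_nat_le_iff of_nat_power)
    qed (use c(1) in simp)
    finally show "hausdorff_content n \<delta> S \<le> ennreal (real N ^ m * (unit_ball_vol (real n) * (c / (2 * real N)) ^ n))"
      by (simp add: mult.commute)
  qed
qed

lemma hausdorff_outer_flat_finite:
  fixes S :: "'a::euclidean_space set"
  assumes "bounded S" "aff_dim S \<le> int n" "n \<ge> 1"
  shows "hausdorff_outer n S < top"
proof -
  obtain c where c: "c \<ge> 0"
    "\<And>\<delta> N. \<lbrakk>N \<ge> 1; c \<le> \<delta> * real N\<rbrakk> \<Longrightarrow>
       hausdorff_content n \<delta> S \<le> ennreal (real N ^ n * (unit_ball_vol (real n) * (c / (2 * real N)) ^ n))"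
    using hausdorff_content_flat[OF assms(1,2)] assms(3) by metis
  have "hausdorff_outer n S \<le> ennreal (unit_ball_vol (real n) * (c / 2) ^ n)"
    unfolding hausdorff_outer_content
  proof (rule SUP_least)
    fix \<delta> :: real assume "\<delta> \<in> {0<..}"
    then obtain N :: nat where N: "c / \<delta> < real N" using reals_Archimedean2 by blast
    define N' where "N' = Suc N"
    have "c \<le> \<delta> * real N'" using N \<open>\<delta> \<in> {0<..}\<close> by (auto simp: N'_def field_simps)
    then have "hausdorff_content n \<delta> S \<le> ennreal (real N' ^ n * (unit_ball_vol (real n) * (c / (2 * real N')) ^ n))"
      by (intro c(2)) (auto simp: N'_def)
    also have "real N' ^ n * (unit_ball_vol (real n) * (c / (2 * real N')) ^ n) = unit_ball_vol (real n) * (c / 2) ^ n"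
    proof -
      have "real N' * (c / (2 * real N')) = c / 2" by (simp add: N'_def field_simps)
      then have "real N' ^ n * (c / (2 * real N')) ^ n = (c / 2) ^ n" by (metis power_mult_distrib)
      then show ?thesis by (simp only: mult.left_commute)
    qed
    finally show "hausdorff_content n \<delta> S \<le> ennreal (unit_ball_vol (real n) * (c / 2) ^ n)" .
  qed
  then show ?thesis using le_less_trans ennreal_less_top by blast
qed

lemma hausdorff_outer_flat_null:
  fixes S :: "'a::euclidean_space set"
  assumes "bounded S" "aff_dim S < int n" "n \<ge> 1"
  shows "hausdorff_outer n S = 0"
proof -
  obtain m where m: "n = Suc m" using assms(3) by (cases n) auto
  have "aff_dim S \<le> int m" using assms(2) m by simp
  then obtain c where c: "c \<ge> 0"
    "\<And>\<delta> N. \<lbrakk>N \<ge> 1; c \<le> \<delta> * real N\<rbrakk> \<Longrightarrow>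
       hausdorff_content n \<delta> S \<le> ennreal (real N ^ m * (unit_ball_vol (real n) * (c / (2 * real N)) ^ n))"
    using hausdorff_content_flat[OF assms(1)] assms(3) by metis
  have "hausdorff_content n \<delta> S \<le> 0" if \<delta>: "\<delta> > 0" for \<delta>
  proof (rule ennreal_le_epsilon)
    fix e :: real assume e: "0 < e"
    define b where "b = unit_ball_vol (real n) * (c / 2) ^ n"
    have b: "b \<ge> 0" using c(1) by (simp add: b_def)
    obtain N :: nat where N: "max (c / \<delta>) (b / e) < real N" using reals_Archimedean2 by blast
    define N' where "N' = Suc N"
    have N': "c \<le> \<delta> * real N'" "b / real N' \<le> e"
      using N \<delta> e b by (auto simp: N'_def field_simps)
    then have "hausdorff_content n \<delta> S \<le> ennreal (real N' ^ m * (unit_ball_vol (real n) * (c / (2 * real N')) ^ n))"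
      by (intro c(2)) (auto simp: N'_def)
    also have "real N' ^ m * (unit_ball_vol (real n) * (c / (2 * real N')) ^ n) = b / real N'"
    proof -
      have "real N' * (c / (2 * real N')) = c / 2" by (simp add: N'_def field_simps)
      then have "real N' ^ m * (c / (2 * real N')) ^ m = (c / 2) ^ m" by (metis power_mult_distrib)
      then have "real N' ^ m * (c / (2 * real N')) ^ n = (c / 2) ^ m * (c / (2 * real N'))"
        by (simp add: m)
      then have "unit_ball_vol (real n) * (real N' ^ m * (c / (2 * real N')) ^ n) = b / real N'"
        by (auto simp: b_def m)
      then show ?thesis by (simp only: mult.left_commute)
    qed
    finally show "hausdorff_content n \<delta> S \<le> 0 + ennreal e"
      using ennreal_leI[OF N'(2)] by simp
  qed
  then show ?thesis unfolding hausdorff_outer_content by (auto intro!: SUP_eqI)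
qed

text \<open>The prism of height 1 over a set of diameter \<open>d\<close> is covered by about
  \<open>1 / d\<close> balls of radius \<open>2 * d\<close>, of total volume of order
  \<open>d ^ n\<close>. This turns a Hausdorff weight into a Lebesgue volume one dimension
  higher.\<close>

lemma thicken_cover:
  fixes C :: "'a::euclidean_space set"
  assumes C: "bounded C" "diameter C \<le> 1" and \<nu>: "norm \<nu> = 1" and n: "DIM('a) = Suc n" "n \<ge> 1"
  obtains Z where "Z \<in> sets borel" "\<And>y t. \<lbrakk>y \<in> C; 0 \<le> t; t \<le> 1\<rbrakk> \<Longrightarrow> y + t *\<^sub>R \<nu> \<in> Z"
    "emeasure lborel Z \<le> ennreal (3 * unit_ball_vol (real DIM('a)) * 2 ^ DIM('a) * diameter C ^ n)"
proof (cases "C = {}")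
  case True
  show ?thesis by (rule that[of "{}"]) (auto simp: True)
next
  case False
  then obtain y0 where y0: "y0 \<in> C" by blast
  \<comment> \<open>There are at most \<open>1 / d + 2 \<le> 3 / d\<close> balls, each of volume
    \<open>unit_ball_vol (real DIM('a)) * (2 * d) ^ DIM('a)\<close>.\<close>
  let ?\<kappa> = "3 * unit_ball_vol (real DIM('a)) * 2 ^ DIM('a)"
  define Z where "Z d = (\<Union>j<Suc (nat \<lceil>1 / d\<rceil>). cball (y0 + (real j * d) *\<^sub>R \<nu>) (2 * d))" for d
  have Z_sets: "Z d \<in> sets borel" for d unfolding Z_def by auto
  have Z_in: "y + t *\<^sub>R \<nu> \<in> Z d" if y: "y \<in> C" and t: "0 \<le> t" "t \<le> 1" and d: "0 < d" "diameter C \<le> d" for y t d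
  proof -
    define j where "j = nat \<lfloor>t / d\<rfloor>"
    have j: "real j * d \<le> t" "t \<le> (real j + 1) * d"
    proof -
      have "real j = of_int \<lfloor>t / d\<rfloor>" using t d by (simp add: j_def)
      then have "real j \<le> t / d" "t / d \<le> real j + 1" by linarith+
      then show "real j * d \<le> t" "t \<le> (real j + 1) * d" using d(1) by (simp_all only: pos_le_divide_eq pos_divide_le_eq)
    qed
    have "j < Suc (nat \<lceil>1 / d\<rceil>)"
    proof -
      have "t / d \<le> 1 / d" using t d by (simp add: divide_right_mono)
      then have "\<lfloor>t / d\<rfloor> \<le> \<lceil>1 / d\<rceil>" by linarith
      then show ?thesis by (simp add: j_def less_Suc_eq_le nat_mono)
    qed
    moreover have "dist (y0 + (real j * d) *\<^sub>R \<nu>) (y + t *\<^sub>R \<nu>) \<le> 2 * d"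
    proof -
      have "y0 + (real j * d) *\<^sub>R \<nu> - (y + t *\<^sub>R \<nu>) = (y0 - y) + (real j * d - t) *\<^sub>R \<nu>"
        by (simp add: algebra_simps)
      then have "dist (y0 + (real j * d) *\<^sub>R \<nu>) (y + t *\<^sub>R \<nu>) \<le> norm (y0 - y) + norm ((real j * d - t) *\<^sub>R \<nu>)"
        unfolding dist_norm by (metis norm_triangle_ineq)
      then have "dist (y0 + (real j * d) *\<^sub>R \<nu>) (y + t *\<^sub>R \<nu>) \<le> dist y0 y + \<bar>real j * d - t\<bar>"
        using \<nu> by (simp add: dist_norm)
      moreover have "dist y0 y \<le> d" using diameter_bounded_bound[OF C(1) y0 y] d by linarith
      moreover have "\<bar>real j * d - t\<bar> \<le> d" using j by (simp add: abs_if algebra_simps)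
      ultimately show ?thesis by linarith
    qed
    ultimately show ?thesis unfolding Z_def by auto
  qed
  have Z_le: "emeasure lborel (Z d) \<le> ennreal (?\<kappa> * d ^ n)" if d: "0 < d" "d \<le> 1" for d
  proof -
    have "emeasure lborel (Z d) \<le> (\<Sum>j<Suc (nat \<lceil>1 / d\<rceil>). emeasure lborel (cball (y0 + (real j * d) *\<^sub>R \<nu>) (2 * d)))"
      unfolding Z_def by (rule emeasure_subadditive_finite) auto
    also have "\<dots> = (\<Sum>j<Suc (nat \<lceil>1 / d\<rceil>). ennreal (unit_ball_vol (real DIM('a)) * (2 * d) ^ DIM('a)))"
      using d by (intro sum.cong refl emeasure_cball) simp
    also have "\<dots> = ennreal (real (Suc (nat \<lceil>1 / d\<rceil>)) * (unit_ball_vol (real DIM('a)) * (2 * d) ^ DIM('a)))"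
      using d by (simp only: sum_constant card_lessThan ennreal_of_nat_eq_real_of_nat)
        (intro ennreal_mult[symmetric] of_nat_0_le_iff mult_nonneg_nonneg; simp)
    also have "\<dots> \<le> ennreal (3 / d * (unit_ball_vol (real DIM('a)) * (2 * d) ^ DIM('a)))"
    proof (intro ennreal_leI mult_right_mono)
      have "1 \<le> 1 / d" using d by simp
      then show "real (Suc (nat \<lceil>1 / d\<rceil>)) \<le> 3 / d" by simp linarith
    qed (use d in simp)
    also have "3 / d * (unit_ball_vol (real DIM('a)) * (2 * d) ^ DIM('a)) = ?\<kappa> * d ^ n"
      using d by (simp add: n power_mult_distrib)
    finally show ?thesis .
  qed
  show ?thesis
  proof (cases "diameter C = 0")
    case False
    then have "0 < diameter C" using diameter_ge_0[OF C(1)] by simp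
    then show ?thesis using C(2) by (intro that[of "Z (diameter C)"] Z_sets Z_in Z_le) auto
  next
    \<comment> \<open>A single point has diameter 0, and the claim then asks for a null set: the
      covers for \<open>d = 1 / real (Suc k)\<close> are intersected.\<close>
    case True
    define Z0 where "Z0 = (\<Inter>k. Z (1 / real (Suc k)))"
    have sets: "Z0 \<in> sets borel" unfolding Z0_def using Z_sets by auto
    have "emeasure lborel Z0 \<le> 0"
    proof (rule ennreal_le_epsilon)
      fix e :: real assume e: "0 < e"
      obtain k :: nat where k: "?\<kappa> / e < real k" using reals_Archimedean2 by blast
      have "emeasure lborel Z0 \<le> emeasure lborel (Z (1 / real (Suc k)))"
        by (rule emeasure_mono) (auto simp: Z0_def Z_sets)
      also have "\<dots> \<le> ennreal (?\<kappa> * (1 / real (Suc k)) ^ n)" by (rule Z_le) auto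
      also have "\<dots> \<le> ennreal e"
      proof (rule ennreal_leI)
        have "(1 / real (Suc k)) ^ n \<le> (1 / real (Suc k)) ^ 1"
          using n by (intro power_decreasing) auto
        then have "?\<kappa> * (1 / real (Suc k)) ^ n \<le> ?\<kappa> * (1 / real (Suc k))"
          by (intro mult_left_mono) auto
        also have "\<dots> \<le> e" using k e by (simp add: field_simps)
        finally show "?\<kappa> * (1 / real (Suc k)) ^ n \<le> e" .
      qed
      finally show "emeasure lborel Z0 \<le> 0 + ennreal e" by simp
    qed
    then show ?thesis
      by (intro that[of Z0] sets) (use True in \<open>auto simp: Z0_def intro!: Z_in\<close>)
  qed
qed

text \<open>A null disc would have covers of arbitrarily small weight. Thickened along the normal,
  they would cover a fixed ball by sets of smaller total volume.\<close>

lemma hausdorff_outer_disc_pos: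
  fixes x0 a :: "'a::euclidean_space"
  assumes n: "DIM('a) = Suc n" "n \<ge> 1" and a: "a \<noteq> 0" and r: "r > 0"
  shows "hausdorff_outer n {x \<in> ball x0 r. a \<bullet> x = a \<bullet> x0} > 0"
proof (rule ccontr)
  let ?D = "{x \<in> ball x0 r. a \<bullet> x = a \<bullet> x0}"
  let ?w = "\<lambda>C. ennreal (unit_ball_vol (real n) * (diameter C / 2) ^ n)"
  assume "\<not> hausdorff_outer n ?D > 0"
  then have zero: "hausdorff_outer n ?D = 0" by simp
  define \<nu> where "\<nu> = a /\<^sub>R norm a"
  have \<nu>: "norm \<nu> = 1" using a by (simp add: \<nu>_def)
  \<comment> \<open>\<open>2 * s \<le> r\<close> keeps the feet of the perpendiculars inside the
    disc; \<open>s \<le> 1 / 2\<close> keeps the heights, which differ from 1/2 by less than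
    \<open>s\<close>, between 0 and 1.\<close>
  define s where "s = min (r / 2) (1 / 2)"
  have s: "0 < s" "s \<le> 1 / 2" "2 * s \<le> r" using r by (auto simp: s_def)
  let ?U = "ball (x0 + (1 / 2) *\<^sub>R \<nu>) s"
  have U: "\<exists>z t. z \<in> ?D \<and> 0 \<le> t \<and> t \<le> 1 \<and> y = z + t *\<^sub>R \<nu>" if y: "y \<in> ?U" for y
  proof -
    define h where "h = (y - (x0 + (1 / 2) *\<^sub>R \<nu>)) \<bullet> \<nu>"
    have nrm: "norm (y - (x0 + (1 / 2) *\<^sub>R \<nu>)) < s" using y by (simp add: dist_norm norm_minus_commute)
    then have h: "\<bar>h\<bar> < s"
      using Cauchy_Schwarz_ineq2[of "y - (x0 + (1 / 2) *\<^sub>R \<nu>)" \<nu>] \<nu> by (simp add: h_def)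
    define z where "z = y - (1 / 2 + h) *\<^sub>R \<nu>"
    have "z - x0 = (y - (x0 + (1 / 2) *\<^sub>R \<nu>)) - h *\<^sub>R \<nu>" by (simp add: z_def algebra_simps)
    then have "norm (z - x0) \<le> norm (y - (x0 + (1 / 2) *\<^sub>R \<nu>)) + norm (h *\<^sub>R \<nu>)"
      by (simp only: norm_triangle_ineq4)
    then have "norm (z - x0) \<le> norm (y - (x0 + (1 / 2) *\<^sub>R \<nu>)) + \<bar>h\<bar>"
      using \<nu> by simp
    then have "dist x0 z < r" using nrm h s by (simp add: dist_norm norm_minus_commute)
    moreover have "a \<bullet> z = a \<bullet> x0"
    proof -
      have "\<nu> \<bullet> \<nu> = 1" using \<nu> by (simp add: dot_square_norm)
      then have "\<nu> \<bullet> (z - x0) = 0"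
        by (simp add: z_def h_def inner_diff_right inner_add_right inner_diff_left inner_add_left inner_commute algebra_simps)
      then have "a \<bullet> (z - x0) = 0" using a by (simp add: \<nu>_def)
      then show ?thesis by (simp add: inner_diff_right)
    qed
    ultimately show ?thesis using h s
      by (intro exI[of _ z] exI[of _ "1 / 2 + h"]) (auto simp: z_def)
  qed
  define \<kappa> where "\<kappa> = 3 * unit_ball_vol (real DIM('a)) * 2 ^ DIM('a)"
  \<comment> \<open>The ratio between the volume bound of \<open>thicken_cover\<close> and the
    Hausdorff weight of the same set.\<close>
  define \<kappa>' where "\<kappa>' = \<kappa> * 2 ^ n / unit_ball_vol (real n)"
  have vol: "unit_ball_vol (real n) > 0" by simp
  have \<kappa>: "\<kappa> > 0" "\<kappa>' > 0" by (auto simp: \<kappa>_def \<kappa>'_def)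
  define m where "m = unit_ball_vol (real DIM('a)) * s ^ DIM('a)"
  have m: "emeasure lborel ?U = ennreal m" "m > 0"
    using s by (simp_all add: emeasure_ball m_def)
  have "hausdorff_content n 1 ?D \<le> hausdorff_outer n ?D"
    unfolding hausdorff_outer_content by (rule SUP_upper) simp
  with zero have "hausdorff_content n 1 ?D = 0" by (metis le_zero_eq)
  moreover have "0 < ennreal (m / \<kappa>')" using m \<kappa> by simp
  ultimately have "hausdorff_content n 1 ?D < ennreal (m / \<kappa>')" by simp
  then obtain C where C: "?D \<subseteq> (\<Union>i. C i)" "\<And>i. bounded (C i)" "\<And>i. diameter (C i) \<le> 1"
    "(\<Sum>i. ?w (C i)) < ennreal (m / \<kappa>')"
    by (rule hausdorff_content_less) (rule that)
  have "\<exists>Z. Z \<in> sets borel \<and> (\<forall>y t. y \<in> C i \<longrightarrow> 0 \<le> t \<longrightarrow> t \<le> 1 \<longrightarrow> y + t *\<^sub>R \<nu> \<in> Z) \<and>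
     emeasure lborel Z \<le> ennreal (\<kappa> * diameter (C i) ^ n)" for i
    using thicken_cover[OF C(2,3) \<nu> n] unfolding \<kappa>_def by metis
  then obtain Z where Z: "\<And>i. Z i \<in> sets borel"
     "\<And>i y t. \<lbrakk>y \<in> C i; 0 \<le> t; t \<le> 1\<rbrakk> \<Longrightarrow> y + t *\<^sub>R \<nu> \<in> Z i"
     "\<And>i. emeasure lborel (Z i) \<le> ennreal (\<kappa> * diameter (C i) ^ n)"
    by metis
  have "?U \<subseteq> (\<Union>i. Z i)"
  proof
    fix y assume "y \<in> ?U"
    then obtain z t where z: "z \<in> ?D" "0 \<le> t" "t \<le> 1" "y = z + t *\<^sub>R \<nu>" using U by blast
    then have "z \<in> (\<Union>i. C i)" using subsetD[OF C(1)] by blast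
    then obtain i where "z \<in> C i" by (rule UN_E)
    then show "y \<in> (\<Union>i. Z i)" using Z(2) z by blast
  qed
  then have "ennreal m \<le> emeasure lborel (\<Union>i. Z i)"
    unfolding m(1)[symmetric] using Z(1) by (intro emeasure_mono) auto
  also have "\<dots> \<le> (\<Sum>i. emeasure lborel (Z i))"
    using Z(1) by (intro emeasure_subadditive_countably) auto
  also have "\<dots> \<le> (\<Sum>i. ennreal (\<kappa> * diameter (C i) ^ n))"
    by (intro suminf_le Z) auto
  also have "\<dots> = (\<Sum>i. ennreal \<kappa>' * ?w (C i))"
  proof (intro suminf_cong)
    fix i
    have "\<kappa> * diameter (C i) ^ n = \<kappa>' * (unit_ball_vol (real n) * (diameter (C i) / 2) ^ n)"
      by (simp add: \<kappa>'_def power_divide vol[THEN less_imp_neq, THEN not_sym])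
    then show "ennreal (\<kappa> * diameter (C i) ^ n) = ennreal \<kappa>' * ?w (C i)"
      using \<kappa> diameter_ge_0[OF C(2)[of i]] by (simp add: ennreal_mult)
  qed
  also have "\<dots> = ennreal \<kappa>' * (\<Sum>i. ?w (C i))" by simp
  also have "\<dots> < ennreal \<kappa>' * ennreal (m / \<kappa>')"
    using \<kappa> C(4) by (intro ennreal_mult_strict_left_mono) auto
  also have "\<dots> = ennreal m" using \<kappa> m by (simp add: ennreal_mult[symmetric])
  finally show False by simp
qed

section \<open>Integration by parts and weak gradients\<close>

definition C1_fun :: "('a::euclidean_space \<Rightarrow> real) \<Rightarrow> bool" where
  "C1_fun v \<longleftrightarrow> (\<exists>v'. (\<forall>x. GDERIV v x :> v' x) \<and> continuous_on UNIV v')"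

lemma GDERIV_eq_zero:
  assumes "GDERIV g x :> D" "open U" "x \<in> U" "\<And>y. y \<in> U \<Longrightarrow> g y = 0"
  shows "D = 0"
proof -
  have "(g has_derivative (\<lambda>h. h \<bullet> D)) (at x)" using assms(1) by (simp add: gderiv_def)
  moreover have "(g has_derivative (\<lambda>h. 0)) (at x)"
    by (rule has_derivative_transform_within_open[OF has_derivative_const[of 0] assms(2,3)])
      (simp add: assms(4))
  ultimately have "(\<lambda>h. h \<bullet> D) = (\<lambda>h. 0)" by (rule has_derivative_unique)
  then have "D \<bullet> D = 0" by metis
  then show ?thesis by simp
qed

lemma GDERIV_imp_continuous: "(\<And>x. GDERIV v x :> v' x) \<Longrightarrow> continuous_on S v"
  unfolding gderiv_def
  by (meson continuous_at_imp_continuous_on has_derivative_continuous)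

lemma C1_fun_continuous: "C1_fun v \<Longrightarrow> continuous_on S v"
  unfolding C1_fun_def using GDERIV_imp_continuous by blast

lemma C1_fun_const: "C1_fun (\<lambda>x. c)"
  unfolding C1_fun_def by (intro exI[of _ "\<lambda>_. 0"]) (auto intro: GDERIV_const)

lemma C1_fun_inner: "C1_fun (\<lambda>x. x \<bullet> b)"
  unfolding C1_fun_def gderiv_def
  by (intro exI[of _ "\<lambda>_. b"]) (auto intro!: derivative_eq_intros)

lemma C1_fun_add: "C1_fun u \<Longrightarrow> C1_fun v \<Longrightarrow> C1_fun (\<lambda>x. u x + v x)"
  unfolding C1_fun_def
proof (elim exE conjE)
  fix u' v' assume "\<forall>x. GDERIV u x :> u' x" "continuous_on UNIV u'" "\<forall>x. GDERIV v x :> v' x" "continuous_on UNIV v'"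
  then show "\<exists>w'. (\<forall>x. GDERIV (\<lambda>x. u x + v x) x :> w' x) \<and> continuous_on UNIV w'"
    by (intro exI[of _ "\<lambda>x. u' x + v' x"] conjI allI GDERIV_add continuous_on_add) auto
qed

lemma C1_fun_mult:
  assumes "C1_fun u" "C1_fun v" shows "C1_fun (\<lambda>x. u x * v x)"
proof -
  obtain u' v' where *: "\<And>x. GDERIV u x :> u' x" "continuous_on UNIV u'"
    "\<And>x. GDERIV v x :> v' x" "continuous_on UNIV v'"
    using assms unfolding C1_fun_def by blast
  show ?thesis unfolding C1_fun_def
    by (intro exI[of _ "\<lambda>x. u x *\<^sub>R v' x + v x *\<^sub>R u' x"] conjI allI GDERIV_mult * continuous_intros
        C1_fun_continuous assms)
qed

lemma C1_fun_compose:
  assumes "C1_fun u" "\<And>s. DERIV h s :> h' s" "continuous_on UNIV h'"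
  shows "C1_fun (\<lambda>x. h (u x))"
proof -
  obtain u' where *: "\<And>x. GDERIV u x :> u' x" "continuous_on UNIV u'"
    using assms(1) unfolding C1_fun_def by blast
  show ?thesis unfolding C1_fun_def
    by (intro exI[of _ "\<lambda>x. h' (u x) *\<^sub>R u' x"] conjI allI GDERIV_DERIV_compose * assms(2) continuous_intros
        continuous_on_compose2[OF assms(3)] C1_fun_continuous[OF assms(1)] subset_UNIV)
qed

lemma C1_fun_sum: "(\<And>i. i \<in> I \<Longrightarrow> C1_fun (u i)) \<Longrightarrow> C1_fun (\<lambda>x. \<Sum>i\<in>I. u i x)"
  by (induction I rule: infinite_finite_induct) (auto intro: C1_fun_const C1_fun_add)

lemma C1_fun_prod: "(\<And>i. i \<in> I \<Longrightarrow> C1_fun (u i)) \<Longrightarrow> C1_fun (\<lambda>x. \<Prod>i\<in>I. u i x)"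
  by (induction I rule: infinite_finite_induct) (auto intro: C1_fun_const C1_fun_mult)

lemma C1_fun_power: "C1_fun u \<Longrightarrow> C1_fun (\<lambda>x. u x ^ m)"
  by (induction m) (auto intro: C1_fun_const C1_fun_mult)

lemma C1_fun_polys: "q \<in> polys n \<Longrightarrow> C1_fun q"
proof -
  assume "q \<in> polys n"
  then obtain c :: "('a \<Rightarrow> nat) \<Rightarrow> real" where
    "q = (\<lambda>x. \<Sum>m\<in>{m \<in> Basis \<rightarrow>\<^sub>E {..n}. (\<Sum>b\<in>Basis. m b) \<le> n}. c m * (\<Prod>b\<in>Basis. (x \<bullet> b) ^ m b))"
    unfolding polys_def by blast
  then show ?thesis
    by (auto intro!: C1_fun_sum C1_fun_mult C1_fun_const C1_fun_prod C1_fun_power C1_fun_inner)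
qed

lemma C1_fun_lipschitz:
  assumes v: "C1_fun v" and S: "compact S" "convex S"
  shows "\<exists>L. L-lipschitz_on S v"
proof -
  obtain v' where v': "\<And>x. GDERIV v x :> v' x" "continuous_on UNIV v'"
    using v unfolding C1_fun_def by blast
  have "compact (v' ` S)" using v'(2) S(1) by (meson compact_continuous_image continuous_on_subset subset_UNIV)
  then obtain L where L: "\<And>x. x \<in> S \<Longrightarrow> norm (v' x) \<le> L" "L > 0"
    using compact_imp_bounded bounded_pos by (metis image_eqI)
  have "L-lipschitz_on S v"
  proof (rule bounded_derivative_imp_lipschitz)
    show "(v has_derivative (\<lambda>h. h \<bullet> v' x)) (at x within S)" if "x \<in> S" for x
      using v'(1) unfolding gderiv_def by (rule has_derivative_at_withinI)
    show "onorm (\<lambda>h. h \<bullet> v' x) \<le> L" if "x \<in> S" for x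
    proof (rule onorm_le)
      fix h show "norm (h \<bullet> v' x) \<le> L * norm h"
        using Cauchy_Schwarz_ineq2[of h "v' x"] L(1)[OF that]
        by (metis mult.commute mult_left_mono norm_ge_zero order_trans real_norm_def)
    qed
  qed (use S L in auto)
  then show ?thesis ..
qed

text \<open>
  Integration by parts without Fubini: the integral of a difference quotient of \<open>g\<close> vanishes by
  translation invariance, and the difference quotients are dominated since \<open>g\<close> is Lipschitz.
\<close>

lemma integral_gradient_zero:
  fixes g :: "'a::euclidean_space \<Rightarrow> real"
  assumes L: "L-lipschitz_on UNIV g" and R: "\<And>x. norm x > R \<Longrightarrow> g x = 0"
    and G: "G \<in> borel_measurable borel" and der: "AE x in lborel. GDERIV g x :> G x"
  shows "integrable lborel G \<and> (LINT x|lborel. G x) = 0"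
proof -
  have cg: "continuous_on UNIV g" using L by (rule lipschitz_on_continuous_on)
  have gm[measurable]: "g \<in> borel_measurable borel" using cg by (rule borel_measurable_continuous_onI)
  note G[measurable]
  have L0: "L \<ge> 0" using L by (rule lipschitz_on_nonneg)
  define M where "M = \<bar>R\<bar> + 1"
  have gint: "integrable lborel g"
  proof -
    have "set_integrable lborel (cball 0 M) g"
      unfolding set_integrable_def
      using borel_integrable_compact[of "cball 0 M" g] continuous_on_subset[OF cg]
      by (auto simp: indicator_def if_distrib cong: if_cong)
    moreover have "indicator (cball 0 M) x *\<^sub>R g x = g x" for x
      using R[of x] by (auto simp: M_def indicator_def)
    ultimately show ?thesis unfolding set_integrable_def by (simp only:)
  qed
  have b: "integrable lborel (\<lambda>x. G x \<bullet> b) \<and> (LINT x|lborel. G x \<bullet> b) = 0" if b: "b \<in> Basis" for b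
  proof -
    define s where "s m x = (g (((1 / real (Suc m)) *\<^sub>R b) + x) - g x) * real (Suc m)" for m x
    \<comment> \<open>The shifts have length at most 1, so all difference quotients vanish outside
      the ball of radius \<open>M + 1\<close>; inside they are bounded by the Lipschitz
      constant.\<close>
    define w where "w x = L * indicator (cball 0 (M + 1)) x" for x :: 'a
    have sm: "s m \<in> borel_measurable lborel" for m unfolding s_def by measurable
    have wint: "integrable lborel w"
      unfolding w_def using emeasure_bounded_finite[OF bounded_cball, of 0 "M + 1"]
      by (intro integrable_mult_right integrable_real_indicator) auto
    have lim: "AE x in lborel. (\<lambda>m. s m x) \<longlonglongrightarrow> G x \<bullet> b"
      using der
    proof eventually_elim
      case (elim x)
      have "((\<lambda>t. g (x + t *\<^sub>R b)) has_derivative (\<lambda>t. (t *\<^sub>R b) \<bullet> G x)) (at 0)"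
      proof -
        have "((\<lambda>t. x + t *\<^sub>R b) has_derivative (\<lambda>t. t *\<^sub>R b)) (at 0)"
          by (auto intro!: derivative_eq_intros)
        moreover have "(g has_derivative (\<lambda>h. h \<bullet> G x)) (at (x + 0 *\<^sub>R b))"
          using elim by (simp add: gderiv_def)
        ultimately show ?thesis by (rule has_derivative_compose)
      qed
      then have "DERIV (\<lambda>t. g (x + t *\<^sub>R b)) 0 :> G x \<bullet> b"
        unfolding has_field_derivative_def by (rule has_derivative_eq_rhs) (auto simp: inner_commute mult.commute)
      then have "((\<lambda>h. (g (x + h *\<^sub>R b) - g x) / h) \<longlongrightarrow> G x \<bullet> b) (at 0)"
        by (simp add: DERIV_def)
      moreover have "filterlim (\<lambda>m. 1 / real (Suc m)) (at 0) sequentially"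
        unfolding filterlim_at using LIMSEQ_inverse_real_of_nat by (simp add: inverse_eq_divide)
      ultimately have "(\<lambda>m. (g (x + (1 / real (Suc m)) *\<^sub>R b) - g x) / (1 / real (Suc m))) \<longlonglongrightarrow> G x \<bullet> b"
        by (rule filterlim_compose)
      then show ?case by (simp add: s_def add.commute)
    qed
    have bound: "AE x in lborel. norm (s m x) \<le> w x" for m
    proof (rule AE_I2)
      fix x
      let ?y = "((1 / real (Suc m)) *\<^sub>R b) + x"
      have d: "dist ?y x = 1 / real (Suc m)" using b by (simp add: dist_norm)
      have "\<bar>g ?y - g x\<bar> \<le> L * (1 / real (Suc m))"
        using lipschitz_onD[OF L, of ?y x] d by (simp add: dist_real_def)
      then have "\<bar>g ?y - g x\<bar> * real (Suc m) \<le> L * (1 / real (Suc m)) * real (Suc m)"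
        by (intro mult_right_mono) auto
      then have 1: "norm (s m x) \<le> L"
        by (simp add: s_def abs_mult del: of_nat_Suc)
      have 2: "s m x = 0" if "norm x > M + 1"
      proof -
        have "norm x - norm ?y \<le> dist ?y x" by (metis dist_norm norm_minus_commute norm_triangle_ineq2)
        also have "\<dots> \<le> 1" unfolding d by simp
        finally have "norm ?y > R" using that by (simp add: M_def)
        moreover have "norm x > R" using that by (simp add: M_def)
        ultimately show ?thesis using R by (simp add: s_def)
      qed
      show "norm (s m x) \<le> w x"
        using 1 2 by (cases "norm x > M + 1") (auto simp: w_def)
    qed
    have Gb: "(\<lambda>x. G x \<bullet> b) \<in> borel_measurable lborel" by measurable
    have s0: "integral\<^sup>L lborel (s m) = 0" for m
    proof -
      let ?c = "(1 / real (Suc m)) *\<^sub>R b"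
      have i: "integrable lborel (\<lambda>x. g (?c + x))" "(LINT x|lborel. g (?c + x)) = (LINT x|lborel. g x)"
        using integral_distr[of "(+) ?c" lborel borel g] integrable_distr_eq[of "(+) ?c" lborel borel g] gint
        by (auto simp: lborel_distr_plus)
      show ?thesis unfolding s_def using i gint by simp
    qed
    have "(\<lambda>m. integral\<^sup>L lborel (s m)) \<longlonglongrightarrow> (LINT x|lborel. G x \<bullet> b)"
      by (rule integral_dominated_convergence[OF Gb sm wint lim bound])
    then have "(LINT x|lborel. G x \<bullet> b) = 0"
      by (simp add: s0 LIMSEQ_const_iff)
    moreover have "integrable lborel (\<lambda>x. G x \<bullet> b)"
      by (rule integrable_dominated_convergence[OF Gb sm wint lim bound])
    ultimately show ?thesis by simp
  qed
  have "integrable lborel (\<lambda>x. \<Sum>b\<in>Basis. (G x \<bullet> b) *\<^sub>R b)"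
    using b by (intro Bochner_Integration.integrable_sum integrable_scaleR_left) auto
  then have int: "integrable lborel G" by (simp add: euclidean_representation)
  have "(LINT x|lborel. G x) \<bullet> b = 0" if "b \<in> Basis" for b
    using b[OF that] int integral_inner_left[of b lborel G] by simp
  then show ?thesis using int by (auto intro: euclidean_eqI)
qed

definition test_fun :: "'a::euclidean_space set \<Rightarrow> ('a \<Rightarrow> real) \<Rightarrow> bool" where
  "test_fun \<Omega> \<phi> \<longleftrightarrow> C1_fun \<phi> \<and> compact (closure {x. \<phi> x \<noteq> 0}) \<and> closure {x. \<phi> x \<noteq> 0} \<subseteq> \<Omega>"

lemma weak_gradient_test_fun:
  "weak_gradient \<Omega> v G \<longleftrightarrow>
     (\<forall>\<phi> \<phi>'. test_fun \<Omega> \<phi> \<and> (\<forall>x. GDERIV \<phi> x :> \<phi>' x) \<and> continuous_on UNIV \<phi>' \<longrightarrow>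
        (LINT x|lebesgue_on \<Omega>. v x *\<^sub>R \<phi>' x) = - (LINT x|lebesgue_on \<Omega>. \<phi> x *\<^sub>R G x))"
  unfolding weak_gradient_def test_fun_def C1_fun_def by blast

lemma continuous_compact_support_bounded:
  fixes h :: "'a::euclidean_space \<Rightarrow> 'b::real_normed_vector"
  assumes "continuous_on UNIV h" "compact K" "\<And>x. x \<notin> K \<Longrightarrow> h x = 0"
  obtains B where "B > 0" "\<And>x. norm (h x) \<le> B"
proof -
  have "compact (h ` K)" using assms by (meson compact_continuous_image continuous_on_subset subset_UNIV)
  then obtain B where B: "B > 0" "\<And>x. x \<in> K \<Longrightarrow> norm (h x) \<le> B"
    using compact_imp_bounded bounded_pos by (metis image_eqI)
  have "norm (h x) \<le> B" for x using B assms(3)[of x] by (cases "x \<in> K") auto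
  with B(1) show ?thesis by (rule that)
qed

lemma test_fun_gradient:
  assumes "test_fun \<Omega> \<phi>" "\<And>x. GDERIV \<phi> x :> \<phi>' x"
  shows "x \<notin> \<Omega> \<Longrightarrow> \<phi> x = 0" "x \<notin> closure {x. \<phi> x \<noteq> 0} \<Longrightarrow> \<phi>' x = 0"
proof -
  show "\<phi> x = 0" if "x \<notin> \<Omega>"
    using assms(1) that closure_subset[of "{x. \<phi> x \<noteq> 0}"] unfolding test_fun_def by blast
  show "\<phi>' x = 0" if "x \<notin> closure {x. \<phi> x \<noteq> 0}"
  proof (rule GDERIV_eq_zero[OF assms(2)])
    show "open (- closure {x. \<phi> x \<noteq> 0})" "x \<in> - closure {x. \<phi> x \<noteq> 0}" using that by auto
    show "\<phi> y = 0" if "y \<in> - closure {x. \<phi> x \<noteq> 0}" for y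
      using that closure_subset[of "{x. \<phi> x \<noteq> 0}"] by auto
  qed
qed

lemma integral_lebesgue_on:
  fixes f :: "'a::euclidean_space \<Rightarrow> 'b::{banach, second_countable_topology}"
  assumes "\<Omega> \<in> sets borel" "f \<in> borel_measurable borel"
  shows "(LINT x|lebesgue_on \<Omega>. f x) = (LINT x|lborel. indicator \<Omega> x *\<^sub>R f x)"
  using assms by (subst integral_restrict_space) (auto intro!: integral_completion)

lemma borel_measurable_lebesgue_on:
  fixes f :: "'a::euclidean_space \<Rightarrow> 'b::{second_countable_topology, topological_space}"
  shows "f \<in> borel_measurable borel \<Longrightarrow> f \<in> borel_measurable (lebesgue_on \<Omega>)"
  by (intro measurable_restrict_space1 measurable_completion) simp

text \<open>An almost everywhere gradient alone does not see jumps. Lipschitz continuity of the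
  products with test functions excludes them and lets \<open>integral_gradient_zero\<close> be
  applied to \<open>v x * \<phi> x\<close>; the product rule then gives the weak
  formulation.\<close>

lemma weak_gradientI:
  fixes v :: "'a::euclidean_space \<Rightarrow> real"
  assumes \<Omega>: "open \<Omega>" "bounded \<Omega>"
    and v: "v \<in> borel_measurable borel" "\<And>x. x \<in> \<Omega> \<Longrightarrow> \<bar>v x\<bar> \<le> B"
    and G: "G \<in> borel_measurable borel" and der: "AE x in lborel. x \<in> \<Omega> \<longrightarrow> GDERIV v x :> G x"
    and lip: "\<And>\<phi>. test_fun \<Omega> \<phi> \<Longrightarrow> \<exists>L. L-lipschitz_on UNIV (\<lambda>x. v x * \<phi> x)"
  shows "weak_gradient \<Omega> v G"
  unfolding weak_gradient_test_fun
proof (intro allI impI, elim conjE)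
  fix \<phi> :: "'a \<Rightarrow> real" and \<phi>'
  assume \<phi>: "test_fun \<Omega> \<phi>" and \<phi>': "\<forall>x. GDERIV \<phi> x :> \<phi>' x" "continuous_on UNIV \<phi>'"
  let ?K = "closure {x. \<phi> x \<noteq> 0}"
  note z = test_fun_gradient[OF \<phi>, of \<phi>', OF \<phi>'(1)[rule_format]]
  have K: "compact ?K" "?K \<subseteq> \<Omega>" using \<phi> by (auto simp: test_fun_def)
  have [measurable]: "\<phi>' \<in> borel_measurable borel" "\<phi> \<in> borel_measurable borel"
    using \<phi>'(2) \<phi> C1_fun_continuous[of \<phi> UNIV] by (auto simp: test_fun_def intro: borel_measurable_continuous_onI)
  note v(1)[measurable] G[measurable]
  have O: "\<Omega> \<in> sets borel" using \<Omega>(1) by simp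
  \<comment> \<open>The product rule inside \<open>\<Omega>\<close>; off the support of
    \<open>\<phi>\<close> both terms vanish, whatever values \<open>v\<close> takes there.\<close>
  define g' where "g' x = v x *\<^sub>R \<phi>' x + \<phi> x *\<^sub>R G x" for x
  obtain L where L: "L-lipschitz_on UNIV (\<lambda>x. v x * \<phi> x)" using lip[OF \<phi>] by blast
  obtain R where R: "\<And>x. x \<in> \<Omega> \<Longrightarrow> norm x \<le> R" using \<Omega>(2) by (auto simp: bounded_iff)
  have "AE x in lborel. GDERIV (\<lambda>x. v x * \<phi> x) x :> g' x"
    using der
  proof eventually_elim
    case (elim x)
    show ?case
    proof (cases "x \<in> \<Omega>")
      case True
      then show ?thesis unfolding g'_def using elim \<phi>'(1) by (intro GDERIV_mult) auto
    next
      case False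
      then have x: "x \<notin> ?K" using K by blast
      have "g' x = 0" using z x False by (simp add: g'_def)
      moreover have "GDERIV (\<lambda>x. v x * \<phi> x) x :> 0"
        unfolding gderiv_def
      proof (rule has_derivative_transform_within_open[of "\<lambda>x. 0" _ x _ "- ?K"])
        show "0 = v y * \<phi> y" if "y \<in> - ?K" for y
          using that closure_subset[of "{x. \<phi> x \<noteq> 0}"] by auto
      qed (use x in auto)
      ultimately show ?thesis by simp
    qed
  qed
  moreover have "norm x > R \<Longrightarrow> v x * \<phi> x = 0" for x using R z(1)[of x] by force
  moreover have "g' \<in> borel_measurable borel" unfolding g'_def by measurable
  ultimately have g': "integrable lborel g'" "(LINT x|lborel. g' x) = 0"
    using integral_gradient_zero[OF L] by blast+
  obtain B' where B': "B' > 0" "\<And>x. norm (\<phi>' x) \<le> B'"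
    using continuous_compact_support_bounded[OF \<phi>'(2) K(1) z(2)] by blast
  have "\<phi>' x = 0" if "x \<notin> \<Omega>" for x using z(2)[of x] K that by blast
  then have ind: "indicator \<Omega> x *\<^sub>R v x *\<^sub>R \<phi>' x = v x *\<^sub>R \<phi>' x" "indicator \<Omega> x *\<^sub>R \<phi> x *\<^sub>R G x = \<phi> x *\<^sub>R G x" for x
    using z(1)[of x] by (auto simp: indicator_def)
  have i1: "integrable lborel (\<lambda>x. v x *\<^sub>R \<phi>' x)"
  proof (rule Bochner_Integration.integrable_bound)
    show "integrable lborel (\<lambda>x. B * B' * indicator \<Omega> x)"
      using O \<Omega>(2) emeasure_bounded_finite[OF \<Omega>(2)]
      by (intro integrable_mult_right integrable_real_indicator) auto
    show "AE x in lborel. norm (v x *\<^sub>R \<phi>' x) \<le> norm (B * B' * indicator \<Omega> x)"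
    proof (rule AE_I2)
      fix x
      show "norm (v x *\<^sub>R \<phi>' x) \<le> norm (B * B' * indicator \<Omega> x)"
      proof (cases "x \<in> \<Omega>")
        case True
        have "\<bar>v x\<bar> * norm (\<phi>' x) \<le> \<bar>B\<bar> * B'"
          using v(2)[OF True] B' by (intro mult_mono) auto
        then show ?thesis using True B' by (simp add: abs_mult)
      next
        case False
        then show ?thesis using \<open>\<And>x. x \<notin> \<Omega> \<Longrightarrow> \<phi>' x = 0\<close> by simp
      qed
    qed
  qed measurable
  have i2: "integrable lborel (\<lambda>x. \<phi> x *\<^sub>R G x)"
    using Bochner_Integration.integrable_diff[OF g'(1) i1] by (simp add: g'_def)
  have "(LINT x|lborel. v x *\<^sub>R \<phi>' x) + (LINT x|lborel. \<phi> x *\<^sub>R G x) = 0"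
    using g'(2) i1 i2 by (simp add: g'_def)
  then show "(LINT x|lebesgue_on \<Omega>. v x *\<^sub>R \<phi>' x) = - (LINT x|lebesgue_on \<Omega>. \<phi> x *\<^sub>R G x)"
    by (simp only: integral_lebesgue_on[OF O] ind eq_neg_iff_add_eq_0 borel_measurable_scaleR v(1) G
        \<open>\<phi>' \<in> borel_measurable borel\<close> \<open>\<phi> \<in> borel_measurable borel\<close>)
qed

section \<open>Bump functions and the fundamental lemma of the calculus of variations\<close>

lemma GDERIV_bump:
  "GDERIV (\<lambda>x. (max 0 (r\<^sup>2 - (norm (x - c))\<^sup>2))\<^sup>2) x :> (4 * max 0 (r\<^sup>2 - (norm (x - c))\<^sup>2)) *\<^sub>R (c - x)"
proof -
  have sq: "DERIV (\<lambda>s::real. (max 0 s)\<^sup>2) s :> 2 * max 0 s" for s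
  proof -
    consider "s > 0" | "s < 0" | "s = 0" by linarith
    then show ?thesis
    proof cases
      case 1
      have "DERIV (\<lambda>s::real. s\<^sup>2) s :> 2 * max 0 s" using 1 by (auto intro!: derivative_eq_intros)
      then show ?thesis
        by (rule has_field_derivative_transform_within_open[of _ _ _ "{0<..}"]) (use 1 in auto)
    next
      case 2
      have "DERIV (\<lambda>s::real. 0) s :> 2 * max 0 s" using 2 by (auto intro!: derivative_eq_intros)
      then show ?thesis
        by (rule has_field_derivative_transform_within_open[of _ _ _ "{..<0}"]) (use 2 in auto)
    next
      case 3
      have "((\<lambda>h::real. (max 0 h)\<^sup>2 / h) \<longlongrightarrow> 0) (at 0)"
      proof (rule Lim_null_comparison)
        show "\<forall>\<^sub>F h in at 0. norm ((max 0 h)\<^sup>2 / h) \<le> \<bar>h\<bar>"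
          by (auto simp: max_def power2_eq_square)
        show "((\<lambda>h::real. \<bar>h\<bar>) \<longlongrightarrow> 0) (at 0)" by (intro tendsto_rabs_zero tendsto_ident_at)
      qed
      then show ?thesis by (simp add: 3 DERIV_def)
    qed
  qed
  have "GDERIV (\<lambda>x. r\<^sup>2 - (norm (x - c))\<^sup>2) x :> 2 *\<^sub>R (c - x)"
    unfolding gderiv_def power2_norm_eq_inner
    by (auto intro!: derivative_eq_intros simp: algebra_simps inner_commute)
  from GDERIV_DERIV_compose[OF this sq] show ?thesis by (simp add: mult.commute)
qed

lemma bump_test_fun:
  fixes c :: "'a::euclidean_space"
  assumes "r > 0" "cball c r \<subseteq> \<Omega>"
  obtains \<phi> where "test_fun \<Omega> \<phi>" "\<And>x. \<phi> x \<ge> 0" "\<And>x. \<phi> x \<noteq> 0 \<longleftrightarrow> x \<in> ball c r"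
proof
  let ?\<phi> = "\<lambda>x. (max 0 (r\<^sup>2 - (norm (x - c))\<^sup>2))\<^sup>2"
  have sup: "?\<phi> x \<noteq> 0 \<longleftrightarrow> x \<in> ball c r" for x
    using assms(1) by (auto simp: max_def dist_norm norm_minus_commute abs_le_square_iff[symmetric] not_le)
  then show "\<And>x. ?\<phi> x \<noteq> 0 \<longleftrightarrow> x \<in> ball c r" .
  show "\<And>x. ?\<phi> x \<ge> 0" by simp
  have "C1_fun ?\<phi>"
    unfolding C1_fun_def
    by (rule exI[of _ "\<lambda>x. (4 * max 0 (r\<^sup>2 - (norm (x - c))\<^sup>2)) *\<^sub>R (c - x)"])
      (intro conjI allI GDERIV_bump continuous_intros)
  moreover have "{x. ?\<phi> x \<noteq> 0} = ball c r" using sup by blast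
  moreover have "closure (ball c r) = cball c r" using assms(1) by (rule closure_ball)
  ultimately show "test_fun \<Omega> ?\<phi>" using assms(2) by (simp add: test_fun_def)
qed

lemma test_fun_add: "test_fun \<Omega> \<phi> \<Longrightarrow> test_fun \<Omega> \<psi> \<Longrightarrow> test_fun \<Omega> (\<lambda>x. \<phi> x + \<psi> x)"
proof -
  assume *: "test_fun \<Omega> \<phi>" "test_fun \<Omega> \<psi>"
  let ?S = "\<lambda>\<phi>. {x. \<phi> x \<noteq> (0::real)}"
  have "?S (\<lambda>x. \<phi> x + \<psi> x) \<subseteq> ?S \<phi> \<union> ?S \<psi>" by auto
  moreover from this have "closure (?S (\<lambda>x. \<phi> x + \<psi> x)) \<subseteq> closure (?S \<phi>) \<union> closure (?S \<psi>)"
    by (metis closure_Un closure_mono)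
  moreover have "bounded (?S \<phi> \<union> ?S \<psi>)"
    using * by (auto simp: test_fun_def)
  ultimately show ?thesis
    using * C1_fun_add[of \<phi> \<psi>] bounded_subset[of "?S \<phi> \<union> ?S \<psi>" "?S (\<lambda>x. \<phi> x + \<psi> x)"]
    unfolding test_fun_def by (simp add: subset_trans[OF _ Un_least])
qed

lemma test_fun_compose:
  assumes "test_fun \<Omega> \<phi>" "\<And>s. DERIV h s :> h' s" "continuous_on UNIV h'" "h 0 = 0"
  shows "test_fun \<Omega> (\<lambda>x. h (\<phi> x))"
proof -
  let ?S = "\<lambda>\<phi>. {x. \<phi> x \<noteq> (0::real)}"
  have "?S (\<lambda>x. h (\<phi> x)) \<subseteq> ?S \<phi>" using assms(4) by auto
  then have sub: "closure (?S (\<lambda>x. h (\<phi> x))) \<subseteq> closure (?S \<phi>)" by (rule closure_mono)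
  moreover have "compact (closure (?S \<phi>))" using assms(1) by (simp add: test_fun_def)
  ultimately have "compact (closure (?S (\<lambda>x. h (\<phi> x))))"
    by (metis closed_closure closed_Int_compact inf.absorb_iff1)
  then show ?thesis using sub assms(1) C1_fun_compose[OF _ assms(2,3)]
    by (auto simp: test_fun_def)
qed

text \<open>The open sets are an intersection-stable generator, so vanishing integrals spread to all
  Borel sets by a Dynkin argument; complements are handled through the integral over
  \<open>UNIV\<close>.\<close>

lemma integrable_zero_on_open_imp_AE_zero:
  fixes f :: "'a::euclidean_space \<Rightarrow> real"
  assumes f: "integrable lborel f" and U: "\<And>U. open U \<Longrightarrow> (LINT x:U|lborel. f x) = 0"
  shows "AE x in lborel. f x = 0"
proof -
  have si: "set_integrable lborel A f" if "A \<in> sets borel" for A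
    unfolding set_integrable_def using integrable_mult_indicator[OF _ f, of A] that by simp
  have A: "(LINT x:A|lborel. f x) = 0" if "A \<in> sigma_sets UNIV {U. open U}" for A
  proof -
    have "Int_stable {U::'a set. open U}" "{U::'a set. open U} \<subseteq> Pow UNIV" by (auto simp: Int_stable_def)
    then show ?thesis using that
  proof (induction rule: sigma_sets_induct_disjoint)
    case (basic A) then show ?case using U by simp
  next
    case empty then show ?case by (simp add: set_lebesgue_integral_def)
  next
    case (compl A)
    then have "A \<in> sets borel" by (simp add: borel_def)
    then have "(LINT x:(UNIV - A) \<union> A|lborel. f x) = (LINT x:(UNIV - A)|lborel. f x) + (LINT x:A|lborel. f x)"
      by (intro set_integral_Un si) auto
    moreover have "(LINT x:UNIV|lborel. f x) = 0" using U[of UNIV] by simp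
    ultimately show ?case using compl by simp
  next
    case (union A)
    then have A: "A i \<in> sets borel" for i by (auto simp: borel_def)
    have "(LINT x:(\<Union>i. A i)|lborel. f x) = (\<Sum>i. (LINT x:(A i)|lborel. f x))"
      using union(1) A by (intro lebesgue_integral_countable_add si) (auto simp: disjoint_family_on_def)
    then show ?case using union by simp
  qed
  qed
  have "AE x in lborel. f x = (\<lambda>x. 0) x"
  proof (rule density_unique_real[OF f])
    fix A :: "'a set" assume "A \<in> sets lborel"
    then have "A \<in> sigma_sets UNIV {U. open U}" by (simp add: borel_def)
    then show "(LINT x:A|lborel. f x) = (LINT x:A|lborel. 0)"
      using A by (simp add: set_lebesgue_integral_def)
  qed simp
  then show ?thesis by simp
qed

text \<open>The indicator of an open set is a bounded pointwise limit of test functions: countably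
  many balls exhaust the set, and the partial sums of their bumps are flattened towards the value
  1.\<close>

lemma test_fun_integral_zero_imp_open:
  fixes f :: "'a::euclidean_space \<Rightarrow> real"
  assumes f: "integrable lborel f" and \<phi>: "\<And>\<phi>. test_fun \<Omega> \<phi> \<Longrightarrow> (LINT x|lborel. \<phi> x * f x) = 0"
    and U: "open U" "U \<subseteq> \<Omega>"
  shows "(LINT x:U|lborel. f x) = 0"
proof (cases "U = {}")
  case True then show ?thesis by (simp add: set_lebesgue_integral_def)
next
  case False
  define F where "F = {ball c r | c r. 0 < r \<and> cball c r \<subseteq> U}"
  have "U \<subseteq> \<Union>F"
  proof
    fix x assume "x \<in> U"
    then obtain r where "r > 0" "cball x r \<subseteq> U" using U(1) open_contains_cball by blast
    then show "x \<in> \<Union>F" unfolding F_def by (auto intro!: exI[of _ "ball x r"])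
  qed
  moreover have "\<Union>F \<subseteq> U" unfolding F_def using ball_subset_cball by fastforce
  ultimately have UF: "\<Union>F = U" by blast
  have "open S" if "S \<in> F" for S using that unfolding F_def by auto
  then obtain F' where F': "F' \<subseteq> F" "countable F'" "\<Union>F' = \<Union>F"
    by (rule Lindelof)
  then have UF': "\<Union>F' = U" using UF by simp
  define A where "A = from_nat_into F'"
  have ne: "F' \<noteq> {}" using UF' False by auto
  have A: "A i \<in> F" for i unfolding A_def using from_nat_into[OF ne] F'(1) by blast
  have UA: "(\<Union>i. A i) = U"
    unfolding A_def using range_from_nat_into[OF ne F'(2)] UF' by simp
  have "\<exists>\<psi>. test_fun \<Omega> \<psi> \<and> (\<forall>x. \<psi> x \<ge> 0) \<and> (\<forall>x. \<psi> x \<noteq> 0 \<longleftrightarrow> x \<in> A i)" for i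
  proof -
    obtain c r where cr: "A i = ball c r" "0 < r" "cball c r \<subseteq> U" using A[of i] unfolding F_def by blast
    then have "cball c r \<subseteq> \<Omega>" using U(2) by blast
    then show ?thesis using bump_test_fun[OF cr(2)] cr(1) by metis
  qed
  then obtain \<psi> where \<psi>: "\<And>i. test_fun \<Omega> (\<psi> i)" "\<And>i x. \<psi> i x \<ge> 0" "\<And>i x. \<psi> i x \<noteq> 0 \<longleftrightarrow> x \<in> A i"
    by metis
  define S where "S m x = (\<Sum>i\<le>m. \<psi> i x)" for m x
  have S: "test_fun \<Omega> (S m)" for m
    unfolding S_def by (induction m) (auto simp: \<psi> intro!: test_fun_add)
  \<comment> \<open>\<open>h m\<close> is continuously differentiable and fixes 0, so supports do
    not grow; it has values in \<open>[0, 1]\<close>, which gives the domination, and tends to 1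
    away from 0.\<close>
  define h where "h m s = real m * s\<^sup>2 / (1 + real m * s\<^sup>2)" for m :: nat and s :: real
  have pos: "1 + real m * s\<^sup>2 > 0" for m s by (simp add: add_pos_nonneg)
  have h: "DERIV (h m) s :> 2 * real m * s / (1 + real m * s\<^sup>2)\<^sup>2" for m s
    unfolding h_def using pos[of m s]
    by (auto intro!: derivative_eq_intros simp: field_simps power2_eq_square)
  have hb: "0 \<le> h m s" "h m s \<le> 1" for m s
    using pos[of m s] by (simp_all add: h_def)
  have T: "test_fun \<Omega> (\<lambda>x. h m (S m x))" for m
  proof (rule test_fun_compose[OF S h])
    show "continuous_on UNIV (\<lambda>s. 2 * real m * s / (1 + real m * s\<^sup>2)\<^sup>2)"
      using pos by (intro continuous_intros) (auto simp: less_imp_neq[symmetric])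
  qed (simp add: h_def)
  have lim: "(\<lambda>m. h m (S m x)) \<longlonglongrightarrow> indicator U x" for x
  proof (cases "x \<in> U")
    case False
    then have "\<psi> i x = 0" for i using \<psi>(3)[of i x] UA by auto
    then show ?thesis using False by (simp add: S_def h_def)
  next
    case True
    then obtain N where N: "x \<in> A N" using UA by blast
    define p where "p = \<psi> N x"
    have p: "p > 0" using \<psi>(2,3)[of N x] N by (simp add: p_def less_le)
    have "\<bar>1 - h m (S m x)\<bar> \<le> (1 / p\<^sup>2) * (1 / real m)" if m: "m \<ge> N" "m > 0" for m
    proof -
      have "p \<le> S m x" unfolding p_def S_def using m(1) \<psi>(2) by (intro member_le_sum) auto
      then have "p\<^sup>2 \<le> (S m x)\<^sup>2" using p by (intro power_mono) auto
      then have 1: "real m * p\<^sup>2 \<le> 1 + real m * (S m x)\<^sup>2" by (simp add: mult_left_mono add_increasing)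
      have "1 - h m (S m x) = 1 / (1 + real m * (S m x)\<^sup>2)"
        using pos[of m "S m x"] by (simp add: h_def field_simps)
      also have "\<dots> \<le> 1 / (real m * p\<^sup>2)" using 1 m p pos by (intro divide_left_mono) auto
      finally show ?thesis using hb[of m "S m x"] by (simp add: mult.commute)
    qed
    then have "\<forall>\<^sub>F m in sequentially. norm (1 - h m (S m x)) \<le> (1 / p\<^sup>2) * (1 / real m)"
      unfolding eventually_sequentially by (intro exI[of _ "Suc N"]) auto
    moreover have "(\<lambda>m. (1 / p\<^sup>2) * (1 / real m)) \<longlonglongrightarrow> 0"
      using tendsto_mult_right_zero[OF lim_1_over_n] by blast
    ultimately have "(\<lambda>m. 1 - h m (S m x)) \<longlonglongrightarrow> 0" by (rule Lim_null_comparison)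
    then have "(\<lambda>m. 1 - (1 - h m (S m x))) \<longlonglongrightarrow> 1 - 0" by (intro tendsto_intros)
    then show ?thesis using True by simp
  qed
  have fm[measurable]: "f \<in> borel_measurable borel" using f by auto
  have [measurable]: "(\<lambda>x. h m (S m x)) \<in> borel_measurable borel" for m
    using T[of m] by (auto simp: test_fun_def intro: borel_measurable_continuous_onI C1_fun_continuous)
  have "(\<lambda>m. LINT x|lborel. h m (S m x) * f x) \<longlonglongrightarrow> (LINT x|lborel. indicator U x * f x)"
  proof (rule integral_dominated_convergence[where w = "\<lambda>x. norm (f x)"])
    show "AE x in lborel. (\<lambda>m. h m (S m x) * f x) \<longlonglongrightarrow> indicator U x * f x"
      by (intro AE_I2 tendsto_mult lim tendsto_const)
    show "AE x in lborel. norm (h m (S m x) * f x) \<le> norm (f x)" for m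
      using hb by (intro AE_I2) (simp add: abs_mult mult_left_le_one_le)
  qed (use U f in \<open>auto intro: borel_measurable_times\<close>)
  moreover have "(LINT x|lborel. h m (S m x) * f x) = 0" for m by (rule \<phi>[OF T])
  ultimately have "(LINT x|lborel. indicator U x * f x) = 0"
    by (simp add: LIMSEQ_const_iff)
  then show ?thesis by (simp add: set_lebesgue_integral_def)
qed

text \<open>\<open>F\<close> is only Lebesgue measurable: it is extended by zero and replaced by a
  Borel representative, to which the two preceding lemmas apply.\<close>

lemma fundamental_lemma_variations:
  fixes F :: "'a::euclidean_space \<Rightarrow> real"
  assumes \<Omega>: "open \<Omega>" and F: "integrable (lebesgue_on \<Omega>) F"
    and \<phi>: "\<And>\<phi>. test_fun \<Omega> \<phi> \<Longrightarrow> (LINT x|lebesgue_on \<Omega>. \<phi> x * F x) = 0"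
  shows "AE x in lebesgue_on \<Omega>. F x = 0"
proof -
  have O: "\<Omega> \<inter> space lebesgue \<in> sets lebesgue" using \<Omega> by simp
  have iF: "integrable lebesgue (\<lambda>x. indicator \<Omega> x *\<^sub>R F x)"
    using F integrable_restrict_space[OF O] by blast
  then obtain f where f[measurable]: "f \<in> borel_measurable lborel" and ae: "AE x in lborel. indicator \<Omega> x *\<^sub>R F x = f x"
    using completion_ex_borel_measurable_real[OF borel_measurable_integrable[OF iF]] by blast
  have aeL: "AE x in lebesgue. indicator \<Omega> x *\<^sub>R F x = f x" using ae by (rule AE_completion)
  have fL[measurable]: "f \<in> borel_measurable lebesgue" using f by (rule measurable_completion)
  have if1: "integrable lborel f"
    using integrable_cong_AE[OF borel_measurable_integrable[OF iF] fL aeL] iF integrable_completion[OF f] by simp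
  have \<phi>': "(LINT x|lborel. \<phi> x * f x) = 0" if t: "test_fun \<Omega> \<phi>" for \<phi>
  proof -
    have [measurable]: "\<phi> \<in> borel_measurable borel"
      using t by (auto simp: test_fun_def intro: borel_measurable_continuous_onI C1_fun_continuous)
    then have mL: "\<phi> \<in> borel_measurable lebesgue" by (intro measurable_completion) simp
    have "(LINT x|lborel. \<phi> x * f x) = (LINT x|lebesgue. \<phi> x * f x)"
      by (rule integral_completion[symmetric]) measurable
    also have "\<dots> = (LINT x|lebesgue. \<phi> x * (indicator \<Omega> x *\<^sub>R F x))"
      using mL borel_measurable_integrable[OF iF] aeL by (intro integral_cong_AE borel_measurable_times fL) auto
    also have "\<dots> = (LINT x|lebesgue. indicator \<Omega> x *\<^sub>R (\<phi> x * F x))"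
      by (intro Bochner_Integration.integral_cong) auto
    also have "\<dots> = (LINT x|lebesgue_on \<Omega>. \<phi> x * F x)"
      by (rule integral_restrict_space[OF O, symmetric])
    finally show ?thesis using \<phi>[OF t] by simp
  qed
  have "AE x in lborel. f x = 0"
  proof (rule integrable_zero_on_open_imp_AE_zero[OF if1])
    fix U :: "'a set" assume U: "open U"
    have "(LINT x:U|lborel. f x) = (LINT x:U \<inter> \<Omega>|lborel. f x)"
      unfolding set_lebesgue_integral_def
    proof (rule integral_cong_AE)
      show "AE x in lborel. indicat_real U x *\<^sub>R f x = indicat_real (U \<inter> \<Omega>) x *\<^sub>R f x"
        using ae by eventually_elim (auto simp: indicator_def split: if_splits)
    qed (use U \<Omega> f in \<open>auto intro!: borel_measurable_times borel_measurable_indicator\<close>)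
    also have "\<dots> = 0"
      using U \<Omega> by (intro test_fun_integral_zero_imp_open[OF if1 \<phi>']) auto
    finally show "(LINT x:U|lborel. f x) = 0" .
  qed
  then have "AE x in lborel. x \<in> \<Omega> \<longrightarrow> F x = 0"
    using ae by eventually_elim (auto simp: indicator_def)
  then show ?thesis
    using AE_restrict_space_iff[OF O] AE_completion by blast
qed

section \<open>The H1 scalar product\<close>

text \<open>The H1 form is known to be bilinear on a subspace only, so the nonnegative quadratic in
  \<open>t\<close> is assumed in place of bilinearity.\<close>

lemma form_Cauchy_Schwarz:
  fixes B :: "'b \<Rightarrow> 'b \<Rightarrow> real"
  assumes quad: "\<And>t. 0 \<le> B u u + 2 * t * B u v + t\<^sup>2 * B v v"
    and nonneg: "0 \<le> B u u" "0 \<le> B v v"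
  shows "\<bar>B u v\<bar> \<le> sqrt (B u u) * sqrt (B v v)"
proof -
  have "(B u v)\<^sup>2 \<le> B u u * B v v"
  proof (cases "B v v = 0")
    case True
    have "B u v = 0"
    proof (rule ccontr)
      assume n: "B u v \<noteq> 0"
      \<comment> \<open>With this \<open>t\<close> the polynomial, affine because
        \<open>B v v = 0\<close>, takes the value -1.\<close>
      have "0 \<le> B u u + 2 * (- (B u u + 1) / (2 * B u v)) * B u v"
        using quad[of "- (B u u + 1) / (2 * B u v)"] True by simp
      moreover have "2 * (- (B u u + 1) / (2 * B u v)) * B u v = - (B u u + 1)"
        using n by (simp add: field_simps)
      ultimately show False by linarith
    qed
    then show ?thesis using nonneg by simp
  next
    case False
    then have c: "B v v > 0" using nonneg by simp
    have "0 \<le> B u u + 2 * (- B u v / B v v) * B u v + (- B u v / B v v)\<^sup>2 * B v v" by (rule quad)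
    also have "\<dots> = B u u - (B u v)\<^sup>2 / B v v" using c by (simp add: power2_eq_square field_simps)
    finally show ?thesis using c by (simp add: field_simps)
  qed
  then have "sqrt ((B u v)\<^sup>2) \<le> sqrt (B u u * B v v)" by (rule real_sqrt_le_mono)
  then show ?thesis by (simp add: real_sqrt_mult)
qed

lemma finite_measure_lebesgue_on: "open \<Omega> \<Longrightarrow> bounded \<Omega> \<Longrightarrow> finite_measure (lebesgue_on \<Omega>)"
  for \<Omega> :: "'a::euclidean_space set"
  using emeasure_bounded_finite[of \<Omega>]
  by (intro finite_measureI) (auto simp: emeasure_restrict_space space_restrict_space)

lemma square_integrable_add:
  assumes "square_integrable M u" "square_integrable M v"
  shows "square_integrable M (\<lambda>x. u x + v x)"
proof -
  have [measurable]: "u \<in> borel_measurable M" "v \<in> borel_measurable M"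
    using assms by (auto simp: square_integrable_def)
  have "integrable M (\<lambda>x. (norm (u x + v x))\<^sup>2)"
  proof (rule Bochner_Integration.integrable_bound)
    show "integrable M (\<lambda>x. 2 * (norm (u x))\<^sup>2 + 2 * (norm (v x))\<^sup>2)"
      using assms by (auto simp: square_integrable_def)
    show "AE x in M. norm ((norm (u x + v x))\<^sup>2) \<le> norm (2 * (norm (u x))\<^sup>2 + 2 * (norm (v x))\<^sup>2)"
    proof (rule AE_I2)
      fix x
      have "(norm (u x + v x))\<^sup>2 \<le> (norm (u x) + norm (v x))\<^sup>2"
        by (intro power_mono norm_triangle_ineq) simp
      also have "\<dots> \<le> 2 * (norm (u x))\<^sup>2 + 2 * (norm (v x))\<^sup>2"
        using sum_squares_bound[of "norm (u x)" "norm (v x)"] by (simp add: power2_sum)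
      finally show "norm ((norm (u x + v x))\<^sup>2) \<le> norm (2 * (norm (u x))\<^sup>2 + 2 * (norm (v x))\<^sup>2)"
        by simp
    qed
  qed measurable
  then show ?thesis by (simp add: square_integrable_def)
qed

lemma square_integrable_scaleR:
  "square_integrable M u \<Longrightarrow> square_integrable M (\<lambda>x. c *\<^sub>R u x)"
  by (auto simp: square_integrable_def power_mult_distrib)

lemma square_integrable_inner:
  fixes u v :: "'a \<Rightarrow> 'b::{real_inner, second_countable_topology}"
  assumes "square_integrable M u" "square_integrable M v"
  shows "integrable M (\<lambda>x. u x \<bullet> v x)"
proof (rule Bochner_Integration.integrable_bound)
  show "integrable M (\<lambda>x. (norm (u x))\<^sup>2 + (norm (v x))\<^sup>2)"
    using assms by (auto simp: square_integrable_def)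
  show "(\<lambda>x. u x \<bullet> v x) \<in> borel_measurable M"
    using assms by (auto simp: square_integrable_def intro: borel_measurable_inner)
  show "AE x in M. norm (u x \<bullet> v x) \<le> norm ((norm (u x))\<^sup>2 + (norm (v x))\<^sup>2)"
  proof (rule AE_I2)
    fix x
    have "\<bar>u x \<bullet> v x\<bar> \<le> norm (u x) * norm (v x)" by (rule Cauchy_Schwarz_ineq2)
    also have "\<dots> \<le> (norm (u x))\<^sup>2 + (norm (v x))\<^sup>2"
      using sum_squares_bound[of "norm (u x)" "norm (v x)"]
        mult_nonneg_nonneg[OF norm_ge_zero[of "u x"] norm_ge_zero[of "v x"]] by linarith
    finally show "norm (u x \<bullet> v x) \<le> norm ((norm (u x))\<^sup>2 + (norm (v x))\<^sup>2)" by simp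
  qed
qed

lemmas square_integrable_mult = square_integrable_inner[where 'b = real, simplified]

lemma (in finite_measure) square_integrable_bounded:
  assumes "u \<in> borel_measurable M" "\<And>x. x \<in> space M \<Longrightarrow> norm (u x) \<le> B"
  shows "square_integrable M u"
  unfolding square_integrable_def
proof
  show "integrable M (\<lambda>x. (norm (u x))\<^sup>2)"
  proof (rule integrable_const_bound[where B = "B\<^sup>2"])
    show "AE x in M. norm ((norm (u x))\<^sup>2) \<le> B\<^sup>2"
      using assms(2) by (intro AE_I2) (auto intro: power_mono)
  qed (use assms(1) in measurable)
qed (rule assms(1))

lemma (in finite_measure) square_integrable_integrable:
  fixes u :: "'a \<Rightarrow> 'b::{banach, second_countable_topology}"
  assumes "square_integrable M u" shows "integrable M u"
proof (rule Bochner_Integration.integrable_bound)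
  show "integrable M (\<lambda>x. 1 + (norm (u x))\<^sup>2)"
    using assms by (auto simp: square_integrable_def)
  show "AE x in M. norm (u x) \<le> norm (1 + (norm (u x))\<^sup>2)"
  proof (rule AE_I2)
    fix x show "norm (u x) \<le> norm (1 + (norm (u x))\<^sup>2)"
      using sum_squares_bound[of 1 "norm (u x)"] by (simp add: add_nonneg_nonneg) (smt (verit) norm_ge_zero)
  qed
qed (use assms in \<open>simp add: square_integrable_def\<close>)

lemma test_fun_bounded:
  assumes "test_fun \<Omega> \<phi>"
  obtains B where "\<And>x. norm (\<phi> x) \<le> B"
proof -
  have "\<phi> x = 0" if "x \<notin> closure {x. \<phi> x \<noteq> 0}" for x
    using that closure_subset[of "{x. \<phi> x \<noteq> 0}"] by auto
  moreover have "continuous_on UNIV \<phi>" "compact (closure {x. \<phi> x \<noteq> 0})"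
    using assms C1_fun_continuous unfolding test_fun_def by auto
  ultimately obtain B where "B > 0" "\<And>x. norm (\<phi> x) \<le> B"
    using continuous_compact_support_bounded[of \<phi> "closure {x. \<phi> x \<noteq> 0}"] by metis
  then show ?thesis using that by metis
qed

lemma test_fun_gradient_bounded:
  assumes "test_fun \<Omega> \<phi>" "\<And>x. GDERIV \<phi> x :> \<phi>' x" "continuous_on UNIV \<phi>'"
  obtains B where "\<And>x. norm (\<phi>' x) \<le> B"
proof -
  have "compact (closure {x. \<phi> x \<noteq> 0})" using assms(1) unfolding test_fun_def by simp
  then obtain B where "B > 0" "\<And>x. norm (\<phi>' x) \<le> B"
    using continuous_compact_support_bounded[OF assms(3) _ test_fun_gradient(2)[OF assms(1,2)]] by metis
  then show ?thesis using that by metis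
qed

lemma h1_form_commute: "h1_form \<Omega> u v = h1_form \<Omega> v u"
  by (simp add: h1_form_def inner_commute mult.commute)

lemma h1_form_nonneg: "0 \<le> h1_form \<Omega> u u"
  unfolding h1_form_def by (intro integral_nonneg_AE AE_I2) simp

context
  fixes \<Omega> :: "'a::euclidean_space set"
  assumes \<Omega>: "open \<Omega>" "bounded \<Omega>"
begin

interpretation finite_measure "lebesgue_on \<Omega>"
  using \<Omega> by (rule finite_measure_lebesgue_on)

lemma test_fun_scaleR_integrable:
  assumes "test_fun \<Omega> \<phi>" "square_integrable (lebesgue_on \<Omega>) (G :: 'a \<Rightarrow> 'b::{banach, second_countable_topology})"
  shows "integrable (lebesgue_on \<Omega>) (\<lambda>x. \<phi> x *\<^sub>R G x)"
proof -
  obtain B where B: "\<And>x. norm (\<phi> x) \<le> B" using test_fun_bounded[OF assms(1)] by metis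
  have \<phi>: "\<phi> \<in> borel_measurable (lebesgue_on \<Omega>)"
    using assms(1) by (auto simp: test_fun_def intro!: borel_measurable_lebesgue_on borel_measurable_continuous_onI C1_fun_continuous)
  have "integrable (lebesgue_on \<Omega>) (\<lambda>x. B *\<^sub>R G x)"
    using square_integrable_integrable[OF assms(2)] by simp
  then show ?thesis
  proof (rule Bochner_Integration.integrable_bound)
    show "AE x in lebesgue_on \<Omega>. norm (\<phi> x *\<^sub>R G x) \<le> norm (B *\<^sub>R G x)"
      using B by (intro AE_I2) (auto intro!: mult_right_mono order_trans[OF _ abs_ge_self])
  qed (use \<phi> assms(2) in \<open>auto simp: square_integrable_def intro: borel_measurable_scaleR\<close>)
qed

text \<open>Test functions annihilate each coordinate of the difference. Since \<open>grad\<close>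
  is an arbitrary choice among weak gradients, the bilinearity of \<open>h1_form\<close> depends on
  this uniqueness.\<close>

lemma weak_gradient_unique:
  assumes G: "square_integrable (lebesgue_on \<Omega>) G1" "weak_gradient \<Omega> v G1"
      "square_integrable (lebesgue_on \<Omega>) G2" "weak_gradient \<Omega> v G2"
  shows "AE x in lebesgue_on \<Omega>. G1 x = G2 x"
proof -
  have "AE x in lebesgue_on \<Omega>. (G1 x - G2 x) \<bullet> b = 0" for b
  proof (rule fundamental_lemma_variations[OF \<Omega>(1)])
    show "integrable (lebesgue_on \<Omega>) (\<lambda>x. (G1 x - G2 x) \<bullet> b)"
      using G by (intro integrable_inner_left Bochner_Integration.integrable_diff square_integrable_integrable)
    fix \<phi> :: "'a \<Rightarrow> real" assume t: "test_fun \<Omega> \<phi>"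
    then obtain \<phi>' where \<phi>': "\<forall>x. GDERIV \<phi> x :> \<phi>' x" "continuous_on UNIV \<phi>'"
      unfolding test_fun_def C1_fun_def by blast
    have "(LINT x|lebesgue_on \<Omega>. \<phi> x *\<^sub>R G1 x) = (LINT x|lebesgue_on \<Omega>. \<phi> x *\<^sub>R G2 x)"
    proof -
      have "(LINT x|lebesgue_on \<Omega>. v x *\<^sub>R \<phi>' x) = - (LINT x|lebesgue_on \<Omega>. \<phi> x *\<^sub>R G1 x)"
        using G(2)[unfolded weak_gradient_test_fun, rule_format, of \<phi> \<phi>'] t \<phi>' by simp
      moreover have "(LINT x|lebesgue_on \<Omega>. v x *\<^sub>R \<phi>' x) = - (LINT x|lebesgue_on \<Omega>. \<phi> x *\<^sub>R G2 x)"
        using G(4)[unfolded weak_gradient_test_fun, rule_format, of \<phi> \<phi>'] t \<phi>' by simp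
      ultimately show ?thesis by simp
    qed
    then have "(LINT x|lebesgue_on \<Omega>. \<phi> x *\<^sub>R G1 x - \<phi> x *\<^sub>R G2 x) = 0"
      using test_fun_scaleR_integrable[OF t G(1)] test_fun_scaleR_integrable[OF t G(3)] by simp
    moreover have "(LINT x|lebesgue_on \<Omega>. \<phi> x * ((G1 x - G2 x) \<bullet> b)) =
        (LINT x|lebesgue_on \<Omega>. (\<phi> x *\<^sub>R G1 x - \<phi> x *\<^sub>R G2 x) \<bullet> b)"
      by (intro Bochner_Integration.integral_cong) (auto simp: inner_diff_left right_diff_distrib)
    moreover have "\<dots> = (LINT x|lebesgue_on \<Omega>. \<phi> x *\<^sub>R G1 x - \<phi> x *\<^sub>R G2 x) \<bullet> b"
      using test_fun_scaleR_integrable[OF t G(1)] test_fun_scaleR_integrable[OF t G(3)]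
      by (intro integral_inner_left) auto
    ultimately show "(LINT x|lebesgue_on \<Omega>. \<phi> x * ((G1 x - G2 x) \<bullet> b)) = 0" by simp
  qed
  then have "AE x in lebesgue_on \<Omega>. \<forall>b\<in>Basis. (G1 x - G2 x) \<bullet> b = 0"
    by (intro AE_finite_allI) auto
  then show ?thesis
    by eventually_elim (rule euclidean_eqI, simp add: inner_diff_left)
qed

lemma weak_gradient_add:
  assumes "square_integrable (lebesgue_on \<Omega>) u" "square_integrable (lebesgue_on \<Omega>) v"
      "square_integrable (lebesgue_on \<Omega>) G" "square_integrable (lebesgue_on \<Omega>) H"
      "weak_gradient \<Omega> u G" "weak_gradient \<Omega> v H"
  shows "weak_gradient \<Omega> (\<lambda>x. u x + v x) (\<lambda>x. G x + H x)"
  unfolding weak_gradient_test_fun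
proof (intro allI impI, elim conjE)
  fix \<phi> :: "'a \<Rightarrow> real" and \<phi>'
  assume t: "test_fun \<Omega> \<phi>" and \<phi>': "\<forall>x. GDERIV \<phi> x :> \<phi>' x" "continuous_on UNIV \<phi>'"
  obtain B where B: "\<And>x. norm (\<phi>' x) \<le> B"
    using test_fun_gradient_bounded[OF t \<phi>'(1)[rule_format] \<phi>'(2)] by blast
  have m: "\<phi>' \<in> borel_measurable (lebesgue_on \<Omega>)"
    using \<phi>'(2) by (intro borel_measurable_lebesgue_on borel_measurable_continuous_onI)
  have i: "integrable (lebesgue_on \<Omega>) (\<lambda>x. w x *\<^sub>R \<phi>' x)" if w: "square_integrable (lebesgue_on \<Omega>) w" for w :: "'a \<Rightarrow> real"
  proof (rule Bochner_Integration.integrable_bound[of _ "\<lambda>x. B * w x"])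
    show "integrable (lebesgue_on \<Omega>) (\<lambda>x. B * w x)" using square_integrable_integrable[OF w] by simp
    have "norm (\<phi>' x) \<le> \<bar>B\<bar>" for x using B[of x] by simp
    then show "AE x in lebesgue_on \<Omega>. norm (w x *\<^sub>R \<phi>' x) \<le> norm (B * w x)"
      by (intro AE_I2) (simp add: abs_mult mult.commute[of "\<bar>B\<bar>"] mult_left_mono)
  qed (use m w in \<open>auto simp: square_integrable_def intro: borel_measurable_scaleR\<close>)
  have "(LINT x|lebesgue_on \<Omega>. (u x + v x) *\<^sub>R \<phi>' x) =
      (LINT x|lebesgue_on \<Omega>. u x *\<^sub>R \<phi>' x) + (LINT x|lebesgue_on \<Omega>. v x *\<^sub>R \<phi>' x)"
    using i[OF assms(1)] i[OF assms(2)] by (simp add: scaleR_add_left)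
  also have "\<dots> = - (LINT x|lebesgue_on \<Omega>. \<phi> x *\<^sub>R G x) + - (LINT x|lebesgue_on \<Omega>. \<phi> x *\<^sub>R H x)"
    using assms(5,6) t \<phi>' unfolding weak_gradient_test_fun by (intro arg_cong2[of _ _ _ _ "(+)"]) blast+
  also have "\<dots> = - (LINT x|lebesgue_on \<Omega>. \<phi> x *\<^sub>R (G x + H x))"
    using test_fun_scaleR_integrable[OF t assms(3)] test_fun_scaleR_integrable[OF t assms(4)]
    by (simp add: scaleR_add_right)
  finally show "(LINT x|lebesgue_on \<Omega>. (u x + v x) *\<^sub>R \<phi>' x) = - (LINT x|lebesgue_on \<Omega>. \<phi> x *\<^sub>R (G x + H x))" .
qed

lemma weak_gradient_scale:
  assumes "weak_gradient \<Omega> u G"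
  shows "weak_gradient \<Omega> (\<lambda>x. c * u x) (\<lambda>x. c *\<^sub>R G x)"
  unfolding weak_gradient_test_fun
proof (intro allI impI)
  fix \<phi> :: "'a \<Rightarrow> real" and \<phi>'
  assume "test_fun \<Omega> \<phi> \<and> (\<forall>x. GDERIV \<phi> x :> \<phi>' x) \<and> continuous_on UNIV \<phi>'"
  then have "(LINT x|lebesgue_on \<Omega>. u x *\<^sub>R \<phi>' x) = - (LINT x|lebesgue_on \<Omega>. \<phi> x *\<^sub>R G x)"
    using assms unfolding weak_gradient_test_fun by simp
  then show "(LINT x|lebesgue_on \<Omega>. (c * u x) *\<^sub>R \<phi>' x) = - (LINT x|lebesgue_on \<Omega>. \<phi> x *\<^sub>R c *\<^sub>R G x)"
    by (simp add: scaleR_scaleR[symmetric] scaleR_left_commute[of _ c] del: scaleR_scaleR)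
qed

lemma grad_H1:
  assumes "v \<in> H1 \<Omega>"
  shows "square_integrable (lebesgue_on \<Omega>) v" "square_integrable (lebesgue_on \<Omega>) (grad \<Omega> v)"
    "weak_gradient \<Omega> v (grad \<Omega> v)"
proof -
  have "\<exists>G. square_integrable (lebesgue_on \<Omega>) G \<and> weak_gradient \<Omega> v G" using assms by (simp add: H1_def)
  then have "square_integrable (lebesgue_on \<Omega>) (grad \<Omega> v) \<and> weak_gradient \<Omega> v (grad \<Omega> v)"
    unfolding grad_def by (rule someI_ex)
  then show "square_integrable (lebesgue_on \<Omega>) (grad \<Omega> v)" "weak_gradient \<Omega> v (grad \<Omega> v)" by auto
  show "square_integrable (lebesgue_on \<Omega>) v" using assms by (simp add: H1_def)
qed

lemma H1_add: "u \<in> H1 \<Omega> \<Longrightarrow> v \<in> H1 \<Omega> \<Longrightarrow> (\<lambda>x. u x + v x) \<in> H1 \<Omega>"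
  using weak_gradient_add[OF grad_H1(1) grad_H1(1) grad_H1(2) grad_H1(2) grad_H1(3) grad_H1(3), of u v]
    square_integrable_add[OF grad_H1(1) grad_H1(1), of u v] square_integrable_add[OF grad_H1(2) grad_H1(2), of u v]
  unfolding H1_def[of \<Omega>] by blast

lemma H1_scale: "u \<in> H1 \<Omega> \<Longrightarrow> (\<lambda>x. c * u x) \<in> H1 \<Omega>"
  using weak_gradient_scale[OF grad_H1(3), of u c]
    square_integrable_scaleR[OF grad_H1(1), of u c] square_integrable_scaleR[OF grad_H1(2), of u c]
  unfolding H1_def[of \<Omega>] by auto

lemma h1_form_integrable:
  assumes "u \<in> H1 \<Omega>" "v \<in> H1 \<Omega>"
  shows "integrable (lebesgue_on \<Omega>) (\<lambda>x. grad \<Omega> u x \<bullet> grad \<Omega> v x + u x * v x)"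
  using assms by (intro Bochner_Integration.integrable_add square_integrable_inner square_integrable_mult grad_H1)

lemma h1_form_add_left:
  assumes "u \<in> H1 \<Omega>" "v \<in> H1 \<Omega>" "w \<in> H1 \<Omega>"
  shows "h1_form \<Omega> (\<lambda>x. u x + v x) w = h1_form \<Omega> u w + h1_form \<Omega> v w"
proof -
  have "AE x in lebesgue_on \<Omega>. grad \<Omega> (\<lambda>x. u x + v x) x = grad \<Omega> u x + grad \<Omega> v x"
    using assms by (intro weak_gradient_unique[of _ "\<lambda>x. u x + v x"] grad_H1 H1_add weak_gradient_add square_integrable_add)
  then have "AE x in lebesgue_on \<Omega>. grad \<Omega> (\<lambda>x. u x + v x) x \<bullet> grad \<Omega> w x + (u x + v x) * w x =
      (grad \<Omega> u x \<bullet> grad \<Omega> w x + u x * w x) + (grad \<Omega> v x \<bullet> grad \<Omega> w x + v x * w x)"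
    by eventually_elim (simp add: inner_add_left distrib_right)
  then have "h1_form \<Omega> (\<lambda>x. u x + v x) w =
      (LINT x|lebesgue_on \<Omega>. (grad \<Omega> u x \<bullet> grad \<Omega> w x + u x * w x) + (grad \<Omega> v x \<bullet> grad \<Omega> w x + v x * w x))"
    unfolding h1_form_def using assms
    by (intro integral_cong_AE borel_measurable_integrable Bochner_Integration.integrable_add h1_form_integrable H1_add) auto
  then show ?thesis
    unfolding h1_form_def using assms by (simp add: Bochner_Integration.integral_add[OF h1_form_integrable h1_form_integrable])
qed

lemma h1_form_scale_left:
  assumes "u \<in> H1 \<Omega>" "w \<in> H1 \<Omega>"
  shows "h1_form \<Omega> (\<lambda>x. c * u x) w = c * h1_form \<Omega> u w"
proof -
  have "AE x in lebesgue_on \<Omega>. grad \<Omega> (\<lambda>x. c * u x) x = c *\<^sub>R grad \<Omega> u x"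
    using assms by (intro weak_gradient_unique[of _ "\<lambda>x. c * u x"] grad_H1 H1_scale weak_gradient_scale square_integrable_scaleR)
  then have "AE x in lebesgue_on \<Omega>. grad \<Omega> (\<lambda>x. c * u x) x \<bullet> grad \<Omega> w x + (c * u x) * w x =
      c * (grad \<Omega> u x \<bullet> grad \<Omega> w x + u x * w x)"
    by eventually_elim (simp add: distrib_left)
  then have "h1_form \<Omega> (\<lambda>x. c * u x) w = (LINT x|lebesgue_on \<Omega>. c * (grad \<Omega> u x \<bullet> grad \<Omega> w x + u x * w x))"
    unfolding h1_form_def using assms
    by (intro integral_cong_AE borel_measurable_integrable integrable_mult_right h1_form_integrable H1_scale) auto
  then show ?thesis unfolding h1_form_def by simp
qed

lemma h1_form_le_norm:
  assumes "u \<in> H1 \<Omega>" "v \<in> H1 \<Omega>"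
  shows "\<bar>h1_form \<Omega> u v\<bar> \<le> h1_norm \<Omega> u * h1_norm \<Omega> v"
  unfolding h1_norm_def
proof (rule form_Cauchy_Schwarz[of "h1_form \<Omega>"])
  fix t
  have tv: "(\<lambda>x. t * v x) \<in> H1 \<Omega>" "(\<lambda>x. u x + t * v x) \<in> H1 \<Omega>"
    using assms by (auto intro: H1_scale H1_add)
  have left: "h1_form \<Omega> (\<lambda>x. u x + t * v x) w = h1_form \<Omega> u w + t * h1_form \<Omega> v w" if "w \<in> H1 \<Omega>" for w
    using h1_form_add_left[OF assms(1) tv(1) that] h1_form_scale_left[OF assms(2) that, of t] by simp
  have right: "h1_form \<Omega> w (\<lambda>x. u x + t * v x) = h1_form \<Omega> w u + t * h1_form \<Omega> w v" if "w \<in> H1 \<Omega>" for w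
    using left[OF that] by (metis h1_form_commute)
  have "h1_form \<Omega> (\<lambda>x. u x + t * v x) (\<lambda>x. u x + t * v x) =
      h1_form \<Omega> u u + 2 * t * h1_form \<Omega> u v + t\<^sup>2 * h1_form \<Omega> v v"
    unfolding left[OF tv(2)] right[OF assms(1)] right[OF assms(2)] h1_form_commute[of \<Omega> v u]
    by (simp add: power2_eq_square algebra_simps)
  then show "0 \<le> h1_form \<Omega> u u + 2 * t * h1_form \<Omega> u v + t\<^sup>2 * h1_form \<Omega> v v"
    using h1_form_nonneg by metis
qed (rule h1_form_nonneg)+

text \<open>The set where a continuous \<open>u\<close> does not vanish is open in
  \<open>\<Omega>\<close> and null, hence empty; density extends this to the closure. It makes the
  H1 form definite on finite element functions.\<close>

lemma h1_norm_eq_0_continuous: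
  assumes u: "u \<in> H1 \<Omega>" "h1_form \<Omega> u u = 0" "continuous_on (closure \<Omega>) u" and x: "x \<in> closure \<Omega>"
  shows "u x = 0"
proof -
  have "AE x in lebesgue_on \<Omega>. grad \<Omega> u x \<bullet> grad \<Omega> u x + u x * u x = 0"
    using u(2) integral_nonneg_eq_0_iff_AE[OF h1_form_integrable[OF u(1) u(1)]]
    unfolding h1_form_def by simp
  then have "AE x in lebesgue_on \<Omega>. u x = 0"
    by eventually_elim (simp add: add_nonneg_eq_0_iff)
  then have ae: "AE x in lborel. x \<in> \<Omega> \<longrightarrow> u x = 0"
    using AE_restrict_space_iff[of \<Omega> lebesgue] \<Omega>(1) AE_completion_iff by auto
  have "u y = 0" if y: "y \<in> \<Omega>" for y
  proof (rule ccontr)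
    assume n: "u y \<noteq> 0"
    have "continuous_on \<Omega> u" using u(3) closure_subset by (rule continuous_on_subset)
    then have o: "open (\<Omega> \<inter> u -` (- {0}))"
      using \<Omega>(1) by (intro continuous_open_preimage) auto
    have "AE x in lborel. x \<notin> \<Omega> \<inter> u -` (- {0})" using ae by eventually_elim auto
    then have "\<Omega> \<inter> u -` (- {0}) \<in> null_sets lborel"
      using o by (simp add: AE_iff_null_sets)
    then have "negligible (\<Omega> \<inter> u -` (- {0}))"
      by (simp add: negligible_iff_null_sets null_sets_completionI)
    then have "\<Omega> \<inter> u -` (- {0}) = {}" using o open_not_negligible by blast
    then show False using y n by blast
  qed
  then show ?thesis
    using continuous_constant_on_closure[OF u(3), of 0 x] x by blast
qed

lemma C1_fun_H1:
  assumes v: "C1_fun v" shows "v \<in> H1 \<Omega>"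
proof -
  obtain v' where v': "\<And>x. GDERIV v x :> v' x" "continuous_on UNIV v'"
    using v unfolding C1_fun_def by blast
  have c: "compact (closure \<Omega>)" using \<Omega>(2) by simp
  have bnd: "\<exists>B. \<forall>x\<in>\<Omega>. norm (h x) \<le> B" if "continuous_on UNIV h" for h :: "'a \<Rightarrow> 'c::real_normed_vector"
  proof -
    have "bounded (h ` closure \<Omega>)"
      using c that by (meson compact_continuous_image compact_imp_bounded continuous_on_subset subset_UNIV)
    then show ?thesis using closure_subset[of \<Omega>] unfolding bounded_iff by blast
  qed
  have vc: "continuous_on UNIV v" using v by (rule C1_fun_continuous)
  obtain B B' where B: "\<And>x. x \<in> \<Omega> \<Longrightarrow> norm (v x) \<le> B" "\<And>x. x \<in> \<Omega> \<Longrightarrow> norm (v' x) \<le> B'"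
    using bnd[OF vc] bnd[OF v'(2)] by blast
  have m: "v \<in> borel_measurable borel" "v' \<in> borel_measurable borel"
    using vc v'(2) by (auto intro: borel_measurable_continuous_onI)
  have "weak_gradient \<Omega> v v'"
  proof (rule weak_gradientI[OF \<Omega> m(1) _ m(2)])
    fix \<phi> :: "'a \<Rightarrow> real" assume t: "test_fun \<Omega> \<phi>"
    have "C1_fun (\<lambda>x. v x * \<phi> x)" using v t by (auto simp: test_fun_def intro: C1_fun_mult)
    then obtain g' where g': "\<And>x. GDERIV (\<lambda>x. v x * \<phi> x) x :> g' x" "continuous_on UNIV g'"
      unfolding C1_fun_def by blast
    let ?K = "closure {x. \<phi> x \<noteq> 0}"
    have "g' x = 0" if "x \<notin> ?K" for x
      by (rule GDERIV_eq_zero[OF g'(1)[of x], where U = "- ?K"]) (use that closure_subset[of "{x. \<phi> x \<noteq> 0}"] in auto)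
    moreover have "compact ?K" using t by (simp add: test_fun_def)
    ultimately obtain L where L: "L > 0" "\<And>x. norm (g' x) \<le> L"
      using continuous_compact_support_bounded[OF g'(2)] by blast
    have "L-lipschitz_on UNIV (\<lambda>x. v x * \<phi> x)"
    proof (rule bounded_derivative_imp_lipschitz)
      show "((\<lambda>x. v x * \<phi> x) has_derivative (\<lambda>h. h \<bullet> g' x)) (at x within UNIV)" for x
        using g'(1) unfolding gderiv_def by simp
      show "onorm (\<lambda>h. h \<bullet> g' x) \<le> L" for x
      proof (rule onorm_le)
        fix h show "norm (h \<bullet> g' x) \<le> L * norm h"
          using Cauchy_Schwarz_ineq2[of h "g' x"] L(2)[of x]
          by (metis mult.commute mult_left_mono norm_ge_zero order_trans real_norm_def)
      qed
    qed (use L in auto)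
    then show "\<exists>L. L-lipschitz_on UNIV (\<lambda>x. v x * \<phi> x)" ..
  qed (use v'(1) B(1) in auto)
  moreover have "square_integrable (lebesgue_on \<Omega>) v" "square_integrable (lebesgue_on \<Omega>) v'"
    using B m by (auto intro!: square_integrable_bounded borel_measurable_lebesgue_on)
  ultimately show ?thesis unfolding H1_def by blast
qed

text \<open>The cellwise gradients form a weak gradient because continuity across the cells makes
  \<open>v x * \<phi> x\<close> globally Lipschitz. This is checked along segments, which are
  covered by finitely many closed sets on each of which the function is Lipschitz.\<close>

lemma piecewise_C1_H1:
  assumes cont: "continuous_on (closure \<Omega>) v" "\<And>x. x \<notin> closure \<Omega> \<Longrightarrow> v x = 0"
    and \<M>: "finite \<M>" "closure \<Omega> = \<Union>\<M>" "\<And>T. T \<in> \<M> \<Longrightarrow> compact T \<and> convex T"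
      "\<And>T T'. \<lbrakk>T \<in> \<M>; T' \<in> \<M>; T \<noteq> T'\<rbrakk> \<Longrightarrow> interior T \<inter> interior T' = {}"
    and pieces: "\<And>T. T \<in> \<M> \<Longrightarrow> \<exists>q. C1_fun q \<and> (\<forall>x\<in>T. v x = q x)"
  shows "v \<in> H1 \<Omega>"
proof -
  obtain q where q: "\<And>T. T \<in> \<M> \<Longrightarrow> C1_fun (q T)" "\<And>T x. T \<in> \<M> \<Longrightarrow> x \<in> T \<Longrightarrow> v x = q T x"
    using pieces by metis
  then obtain q' where q': "\<And>T x. T \<in> \<M> \<Longrightarrow> GDERIV (q T) x :> q' T x" "\<And>T. T \<in> \<M> \<Longrightarrow> continuous_on UNIV (q' T)"
    unfolding C1_fun_def by metis
  \<comment> \<open>The interiors are disjoint, so at most one term is nonzero at a point; the cell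
    boundaries form a null set.\<close>
  define G where "G x = (\<Sum>T\<in>\<M>. indicator (interior T) x *\<^sub>R q' T x)" for x
  have Gm: "G \<in> borel_measurable borel"
    unfolding G_def using q'(2)
    by (intro borel_measurable_sum borel_measurable_scaleR borel_measurable_indicator borel_measurable_continuous_onI) auto
  have vm: "v \<in> borel_measurable borel"
  proof -
    have "(\<lambda>x. if x \<in> closure \<Omega> then v x else 0) \<in> borel_measurable borel"
      by (rule borel_measurable_continuous_on_if) (use cont(1) in auto)
    also have "(\<lambda>x. if x \<in> closure \<Omega> then v x else 0) = v" using cont(2) by auto
    finally show ?thesis .
  qed
  have "compact (closure \<Omega>)" using \<Omega>(2) by simp
  then obtain B where B: "\<And>x. x \<in> closure \<Omega> \<Longrightarrow> norm (v x) \<le> B"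
    using compact_imp_bounded[OF compact_continuous_image[OF cont(1)]] unfolding bounded_iff by blast
  have Bv: "norm (v x) \<le> B" if "x \<in> \<Omega>" for x using B that closure_subset by blast
  have "\<exists>B\<ge>0. \<forall>x\<in>T. norm (q' T x) \<le> B" if "T \<in> \<M>" for T
  proof -
    have "bounded (q' T ` T)"
      using \<M>(3)[OF that] q'(2)[OF that]
      by (meson compact_continuous_image compact_imp_bounded continuous_on_subset subset_UNIV)
    then obtain B where "B > 0" "\<forall>y\<in>q' T ` T. norm y \<le> B" using bounded_pos by blast
    then show ?thesis by (intro exI[of _ B]) auto
  qed
  then obtain BT where BT: "\<And>T. T \<in> \<M> \<Longrightarrow> 0 \<le> BT T" "\<And>T x. T \<in> \<M> \<Longrightarrow> x \<in> T \<Longrightarrow> norm (q' T x) \<le> BT T"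
    by metis
  have GB: "norm (G x) \<le> (\<Sum>T\<in>\<M>. BT T)" for x
    unfolding G_def
  proof (rule sum_norm_le)
    fix T assume T: "T \<in> \<M>"
    show "norm (indicator (interior T) x *\<^sub>R q' T x) \<le> BT T"
      using BT[OF T] interior_subset[of T] by (auto simp: indicator_def)
  qed
  have nullF: "(\<Union>T\<in>\<M>. frontier T) \<in> null_sets lborel"
  proof (rule null_sets_UN'[OF countable_finite])
    fix T assume "T \<in> \<M>"
    then have "negligible (frontier T)" using \<M>(3) negligible_convex_frontier by blast
    then have "frontier T \<in> null_sets (completion lborel)" by (simp add: negligible_iff_null_sets)
    moreover have "frontier T \<in> sets lborel" by simp
    ultimately show "frontier T \<in> null_sets lborel" using null_sets_completion_iff by blast
  qed (rule \<M>(1))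
  have "AE x in lborel. x \<in> \<Omega> \<longrightarrow> GDERIV v x :> G x"
    using AE_not_in[OF nullF]
  proof eventually_elim
    case (elim x)
    show ?case
    proof
      assume "x \<in> \<Omega>"
      then obtain T where T: "T \<in> \<M>" "x \<in> T" using \<M>(2) closure_subset by blast
      then have i: "x \<in> interior T"
        using elim closure_subset[of T] unfolding frontier_def by blast
      have "G x = (\<Sum>T'\<in>{T}. indicator (interior T') x *\<^sub>R q' T' x)"
        unfolding G_def
        using \<M>(1) T(1) \<M>(4)[OF T(1)] i by (intro sum.mono_neutral_right) (auto simp: indicator_def)
      then have "G x = q' T x" using i by simp
      moreover have "GDERIV v x :> q' T x"
        unfolding gderiv_def
      proof (rule has_derivative_transform_within_open[of "q T" _ x _ "interior T"])
        show "(q T has_derivative (\<lambda>h. h \<bullet> q' T x)) (at x)" using q'(1)[OF T(1)] by (simp add: gderiv_def)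
        show "q T y = v y" if "y \<in> interior T" for y
          using q(2)[OF T(1)] that interior_subset by force
      qed (use i in auto)
      ultimately show "GDERIV v x :> G x" by simp
    qed
  qed
  moreover have "\<exists>L. L-lipschitz_on UNIV (\<lambda>x. v x * \<phi> x)" if t: "test_fun \<Omega> \<phi>" for \<phi>
  proof -
    let ?g = "\<lambda>x. v x * \<phi> x"
    have "\<exists>L. L-lipschitz_on T ?g" if T: "T \<in> \<M>" for T
    proof -
      have "C1_fun (\<lambda>x. q T x * \<phi> x)" using q(1)[OF T] t by (auto simp: test_fun_def intro: C1_fun_mult)
      then obtain L where "L-lipschitz_on T (\<lambda>x. q T x * \<phi> x)" using C1_fun_lipschitz \<M>(3)[OF T] by blast
      then have "L-lipschitz_on T ?g"
        by (rule lipschitz_on_transform) (use q(2)[OF T] in auto)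
      then show ?thesis ..
    qed
    then obtain LT where LT: "\<And>T. T \<in> \<M> \<Longrightarrow> (LT T)-lipschitz_on T ?g" by metis
    define L where "L = (\<Sum>T\<in>\<M>. LT T)"
    have LT0: "LT T \<ge> 0" if "T \<in> \<M>" for T using lipschitz_on_nonneg[OF LT[OF that]] .
    have LL: "LT T \<le> L" if "T \<in> \<M>" for T
      unfolding L_def using \<M>(1) that LT0 by (intro member_le_sum) auto
    have L0: "L \<ge> 0" unfolding L_def using LT0 by (intro sum_nonneg) auto
    have "L-lipschitz_on UNIV ?g"
    proof (rule lipschitz_onI)
      fix x y :: 'a
      define \<gamma> where "\<gamma> s = x + s *\<^sub>R (y - x)" for s :: real
      have \<gamma>c: "continuous_on UNIV \<gamma>" unfolding \<gamma>_def by (intro continuous_intros)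
      have \<gamma>d: "dist (\<gamma> s) (\<gamma> s') = dist s s' * norm (y - x)" for s s'
        by (simp add: \<gamma>_def dist_norm scaleR_left_diff_distrib[symmetric] del: scaleR_left_diff_distrib)
      \<comment> \<open>The segment may leave \<open>\<Omega>\<close>: the index \<open>None\<close>
        stands for its part outside, where \<open>\<phi>\<close> vanishes.\<close>
      define U where "U i = (case i of None \<Rightarrow> \<gamma> -` (- \<Omega>) | Some T \<Rightarrow> \<gamma> -` T)" for i
      have "(L * norm (y - x))-lipschitz_on {0..1} (\<lambda>s. ?g (\<gamma> s))"
      proof (rule lipschitz_on_closed_Union[where U = U and I = "insert None (Some ` \<M>)"])
        fix i assume i: "i \<in> insert None (Some ` \<M>)"
        show "closed (U i)"
        proof (cases i)
          case None
          then show ?thesis using \<Omega>(1) \<gamma>c by (simp add: U_def closed_vimage closed_Compl)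
        next
          case (Some T)
          then have "closed T" using i \<M>(3)[of T] by (auto intro: compact_imp_closed)
          then show ?thesis using Some \<gamma>c by (simp add: U_def closed_vimage)
        qed
        show "(L * norm (y - x))-lipschitz_on (U i) (\<lambda>s. ?g (\<gamma> s))"
        proof (rule lipschitz_onI)
          fix s s' assume s: "s \<in> U i" "s' \<in> U i"
          show "dist (?g (\<gamma> s)) (?g (\<gamma> s')) \<le> L * norm (y - x) * dist s s'"
          proof (cases i)
            case None
            then have "\<phi> (\<gamma> s) = 0" "\<phi> (\<gamma> s') = 0"
              using s t closure_subset[of "{x. \<phi> x \<noteq> 0}"] by (auto simp: U_def test_fun_def)
            then show ?thesis using L0 by simp
          next
            case (Some T)
            then have T: "T \<in> \<M>" using i by auto
            have "dist (?g (\<gamma> s)) (?g (\<gamma> s')) \<le> LT T * dist (\<gamma> s) (\<gamma> s')"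
              using s Some by (intro lipschitz_onD[OF LT[OF T]]) (auto simp: U_def)
            also have "\<dots> \<le> L * dist (\<gamma> s) (\<gamma> s')" using LL[OF T] by (intro mult_right_mono) auto
            finally show ?thesis by (simp add: \<gamma>d mult_ac)
          qed
        qed (use L0 in simp)
      next
        show "{0..1} \<subseteq> (\<Union>i\<in>insert None (Some ` \<M>). U i)"
        proof
          fix s :: real
          show "s \<in> (\<Union>i\<in>insert None (Some ` \<M>). U i)"
          proof (cases "\<gamma> s \<in> \<Omega>")
            case True
            then obtain T where "T \<in> \<M>" "\<gamma> s \<in> T" using \<M>(2) closure_subset by blast
            then show ?thesis by (auto simp: U_def)
          qed (auto simp: U_def)
        qed
      qed (use \<M>(1) L0 in auto)
      from lipschitz_onD[OF this, of 0 1] show "dist (?g x) (?g y) \<le> L * dist x y"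
        by (simp add: \<gamma>_def dist_norm norm_minus_commute)
    qed (rule L0)
    then show ?thesis ..
  qed
  ultimately have "weak_gradient \<Omega> v G"
    using Bv by (intro weak_gradientI[OF \<Omega> vm _ Gm]) auto
  moreover have "square_integrable (lebesgue_on \<Omega>) v" "square_integrable (lebesgue_on \<Omega>) G"
    using Bv GB vm Gm by (auto intro!: square_integrable_bounded borel_measurable_lebesgue_on)
  ultimately show ?thesis unfolding H1_def by blast
qed

end

section \<open>Facets of full-dimensional polytopes\<close>

lemma facet_hyperplane:
  fixes T :: "'a::euclidean_space set"
  assumes T: "polytope T" "aff_dim T = int DIM('a)" and F: "F facet_of T"
  obtains a b where "a \<noteq> 0" "T \<subseteq> {x. a \<bullet> x \<le> b}" "F = T \<inter> {x. a \<bullet> x = b}" "affine hull F = {x. a \<bullet> x = b}"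
proof -
  have f: "F face_of T" "F \<noteq> {}" "aff_dim F = aff_dim T - 1" using F by (auto simp: facet_of_def)
  have "F exposed_face_of T"
    using exposed_face_of_polyhedron[OF polytope_imp_polyhedron[OF T(1)]] f(1) by blast
  then obtain a b where ab: "T \<subseteq> {x. a \<bullet> x \<le> b}" "F = T \<inter> {x. a \<bullet> x = b}"
    unfolding exposed_face_of_def by blast
  have "a \<noteq> 0"
  proof
    assume "a = 0"
    then have "F = T" using ab f(2) by auto
    then show False using f(3) by simp
  qed
  moreover have "affine hull F = {x. a \<bullet> x = b}"
  proof (rule affine_dim_equal)
    show "affine hull F \<subseteq> {x. a \<bullet> x = b}"
      by (rule hull_minimal) (use ab in \<open>auto simp: affine_hyperplane\<close>)
    show "aff_dim (affine hull F) = aff_dim {x. a \<bullet> x = b}"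
      using f(3) T(2) \<open>a \<noteq> 0\<close> by (simp add: aff_dim_affine_hull)
  qed (use f(2) in \<open>auto simp: affine_hyperplane\<close>)
  ultimately show ?thesis using ab that by blast
qed

text \<open>A point \<open>y\<close> just below the supporting hyperplane lies on the segment from a
  fixed \<open>z \<in> T\<close> strictly below it to a point \<open>h\<close> of the hyperplane. If
  \<open>y\<close> is near \<open>x\<close>, so is \<open>h\<close>; then \<open>h\<close> lies in
  the facet and convexity gives \<open>y \<in> T\<close>.\<close>

lemma facet_half_ball:
  fixes T :: "'a::euclidean_space set"
  assumes T: "polytope T" "aff_dim T = int DIM('a)" and F: "F facet_of T" and x: "x \<in> rel_interior F"
  obtains a r where "a \<noteq> 0" "r > 0" "\<And>y. \<lbrakk>y \<in> ball x r; a \<bullet> y = a \<bullet> x\<rbrakk> \<Longrightarrow> y \<in> F"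
    "\<And>y. \<lbrakk>y \<in> ball x r; a \<bullet> y < a \<bullet> x\<rbrakk> \<Longrightarrow> y \<in> interior T"
proof -
  obtain a b where ab: "a \<noteq> 0" "T \<subseteq> {x. a \<bullet> x \<le> b}" "F = T \<inter> {x. a \<bullet> x = b}" "affine hull F = {x. a \<bullet> x = b}"
    using facet_hyperplane[OF T F] .
  obtain e where e: "e > 0" "ball x e \<inter> affine hull F \<subseteq> F" and xF: "x \<in> F"
    using x unfolding mem_rel_interior_ball by blast
  have bx: "a \<bullet> x = b" using xF ab by blast
  have "\<not> T \<subseteq> {x. a \<bullet> x = b}"
  proof
    assume "T \<subseteq> {x. a \<bullet> x = b}"
    then have "F = T" using ab(3) by blast
    then show False using F by (simp add: facet_of_def)
  qed
  then obtain z where z: "z \<in> T" "a \<bullet> z < b" using ab(2) by force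
  define \<delta> where "\<delta> = b - a \<bullet> z"
  have \<delta>: "\<delta> > 0" using z by (simp add: \<delta>_def)
  \<comment> \<open>\<open>K * norm (y - x)\<close> will bound the weight \<open>t\<close> of
    \<open>z\<close>, and \<open>2 * M * norm (y - x)\<close> the distance of \<open>h\<close> from
    \<open>x\<close>. The radius \<open>r\<close> ensures \<open>t \<le> 1 / 2\<close> and puts
    \<open>h\<close> into the ball of radius \<open>e\<close>.\<close>
  define K where "K = norm a / \<delta>"
  have K: "K > 0" using ab(1) \<delta> by (simp add: K_def)
  define M where "M = 1 + K * norm (z - x)"
  have M: "M \<ge> 1" using K by (simp add: M_def)
  define r where "r = min (1 / (2 * K)) (e / (2 * M))"
  have r: "r > 0" "r * K \<le> 1 / 2" "2 * (r * M) \<le> e"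
  proof -
    show "r > 0" using K M e(1) by (simp add: r_def)
    have "r \<le> 1 / (2 * K)" "r \<le> e / (2 * M)" by (auto simp: r_def)
    then show "r * K \<le> 1 / 2" "2 * (r * M) \<le> e" using K M by (auto simp: field_simps)
  qed
  have hyp: "y \<in> F" if "y \<in> ball x r" "a \<bullet> y = a \<bullet> x" for y
  proof -
    have "r \<le> e" using r M mult_left_mono[of 1 M r] by linarith
    then show ?thesis using that e(2) ab(4) bx by auto
  qed
  have half: "y \<in> T" if y: "y \<in> ball x r" "a \<bullet> y < a \<bullet> x" for y
  proof -
    define t where "t = (b - a \<bullet> y) / \<delta>"
    have nr: "norm (y - x) < r" using y by (simp add: dist_norm norm_minus_commute)
    have "b - a \<bullet> y = a \<bullet> (x - y)" using bx by (simp add: inner_diff_right)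
    also have "\<dots> \<le> norm a * norm (y - x)" using norm_cauchy_schwarz[of a "x - y"] by (simp add: norm_minus_commute)
    finally have "(b - a \<bullet> y) / \<delta> \<le> norm a * norm (y - x) / \<delta>" using \<delta> by (intro divide_right_mono) auto
    then have tK: "t \<le> K * norm (y - x)" by (simp add: t_def K_def)
    have "K * norm (y - x) \<le> K * r" using nr K by simp
    moreover have "K * r \<le> 1 / 2" using r(2) by (simp add: mult.commute)
    ultimately have t: "t > 0" "t \<le> 1 / 2" using tK y(2) bx \<delta> by (simp add: t_def, linarith)
    define h where "h = (1 / (1 - t)) *\<^sub>R (y - t *\<^sub>R z)"
    have "a \<bullet> y = b - t * \<delta>" using \<delta> by (simp add: t_def)
    then have "a \<bullet> (y - t *\<^sub>R z) = (1 - t) * b" by (simp add: inner_diff_right \<delta>_def algebra_simps)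
    then have ah: "a \<bullet> h = b" using t by (simp add: h_def)
    have "h - x = (1 / (1 - t)) *\<^sub>R ((y - x) - t *\<^sub>R (z - x))"
    proof -
      have "(1 - t) *\<^sub>R (h - x) = (y - x) - t *\<^sub>R (z - x)"
        using t by (simp add: h_def scaleR_diff_right) (simp add: algebra_simps)
      then have "(1 / (1 - t)) *\<^sub>R ((1 - t) *\<^sub>R (h - x)) = (1 / (1 - t)) *\<^sub>R ((y - x) - t *\<^sub>R (z - x))" by simp
      then show ?thesis using t by simp
    qed
    then have "norm (h - x) = (1 / (1 - t)) * norm ((y - x) - t *\<^sub>R (z - x))" using t by simp
    also have "\<dots> \<le> 2 * norm ((y - x) - t *\<^sub>R (z - x))"
      using t by (intro mult_right_mono) (auto simp: field_simps)
    also have "\<dots> \<le> 2 * (norm (y - x) + t * norm (z - x))"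
      using norm_triangle_ineq4[of "y - x" "t *\<^sub>R (z - x)"] t by simp
    also have "\<dots> \<le> 2 * (norm (y - x) + K * norm (y - x) * norm (z - x))"
      using tK by (intro mult_left_mono add_left_mono mult_right_mono) auto
    also have "\<dots> = 2 * (norm (y - x) * M)" by (simp add: M_def algebra_simps)
    also have "\<dots> < 2 * (r * M)" using nr M by simp
    finally have "norm (h - x) < e" using r by simp
    then have "h \<in> ball x e" by (simp add: dist_norm norm_minus_commute)
    then have "h \<in> F" using e(2) ab(4) ah by blast
    then have hT: "h \<in> T" using ab(3) by blast
    have "y = (1 - t) *\<^sub>R h + t *\<^sub>R z" using t by (simp add: h_def)
    then show ?thesis
      using convexD[OF polytope_imp_convex[OF T(1)] hT z(1), of "1 - t" t] t by simp
  qed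
  have "y \<in> interior T" if "y \<in> ball x r" "a \<bullet> y < a \<bullet> x" for y
  proof -
    have "ball x r \<inter> {y. a \<bullet> y < a \<bullet> x} \<subseteq> interior T"
      using half by (intro interior_maximal) (auto simp: open_halfspace_lt)
    then show ?thesis using that by blast
  qed
  with ab(1) r(1) hyp show ?thesis by (rule that)
qed

text \<open>The negative sum of the unit normals lies in both half spaces unless the normals are
  opposite: its products with \<open>a\<close> and \<open>a'\<close> are negative multiples of the
  defect \<open>norm a * norm a' + a \<bullet> a'\<close> in the Cauchy-Schwarz inequality.\<close>

lemma disjoint_half_spaces:
  fixes a a' :: "'a::euclidean_space"
  assumes "a \<noteq> 0" "a' \<noteq> 0" "\<And>v. a \<bullet> v < 0 \<Longrightarrow> \<not> a' \<bullet> v < 0"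
  obtains c where "c > 0" "a' = - (c *\<^sub>R a)"
proof -
  define v where "v = - (a /\<^sub>R norm a + a' /\<^sub>R norm a')"
  have n: "norm a > 0" "norm a' > 0" using assms by auto
  have cs: "\<bar>a \<bullet> a'\<bar> \<le> norm a * norm a'" by (rule Cauchy_Schwarz_ineq2)
  have nn: "a \<bullet> a / norm a = norm a" "a' \<bullet> a' / norm a' = norm a'"
    using n by (simp_all add: power2_norm_eq_inner[symmetric] power2_eq_square)
  have av: "a \<bullet> v = - (norm a * norm a' + a \<bullet> a') / norm a'"
    using n nn by (simp add: v_def inner_diff_right add_divide_distrib diff_divide_distrib inverse_eq_divide)
  have a'v: "a' \<bullet> v = - (norm a * norm a' + a \<bullet> a') / norm a"
    using n nn by (simp add: v_def inner_diff_right add_divide_distrib diff_divide_distrib inverse_eq_divide inner_commute[of a' a])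
  have "norm a * norm a' + a \<bullet> a' \<le> 0"
  proof (rule ccontr)
    assume "\<not> norm a * norm a' + a \<bullet> a' \<le> 0"
    then have "a \<bullet> v < 0" "a' \<bullet> v < 0" unfolding av a'v using n by (auto intro!: divide_neg_pos)
    then show False using assms(3) by blast
  qed
  then have "a \<bullet> (- a') = norm a * norm (- a')" using cs by simp
  then have e: "norm a *\<^sub>R (- a') = norm (- a') *\<^sub>R a" by (simp only: norm_cauchy_schwarz_eq)
  have "a' = - ((norm a' / norm a) *\<^sub>R a)"
  proof -
    have "(1 / norm a) *\<^sub>R (norm a *\<^sub>R (- a')) = (1 / norm a) *\<^sub>R (norm a' *\<^sub>R a)" using e by simp
    then have "- a' = (norm a' / norm a) *\<^sub>R a" using n by simp
    then show ?thesis by (metis minus_minus)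
  qed
  with n show ?thesis by (intro that[of "norm a' / norm a"]) auto
qed

lemma surface_measure_sets [simp, measurable_cong]: "sets surface_measure = sets borel"
  and surface_measure_space [simp]: "space surface_measure = UNIV"
  by (simp_all add: surface_measure_def)

lemma emeasure_surface_measure:
  fixes A :: "'a::euclidean_space set"
  assumes "DIM('a) \<ge> 2" "A \<in> sets borel"
  shows "emeasure surface_measure A = hausdorff_outer (DIM('a) - 1) A"
  unfolding surface_measure_def using assms by (intro emeasure_hausdorff_measure) auto

lemma emeasure_facet_finite:
  fixes T :: "'a::euclidean_space set"
  assumes d: "DIM('a) \<ge> 2" and T: "polytope T" and F: "F facet_of T"
  shows "emeasure surface_measure F < top"
proof -
  have P: "polytope F" using face_of_polytope_polytope[OF T] F by (auto simp: facet_of_def)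
  have "F \<in> sets borel" using polytope_imp_compact[OF P] by (rule borel_compact)
  moreover have "aff_dim F \<le> int (DIM('a) - 1)"
    using F aff_dim_le_DIM[of T] d by (auto simp: facet_of_def)
  ultimately show ?thesis
    unfolding emeasure_surface_measure[OF d \<open>F \<in> sets borel\<close>]
    using polytope_imp_bounded[OF P] d by (intro hausdorff_outer_flat_finite) auto
qed

text \<open>The relative boundary of a polytope is the union of its finitely many facets, which here
  have dimension at most \<open>DIM('a) - 2\<close>.\<close>

lemma rel_frontier_facet_null:
  fixes T :: "'a::euclidean_space set"
  assumes d: "DIM('a) \<ge> 2" and T: "polytope T" and F: "F facet_of T"
  shows "rel_frontier F \<in> null_sets surface_measure"
proof -
  have P: "polytope F" using face_of_polytope_polytope[OF T] F by (auto simp: facet_of_def)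
  have "(\<Union>G\<in>{G. G facet_of F}. G) \<in> null_sets surface_measure"
  proof (rule null_sets_UN')
    show "countable {G. G facet_of F}"
      using finite_polyhedron_facets[OF polytope_imp_polyhedron[OF P]] by (rule countable_finite)
    fix G assume "G \<in> {G. G facet_of F}"
    then have G: "G facet_of F" by simp
    have PG: "polytope G" using face_of_polytope_polytope[OF P] G by (auto simp: facet_of_def)
    have "G \<in> sets borel" using polytope_imp_compact[OF PG] by (rule borel_compact)
    moreover have "aff_dim G < int (DIM('a) - 1)"
      using G F aff_dim_le_DIM[of T] d by (auto simp: facet_of_def)
    ultimately show "G \<in> null_sets surface_measure"
      using polytope_imp_bounded[OF PG] d
      by (auto simp: null_sets_def emeasure_surface_measure intro!: hausdorff_outer_flat_null)
  qed
  then show ?thesis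
    using rel_frontier_of_polyhedron[OF polytope_imp_polyhedron[OF P]] by simp
qed

text \<open>\<open>x\<close> may lie on the relative boundary, but points of the relative interior
  are dense, and near such a point the facet contains a disc of its hyperplane.\<close>

lemma emeasure_facet_pos:
  fixes T :: "'a::euclidean_space set"
  assumes d: "DIM('a) \<ge> 2" and T: "polytope T" "aff_dim T = int DIM('a)" and F: "F facet_of T"
    and x: "x \<in> F" and r: "r > 0"
  shows "emeasure surface_measure (F \<inter> ball x r) > 0"
proof -
  have P: "polytope F" using face_of_polytope_polytope[OF T(1)] F by (auto simp: facet_of_def)
  have "closure (rel_interior F) = closure F"
    using polytope_imp_convex[OF P] by (rule convex_closure_rel_interior)
  then have "x \<in> closure (rel_interior F)" using x closure_subset by blast
  then obtain y where y: "y \<in> rel_interior F" "dist y x < r"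
    using r closure_approachable by blast
  obtain a s where s: "a \<noteq> 0" "s > 0" "\<And>z. \<lbrakk>z \<in> ball y s; a \<bullet> z = a \<bullet> y\<rbrakk> \<Longrightarrow> z \<in> F"
    using facet_half_ball[OF T F y(1)] by metis
  define s' where "s' = min s (r - dist y x)"
  have s': "s' > 0" "s' \<le> s" "s' \<le> r - dist y x" using s(2) y(2) by (auto simp: s'_def)
  have "ball y s' \<subseteq> ball x r"
  proof
    fix z assume "z \<in> ball y s'"
    then show "z \<in> ball x r" using s' dist_triangle[of x z y] by (simp add: dist_commute)
  qed
  then have sub: "{z \<in> ball y s'. a \<bullet> z = a \<bullet> y} \<subseteq> F \<inter> ball x r" using s(3) s'(2) by auto
  have "closed F" using polytope_imp_compact[OF P] by (rule compact_imp_closed)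
  then have B: "F \<inter> ball x r \<in> sets borel" by auto
  have "{z \<in> ball y s'. a \<bullet> z = a \<bullet> y} = ball y s' \<inter> {z. a \<bullet> z = a \<bullet> y}" by auto
  also have "\<dots> \<in> sets borel" using closed_hyperplane[of a "a \<bullet> y"] by (intro sets.Int) auto
  finally have B': "{z \<in> ball y s'. a \<bullet> z = a \<bullet> y} \<in> sets borel" .
  have "0 < hausdorff_outer (DIM('a) - 1) {z \<in> ball y s'. a \<bullet> z = a \<bullet> y}"
    using d s(1) s'(1) by (intro hausdorff_outer_disc_pos) auto
  also have "\<dots> = emeasure surface_measure {z \<in> ball y s'. a \<bullet> z = a \<bullet> y}"
    by (rule emeasure_surface_measure[OF d B', symmetric])
  also have "\<dots> \<le> emeasure surface_measure (F \<inter> ball x r)"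
    using sub B by (intro emeasure_mono) auto
  finally show ?thesis .
qed

text \<open>A mesh fills the closure of a subdomain; regularity is what puts the interiors of its
  cells into the open set itself. A point outside \<open>D\<close> but interior to the closure could
  be pushed along \<open>- \<nu>\<close> strictly below the graph, into an open set that misses
  \<open>D\<close>.\<close>

lemma C11_domain_regular: "C11_domain D \<Longrightarrow> interior (closure D) = D"
proof (rule subset_antisym)
  assume D: "C11_domain D"
  then have "open D" by (simp add: C11_domain_def bounded_domain_def)
  then show "D \<subseteq> interior (closure D)" by (simp add: closure_subset interior_maximal)
  show "interior (closure D) \<subseteq> D"
  proof (rule ccontr)
    assume "\<not> interior (closure D) \<subseteq> D"
    then obtain x where x: "x \<in> interior (closure D)" "x \<notin> D" by blast
    then have "x \<in> frontier D" using \<open>open D\<close> interior_subset by (auto simp: frontier_def interior_open)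
    then obtain r \<nu> \<phi> \<phi>' where r: "r > 0" "norm \<nu> = 1" "\<And>y. GDERIV \<phi> y :> \<phi>' y"
        "\<And>y. y \<in> ball x r \<Longrightarrow> y \<in> D \<longleftrightarrow> \<phi> (y - (y \<bullet> \<nu>) *\<^sub>R \<nu>) < y \<bullet> \<nu>"
      using D unfolding C11_domain_def by metis
    have \<nu>: "\<nu> \<bullet> \<nu> = 1" using r(2) by (simp add: dot_square_norm)
    define f where "f y = \<phi> (y - (y \<bullet> \<nu>) *\<^sub>R \<nu>) - y \<bullet> \<nu>" for y
    have "continuous_on UNIV \<phi>" using r(3) by (rule GDERIV_imp_continuous)
    then have cf: "continuous_on UNIV f"
      unfolding f_def
      by (intro continuous_on_diff continuous_on_compose2[OF \<open>continuous_on UNIV \<phi>\<close>] continuous_intros) auto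
    have "open {y. f y > 0}" using open_Collect_less[OF continuous_on_const cf] by simp
    then have "open (ball x r \<inter> {y. f y > 0})" by auto
    moreover have "D \<inter> (ball x r \<inter> {y. f y > 0}) = {}" using r(4) by (auto simp: f_def)
    ultimately have disj: "closure D \<inter> (ball x r \<inter> {y. f y > 0}) = {}"
      by (metis Int_commute open_Int_closure_eq_empty)
    obtain e where e: "e > 0" "ball x e \<subseteq> closure D"
      using x(1) by (meson mem_interior)
    define s where "s = min r e / 2"
    have s: "s > 0" "s < r" "s < e" using r(1) e(1) by (auto simp: s_def)
    define y where "y = x - s *\<^sub>R \<nu>"
    have yb: "y \<in> ball x r" "y \<in> ball x e" using s r(2) by (auto simp: y_def dist_norm)
    have "f y = f x + s"
      using \<nu> by (simp add: f_def y_def inner_diff_left algebra_simps)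
    moreover have "f x \<ge> 0" using r(4)[of x] r(1) x(2) by (simp add: f_def)
    ultimately have "f y > 0" using s by simp
    then show False using disj yb e(2) by blast
  qed
qed

lemma polyhedral_domain_regular: "polyhedral_domain D \<Longrightarrow> interior (closure D) = D"
proof -
  assume D: "polyhedral_domain D"
  then obtain \<P> where P: "finite \<P>" "\<And>P. P \<in> \<P> \<Longrightarrow> polytope P" "D = interior (\<Union>\<P>)"
    unfolding polyhedral_domain_def by blast
  have "closed (\<Union>\<P>)" using P by (intro closed_Union) (auto intro: polytope_imp_closed)
  then have "closure D \<subseteq> \<Union>\<P>" using P(3) interior_subset by (metis closure_minimal)
  then have "interior (closure D) \<subseteq> D" using P(3) interior_mono by metis
  moreover have "D \<subseteq> interior (closure D)"
    using P(3) open_interior by (metis closure_subset interior_maximal)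
  ultimately show ?thesis by blast
qed

text \<open>What makes the surface integral of products a scalar product on continuous functions:
  compactness and finite measure give integrability, positive measure near every point gives
  definiteness.\<close>

locale surface_piece =
  fixes \<Gamma> :: "'a::euclidean_space set"
  assumes compact_piece: "compact \<Gamma>"
    and finite_piece: "emeasure surface_measure \<Gamma> < top"
    and pos_piece: "\<And>x r. \<lbrakk>x \<in> \<Gamma>; r > 0\<rbrakk> \<Longrightarrow> emeasure surface_measure (\<Gamma> \<inter> ball x r) > 0"
begin

lemma piece_borel: "\<Gamma> \<in> sets borel"
  using compact_piece by (rule borel_compact)

lemma surface_integrable:
  fixes f :: "'a \<Rightarrow> real"
  assumes "continuous_on \<Gamma> f" shows "set_integrable surface_measure \<Gamma> f"
proof -
  obtain B where B: "\<And>x. x \<in> \<Gamma> \<Longrightarrow> norm (f x) \<le> B"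
    using compact_imp_bounded[OF compact_continuous_image[OF assms compact_piece]]
    unfolding bounded_iff by blast
  have m: "(\<lambda>x. indicator \<Gamma> x *\<^sub>R f x) \<in> borel_measurable borel"
    using borel_measurable_continuous_on_indicator[OF piece_borel assms] by simp
  show ?thesis
    unfolding set_integrable_def
  proof (rule Bochner_Integration.integrable_bound)
    show "integrable surface_measure (\<lambda>x. B * indicator \<Gamma> x)"
      using finite_piece piece_borel by (intro integrable_mult_right integrable_real_indicator) auto
    show "AE x in surface_measure. norm (indicator \<Gamma> x *\<^sub>R f x) \<le> norm (B * indicator \<Gamma> x)"
      by (intro AE_I2) (auto simp: indicator_def dest!: B)
  qed (use m in simp)
qed

lemma surface_integral_add:
  "\<lbrakk>continuous_on \<Gamma> f; continuous_on \<Gamma> g\<rbrakk> \<Longrightarrow>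
     surface_integral \<Gamma> (\<lambda>x. f x + g x) = surface_integral \<Gamma> f + surface_integral \<Gamma> g"
  unfolding surface_integral_def by (intro set_integral_add surface_integrable)

lemma surface_integral_scale: "surface_integral \<Gamma> (\<lambda>x. c * f x) = c * surface_integral \<Gamma> f"
  unfolding surface_integral_def by simp

lemma surface_integral_nonneg: "(\<And>x. x \<in> \<Gamma> \<Longrightarrow> f x \<ge> 0) \<Longrightarrow> surface_integral \<Gamma> f \<ge> 0"
  unfolding surface_integral_def set_lebesgue_integral_def
  by (intro integral_nonneg_AE AE_I2) (auto simp: indicator_def)

lemma surface_integral_eq_0:
  assumes f: "continuous_on \<Gamma> f" "\<And>x. x \<in> \<Gamma> \<Longrightarrow> f x \<ge> 0" "surface_integral \<Gamma> f = 0" and x: "x \<in> \<Gamma>"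
  shows "f x = 0"
proof (rule ccontr)
  assume "f x \<noteq> 0"
  then have "f x > 0" using f(2)[OF x] by simp
  then obtain r where r: "r > 0" "\<And>y. \<lbrakk>y \<in> \<Gamma>; dist y x < r\<rbrakk> \<Longrightarrow> \<bar>f y - f x\<bar> < f x"
    using f(1) x unfolding continuous_on_iff dist_real_def by meson
  have "AE y in surface_measure. indicator \<Gamma> y *\<^sub>R f y = 0"
    using f surface_integrable[OF f(1)]
    unfolding surface_integral_def set_lebesgue_integral_def set_integrable_def
    by (subst integral_nonneg_eq_0_iff_AE[symmetric]) (auto simp: indicator_def)
  then have "AE y in surface_measure. y \<notin> \<Gamma> \<inter> ball x r"
  proof eventually_elim
    case (elim y)
    then show ?case using r(2)[of y] by (auto simp: dist_commute)
  qed
  then have "\<Gamma> \<inter> ball x r \<in> null_sets surface_measure"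
    using piece_borel by (simp add: AE_iff_null_sets)
  then show False using pos_piece[OF x r(1)] by (simp add: null_sets_def)
qed

end

section \<open>Interfaces of a conforming mesh\<close>

lemma interface_commute: "interface D k l = interface D l k"
  by (simp add: interface_def Int_commute)

lemma adjacent_sym: "adjacent D k l \<longleftrightarrow> adjacent D l k"
  by (auto simp: adjacent_def interface_commute[of D k l])

text \<open>A continuous H1 function is its own trace, approximated by the constant sequence, so it
  competes in the infimum that defines the quotient norm.\<close>

lemma h_half_norm_continuous_le:
  fixes v :: "'a::euclidean_space \<Rightarrow> real"
  assumes O: "open \<Omega>" "bounded \<Omega>" and v: "v \<in> H1 \<Omega>" "continuous_on (closure \<Omega>) v"
    and g: "\<And>x. x \<in> S \<Longrightarrow> v x = g x" and S: "S \<subseteq> frontier \<Omega>"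
  shows "h_half_norm \<Omega> S g \<le> ennreal (h1_norm \<Omega> v)"
proof -
  have "has_trace \<Omega> v v"
    unfolding has_trace_def
  proof (intro conjI exI[of _ "\<lambda>n. v"] allI)
    have "continuous_on (frontier \<Omega>) v"
      using v(2) by (rule continuous_on_subset) (simp add: frontier_def)
    then have "v \<in> borel_measurable (restrict_space borel (frontier \<Omega>))"
      by (rule borel_measurable_continuous_on_restrict)
    moreover have "sets (restrict_space surface_measure (frontier \<Omega>)) = sets (restrict_space borel (frontier \<Omega>))"
      by (simp add: sets_restrict_space)
    ultimately show "v \<in> borel_measurable (restrict_space surface_measure (frontier \<Omega>))"
      using measurable_cong_sets by blast
    have "h1_form \<Omega> (\<lambda>x. 0 * v x) (\<lambda>x. 0 * v x) = 0"
      using h1_form_scale_left[OF O v(1), of "\<lambda>x. 0 * v x" 0] H1_scale[OF O v(1), of 0] by simp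
    then show "(\<lambda>n. h1_norm \<Omega> (\<lambda>x. v x - v x)) \<longlonglongrightarrow> 0" by (simp add: h1_norm_def)
  qed (use v in auto)
  then show ?thesis
    unfolding h_half_norm_def using v(1) g by (intro INF_lower) auto
qed

locale conforming_mesh =
  fixes \<Omega> :: "'a::euclidean_space set" and D :: "'k::finite \<Rightarrow> 'a set"
    and n :: nat and \<T> :: "'k \<Rightarrow> 'a set set" and \<sigma> \<tau> :: real
  assumes dim2: "DIM('a) \<ge> 2"
    and decomp: "conforming_decomposition \<Omega> D"
    and regular: "uniformly_regular_meshes \<sigma> \<tau> D \<T>"
    and fit: "meshes_fit_interfaces n D \<T>"
begin

lemma D_domain: "bounded_domain (D k)" "interior (closure (D k)) = D k" "D k \<subseteq> \<Omega>"
proof -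
  have "C11_domain (D k) \<or> polyhedral_domain (D k)" "D k \<subseteq> \<Omega>"
    using decomp by (auto simp: conforming_decomposition_def)
  then show "bounded_domain (D k)" "interior (closure (D k)) = D k" "D k \<subseteq> \<Omega>"
    using C11_domain_regular[of "D k"] polyhedral_domain_regular[of "D k"]
    by (auto simp only: C11_domain_def polyhedral_domain_def)
qed

lemma D_open: "open (D k)" and D_bounded: "bounded (D k)" and D_nonempty: "D k \<noteq> {}"
  using D_domain(1)[of k] by (auto simp: bounded_domain_def)

lemma D_disjoint: "k \<noteq> l \<Longrightarrow> D k \<inter> D l = {}"
  using decomp by (auto simp: conforming_decomposition_def)

lemma mesh_finite: "finite (\<T> k)"
  and mesh_closure: "closure (D k) = \<Union>(\<T> k)"
  using regular by (auto simp: uniformly_regular_meshes_def triangulation_def)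

lemma mesh_cell:
  assumes "T \<in> \<T> k" shows "polytope T" "aff_dim T = int DIM('a)" "compact T" "convex T" "interior T \<subseteq> D k"
proof -
  have s: "int DIM('a) simplex T" using regular assms by (auto simp: uniformly_regular_meshes_def)
  then show "polytope T" "aff_dim T = int DIM('a)" "compact T" "convex T"
    by (auto simp: simplex_imp_polytope aff_dim_simplex compact_simplex convex_simplex)
  have "T \<subseteq> closure (D k)" using mesh_closure assms by blast
  then show "interior T \<subseteq> D k" using interior_mono D_domain(2) by metis
qed

text \<open>The intersection is a face of both cells. With interior points it would have full
  dimension, and a proper face has smaller dimension, so it would equal both cells.\<close>

lemma mesh_interiors_disjoint:
  assumes "T \<in> \<T> k" "T' \<in> \<T> k" "T \<noteq> T'"
  shows "interior T \<inter> interior T' = {}"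
proof (rule ccontr)
  assume "interior T \<inter> interior T' \<noteq> {}"
  then have i: "interior (T \<inter> T') \<noteq> {}" by simp
  have f: "(T \<inter> T') face_of T" "(T' \<inter> T) face_of T'"
    using regular assms by (auto simp: uniformly_regular_meshes_def triangulation_def)
  have full: "aff_dim (T \<inter> T') = int DIM('a)" using i aff_dim_nonempty_interior by blast
  have "T \<inter> T' = S" if "(T \<inter> T') face_of S" "S \<in> \<T> k" for S
  proof (rule ccontr)
    assume "T \<inter> T' \<noteq> S"
    then have "aff_dim (T \<inter> T') < aff_dim S"
      using face_of_aff_dim_lt[OF mesh_cell(4)[OF that(2)] that(1)] by blast
    then show False using full mesh_cell(2)[OF that(2)] by simp
  qed
  then have "T \<inter> T' = T" "T \<inter> T' = T'" using f assms by (auto simp: Int_commute)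
  then show False using assms(3) by simp
qed

lemma Yh_H1: "v \<in> Yh m D \<T> k \<Longrightarrow> v \<in> H1 (D k)"
proof -
  assume "v \<in> Yh m D \<T> k"
  then have v: "continuous_on (closure (D k)) v" "\<And>x. x \<notin> closure (D k) \<Longrightarrow> v x = 0"
      "\<And>T. T \<in> \<T> k \<Longrightarrow> \<exists>q\<in>polys m. \<forall>x\<in>T. v x = q x"
    unfolding Yh_def fe_space_def by simp_all
  show ?thesis
  proof (rule piecewise_C1_H1[OF D_open D_bounded v(1,2) mesh_finite mesh_closure])
    show "\<exists>q. C1_fun q \<and> (\<forall>x\<in>T. v x = q x)" if "T \<in> \<T> k" for T
      using v(3)[OF that] C1_fun_polys by blast
  qed (simp_all add: mesh_cell mesh_interiors_disjoint)
qed

section \<open>Interfaces as pieces of surface and their local geometry\<close>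

lemma interface_eq: "adjacent D k l \<Longrightarrow> interface D k l = \<Union>(trace_mesh D \<T> k l)"
  using fit by (simp add: meshes_fit_interfaces_def)

lemma trace_mesh_facet:
  assumes "F \<in> trace_mesh D \<T> k l" obtains T where "T \<in> \<T> k" "F facet_of T"
  using assms by (auto simp: trace_mesh_def)

lemma finite_trace_mesh: "finite (trace_mesh D \<T> k l)"
proof (rule finite_subset)
  show "trace_mesh D \<T> k l \<subseteq> (\<Union>T\<in>\<T> k. {F. F facet_of T})" by (auto simp: trace_mesh_def)
  show "finite (\<Union>T\<in>\<T> k. {F. F facet_of T})"
    using mesh_finite mesh_cell(1) finite_polyhedron_facets polytope_imp_polyhedron by blast
qed

lemma compact_interface: "compact (interface D k l)"
proof -
  have "bounded (frontier (D k))" using D_bounded by (simp add: frontier_def bounded_diff bounded_closure)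
  then show ?thesis unfolding interface_def
    by (metis closed_Int compact_eq_bounded_closed bounded_Int frontier_closed)
qed

lemma interface_subset_closure: "interface D k l \<subseteq> closure (D k)" "interface D k l \<subseteq> closure (D l)"
  by (auto simp: interface_def frontier_def)

lemma surface_piece_interface:
  assumes "adjacent D k l" shows "surface_piece (interface D k l)"
proof
  show "compact (interface D k l)" by (rule compact_interface)
  have F: "emeasure surface_measure F < top" "F \<in> sets borel" if Fm: "F \<in> trace_mesh D \<T> k l" for F
  proof -
    obtain T where T: "T \<in> \<T> k" "F facet_of T" using Fm by (rule trace_mesh_facet)
    show "emeasure surface_measure F < top"
      by (rule emeasure_facet_finite[OF dim2 mesh_cell(1)[OF T(1)] T(2)])
    have "polytope F" using face_of_polytope_polytope[OF mesh_cell(1)[OF T(1)]] T(2) by (auto simp: facet_of_def)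
    then show "F \<in> sets borel" using polytope_imp_compact borel_compact by blast
  qed
  have "emeasure surface_measure (\<Union>F\<in>trace_mesh D \<T> k l. F) \<le> (\<Sum>F\<in>trace_mesh D \<T> k l. emeasure surface_measure F)"
    using F finite_trace_mesh by (intro emeasure_subadditive_finite) auto
  also have "\<dots> < top" using F finite_trace_mesh by (simp add: less_top)
  finally show "emeasure surface_measure (interface D k l) < top" using interface_eq[OF assms] by simp
  fix x :: 'a and r :: real assume x: "x \<in> interface D k l" and r: "r > 0"
  then obtain F where F: "F \<in> trace_mesh D \<T> k l" "x \<in> F" using interface_eq[OF assms] by blast
  obtain T where T: "T \<in> \<T> k" "F facet_of T" using F(1) by (rule trace_mesh_facet)
  have "0 < emeasure surface_measure (F \<inter> ball x r)"
    by (rule emeasure_facet_pos[OF dim2 mesh_cell(1,2)[OF T(1)] T(2) F(2) r])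
  also have "\<dots> \<le> emeasure surface_measure (interface D k l \<inter> ball x r)"
    using F(1) interface_eq[OF assms] borel_compact[OF compact_interface, of k l]
    by (intro emeasure_mono) auto
  finally show "0 < emeasure surface_measure (interface D k l \<inter> ball x r)" .
qed

text \<open>Off this set a point of an interface is relatively interior to a facet of the mesh on
  either side, since the union runs over all ordered pairs.\<close>

definition skeleton :: "'a set" where
  "skeleton = (\<Union>k. \<Union>l. \<Union>F\<in>trace_mesh D \<T> k l. rel_frontier F)"

lemma skeleton_null: "skeleton \<in> null_sets surface_measure"
  unfolding skeleton_def
proof (intro null_sets_UN' countable_finite finite_UNIV finite_trace_mesh)
  fix k l F assume "F \<in> trace_mesh D \<T> k l"
  then obtain T where T: "T \<in> \<T> k" "F facet_of T" by (rule trace_mesh_facet)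
  show "rel_frontier F \<in> null_sets surface_measure"
    by (rule rel_frontier_facet_null[OF dim2 mesh_cell(1)[OF T(1)] T(2)])
qed auto

lemma interface_half_ball:
  assumes kl: "adjacent D k l" and x: "x \<in> interface D k l" "x \<notin> skeleton"
  obtains a r where "a \<noteq> 0" "r > 0" "\<And>y. \<lbrakk>y \<in> ball x r; a \<bullet> y = a \<bullet> x\<rbrakk> \<Longrightarrow> y \<in> interface D k l"
    "\<And>y. \<lbrakk>y \<in> ball x r; a \<bullet> y < a \<bullet> x\<rbrakk> \<Longrightarrow> y \<in> D k"
proof -
  obtain F where F: "F \<in> trace_mesh D \<T> k l" "x \<in> F" using x(1) interface_eq[OF kl] by blast
  have "x \<notin> rel_frontier F" using x(2) F(1) by (auto simp: skeleton_def)
  then have i: "x \<in> rel_interior F" using F(2) closure_subset by (auto simp: rel_frontier_def)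
  obtain T where T: "T \<in> \<T> k" "F facet_of T" using F(1) by (rule trace_mesh_facet)
  show ?thesis
  proof (rule facet_half_ball[OF mesh_cell(1,2)[OF T(1)] T(2) i])
    fix a r assume *: "a \<noteq> 0" "0 < r" "\<And>y. \<lbrakk>y \<in> ball x r; a \<bullet> y = a \<bullet> x\<rbrakk> \<Longrightarrow> y \<in> F"
      "\<And>y. \<lbrakk>y \<in> ball x r; a \<bullet> y < a \<bullet> x\<rbrakk> \<Longrightarrow> y \<in> interior T"
    show thesis
    proof (rule that[OF *(1,2)])
      show "y \<in> interface D k l" if "y \<in> ball x r" "a \<bullet> y = a \<bullet> x" for y
        using *(3)[OF that] F(1) interface_eq[OF kl] by blast
      show "y \<in> D k" if "y \<in> ball x r" "a \<bullet> y < a \<bullet> x" for y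
        using *(4)[OF that] mesh_cell(5)[OF T(1)] by blast
    qed
  qed
qed

text \<open>Half balls contained in disjoint subdomains are disjoint; by scaling, so are the half
  spaces, and \<open>disjoint_half_spaces\<close> applies.\<close>

lemma opposite_half_spaces:
  assumes "r > 0" "r' > 0" "a \<noteq> 0" "a' \<noteq> 0" "k \<noteq> l"
    and "\<And>y. \<lbrakk>y \<in> ball x r; a \<bullet> y < a \<bullet> x\<rbrakk> \<Longrightarrow> y \<in> D k"
    and "\<And>y. \<lbrakk>y \<in> ball x r'; a' \<bullet> y < a' \<bullet> x\<rbrakk> \<Longrightarrow> y \<in> D l"
  obtains c where "c > 0" "a' = - (c *\<^sub>R a)"
proof (rule disjoint_half_spaces[OF assms(3,4)])
  fix v assume v: "a \<bullet> v < 0"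
  show "\<not> a' \<bullet> v < 0"
  proof
    assume v': "a' \<bullet> v < 0"
    have v0: "norm v > 0" using v by auto
    define t where "t = min r r' / (2 * norm v)"
    have t: "t > 0" "t * norm v < r" "t * norm v < r'" using assms(1,2) v0 by (auto simp: t_def)
    then have "x + t *\<^sub>R v \<in> ball x r" "x + t *\<^sub>R v \<in> ball x r'" by (auto simp: dist_norm)
    moreover have "a \<bullet> (x + t *\<^sub>R v) < a \<bullet> x" "a' \<bullet> (x + t *\<^sub>R v) < a' \<bullet> x"
      using t(1) v v' by (auto simp: inner_add_right mult_pos_neg)
    ultimately have "x + t *\<^sub>R v \<in> D k \<inter> D l" using assms(6,7) by blast
    then show False using D_disjoint[OF assms(5)] by blast
  qed
qed (rule that)

text \<open>Three half balls with the same centre cannot be pairwise disjoint.\<close>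

lemma interfaces_overlap_in_skeleton:
  assumes kl: "adjacent D k l" "adjacent D k m" "l \<noteq> m"
  shows "interface D k l \<inter> interface D k m \<subseteq> skeleton"
proof (rule subsetI, rule ccontr)
  fix x assume x: "x \<in> interface D k l \<inter> interface D k m" "x \<notin> skeleton"
  have ne: "k \<noteq> l" "k \<noteq> m" using kl by (auto simp: adjacent_def)
  have xl: "x \<in> interface D k l" using x by blast
  obtain a r where a: "a \<noteq> 0" "r > 0" "\<And>y. \<lbrakk>y \<in> ball x r; a \<bullet> y < a \<bullet> x\<rbrakk> \<Longrightarrow> y \<in> D k"
    using interface_half_ball[OF kl(1) xl x(2)] by metis
  obtain a' r' where a': "a' \<noteq> 0" "r' > 0" "\<And>y. \<lbrakk>y \<in> ball x r'; a' \<bullet> y < a' \<bullet> x\<rbrakk> \<Longrightarrow> y \<in> D l"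
    using interface_half_ball[of l k x] kl(1) x by (metis IntD1 adjacent_sym interface_commute)
  obtain a'' r'' where a'': "a'' \<noteq> 0" "r'' > 0" "\<And>y. \<lbrakk>y \<in> ball x r''; a'' \<bullet> y < a'' \<bullet> x\<rbrakk> \<Longrightarrow> y \<in> D m"
    using interface_half_ball[of m k x] kl(2) x by (metis IntD2 adjacent_sym interface_commute)
  obtain c where c: "c > 0" "a' = - (c *\<^sub>R a)"
    using opposite_half_spaces[OF a(2) a'(2) a(1) a'(1) ne(1) a(3) a'(3)] by blast
  obtain c' where c': "c' > 0" "a'' = - (c' *\<^sub>R a)"
    using opposite_half_spaces[OF a(2) a''(2) a(1) a''(1) ne(2) a(3) a''(3)] by blast
  obtain c'' where c'': "c'' > 0" "a'' = - (c'' *\<^sub>R a')"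
    using opposite_half_spaces[OF a'(2) a''(2) a'(1) a''(1) kl(3) a'(3) a''(3)] by blast
  \<comment> \<open>\<open>a''\<close> is a negative multiple of \<open>a\<close>, but as a negative
    multiple of \<open>a'\<close> it is also a positive multiple of \<open>a\<close>.\<close>
  have "(c' + c'' * c) *\<^sub>R a = 0"
    using c c' c'' by (simp add: scaleR_add_left)
  then show False using a(1) c c' c'' by (simp add: add_pos_pos less_imp_neq[symmetric])
qed

text \<open>The half balls of \<open>D k\<close> and \<open>D l\<close> fill a small ball up to a
  disc of their common hyperplane, and this disc lies in the interface; \<open>D l\<close> is open
  and disjoint from \<open>D k\<close>, so it contains no frontier point of \<open>D k\<close>.
  Hence a small bump at \<open>x\<close> vanishes on the rest of the boundary.\<close>

lemma frontier_near_interface: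
  assumes kl: "adjacent D k l" and x: "x \<in> interface D k l" "x \<notin> skeleton"
  obtains r where "r > 0" "ball x r \<inter> frontier (D k) \<subseteq> interface D k l"
proof -
  have ne: "k \<noteq> l" using kl by (auto simp: adjacent_def)
  obtain a r where a: "a \<noteq> 0" "r > 0" "\<And>y. \<lbrakk>y \<in> ball x r; a \<bullet> y = a \<bullet> x\<rbrakk> \<Longrightarrow> y \<in> interface D k l"
      "\<And>y. \<lbrakk>y \<in> ball x r; a \<bullet> y < a \<bullet> x\<rbrakk> \<Longrightarrow> y \<in> D k"
    using interface_half_ball[OF kl x] by blast
  obtain a' r' where a': "a' \<noteq> 0" "r' > 0" "\<And>y. \<lbrakk>y \<in> ball x r'; a' \<bullet> y < a' \<bullet> x\<rbrakk> \<Longrightarrow> y \<in> D l"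
    using interface_half_ball[of l k x] kl x by (metis adjacent_sym interface_commute)
  obtain c where c: "c > 0" "a' = - (c *\<^sub>R a)"
    using opposite_half_spaces[OF a(2) a'(2) a(1) a'(1) ne a(4) a'(3)] by blast
  have "ball x (min r r') \<inter> frontier (D k) \<subseteq> interface D k l"
  proof
    fix y assume y: "y \<in> ball x (min r r') \<inter> frontier (D k)"
    have "y \<notin> D k" using y D_open by (auto simp: frontier_def interior_open)
    then have "\<not> a \<bullet> y < a \<bullet> x" using a(4)[of y] y by auto
    moreover have "y \<notin> D l"
      using y D_disjoint[OF ne] open_Int_closure_eq_empty[OF D_open, of l "D k"] by (auto simp: frontier_def)
    then have "\<not> a' \<bullet> y < a' \<bullet> x" using a'(3)[of y] y by auto
    then have "\<not> a \<bullet> y > a \<bullet> x" using c by simp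
    ultimately show "y \<in> interface D k l" using a(3)[of y] y by auto
  qed
  then show ?thesis using a(2) a'(2) by (intro that[of "min r r'"]) auto
qed

text \<open>A bump placed where \<open>q\<close> keeps its sign, and away from the rest of the
  boundary, is admissible in the supremum and would have a nonzero pairing with \<open>q\<close>.
  The stability property controls multipliers in this norm, so their uniqueness rests on it being
  definite.\<close>

lemma h_minus_half_norm_eq_0:
  assumes kl: "adjacent D k l" and q: "continuous_on (interface D k l) q"
    and zero: "h_minus_half_norm (D k) (interface D k l) q = 0" and x0: "x0 \<in> interface D k l"
  shows "q x0 = 0"
proof (rule ccontr)
  let ?\<Gamma> = "interface D k l"
  interpret surface_piece ?\<Gamma> by (rule surface_piece_interface[OF kl])
  assume q0: "q x0 \<noteq> 0"
  have "continuous_on ?\<Gamma> (\<lambda>x. q x * q x0)" using q by (intro continuous_intros)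
  moreover have "q x0 * q x0 > 0" using q0 by (metis not_real_square_gt_zero)
  ultimately obtain r0 where r0: "r0 > 0" "\<And>y. \<lbrakk>y \<in> ?\<Gamma>; dist y x0 < r0\<rbrakk> \<Longrightarrow> \<bar>q y * q x0 - q x0 * q x0\<bar> < q x0 * q x0"
    using x0 unfolding continuous_on_iff dist_real_def by meson
  have pos: "q y * q x0 > 0" if "y \<in> ?\<Gamma>" "dist y x0 < r0" for y using r0(2)[OF that] by linarith
  \<comment> \<open>The given point may lie on the skeleton; positive measure near it yields another
    point where \<open>q\<close> has the same sign.\<close>
  have "\<not> ?\<Gamma> \<inter> ball x0 r0 \<subseteq> skeleton"
  proof
    assume "?\<Gamma> \<inter> ball x0 r0 \<subseteq> skeleton"
    then have "?\<Gamma> \<inter> ball x0 r0 \<in> null_sets surface_measure"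
      using piece_borel by (intro null_sets_subset[OF skeleton_null]) auto
    then show False using pos_piece[OF x0 r0(1)] by (simp add: null_sets_def)
  qed
  then obtain x where x: "x \<in> ?\<Gamma>" "x \<in> ball x0 r0" "x \<notin> skeleton" by blast
  obtain r1 where r1: "r1 > 0" "ball x r1 \<inter> frontier (D k) \<subseteq> ?\<Gamma>"
    using frontier_near_interface[OF kl x(1,3)] by blast
  define r where "r = min r1 (r0 - dist x0 x)"
  have r: "r > 0" "r \<le> r1" "r \<le> r0 - dist x0 x" using r1(1) x(2) by (auto simp: r_def)
  obtain \<phi> where \<phi>: "test_fun UNIV \<phi>" "\<And>y. \<phi> y \<ge> 0" "\<And>y. \<phi> y \<noteq> 0 \<longleftrightarrow> y \<in> ball x r"
    using bump_test_fun[OF r(1), of x UNIV] by auto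
  have \<phi>H: "\<phi> \<in> H1 (D k)" using \<phi>(1) by (intro C1_fun_H1 D_open D_bounded) (simp add: test_fun_def)
  have \<phi>c: "continuous_on S \<phi>" for S using \<phi>(1) by (intro C1_fun_continuous) (simp add: test_fun_def)
  \<comment> \<open>Scales the bump into the unit ball; the added 1 avoids division by 0.\<close>
  define c where "c = 1 / (1 + h1_norm (D k) \<phi>)"
  have N: "h1_norm (D k) \<phi> \<ge> 0"
    unfolding h1_norm_def using h1_form_nonneg by simp
  have c: "c > 0" "c * h1_norm (D k) \<phi> \<le> 1" using N by (auto simp: c_def field_simps)
  define g where "g y = c * \<phi> y" for y
  have gH: "g \<in> H1 (D k)" unfolding g_def using \<phi>H by (intro H1_scale D_open D_bounded)
  have "h1_form (D k) g g = c * (c * h1_form (D k) \<phi> \<phi>)"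
    using h1_form_scale_left[OF D_open D_bounded \<phi>H gH, of c] h1_form_commute[of "D k" \<phi> g]
      h1_form_scale_left[OF D_open D_bounded \<phi>H \<phi>H, of c]
    by (simp only: g_def[abs_def, symmetric])
  then have "h1_norm (D k) g = c * h1_norm (D k) \<phi>"
    using c(1) by (simp add: h1_norm_def real_sqrt_mult mult.assoc[symmetric])
  then have g1: "h1_norm (D k) g \<le> 1" using c by simp
  have "h_half00_norm (D k) ?\<Gamma> g \<le> ennreal (h1_norm (D k) g)"
    unfolding h_half00_norm_def
  proof (rule h_half_norm_continuous_le[OF D_open D_bounded gH])
    show "continuous_on (closure (D k)) g" unfolding g_def by (intro continuous_intros \<phi>c)
    fix y assume y: "y \<in> frontier (D k)"
    have "\<phi> y = 0" if "y \<notin> ?\<Gamma>"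
    proof -
      have "y \<notin> ball x r1" using y that r1(2) by blast
      then have "y \<notin> ball x r" using r(2) by simp
      then show ?thesis using \<phi>(3) by blast
    qed
    then show "g y = (if y \<in> ?\<Gamma> then g y else 0)" by (auto simp: g_def)
  qed simp
  also have "\<dots> \<le> 1" using g1 by simp
  finally have "ennreal \<bar>surface_integral ?\<Gamma> (\<lambda>x. q x * g x)\<bar> \<le> h_minus_half_norm (D k) ?\<Gamma> q"
    unfolding h_minus_half_norm_def by (intro SUP_upper) simp
  then have "surface_integral ?\<Gamma> (\<lambda>x. q x * g x) = 0" using zero by simp
  \<comment> \<open>The factor \<open>q x0\<close> makes the integrand nonnegative whatever the sign
    of \<open>q\<close>.\<close>
  then have "surface_integral ?\<Gamma> (\<lambda>x. q x0 * (q x * g x)) = 0" using surface_integral_scale by simp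
  moreover have "continuous_on ?\<Gamma> (\<lambda>x. q x0 * (q x * g x))"
    unfolding g_def using q by (intro continuous_intros \<phi>c)
  moreover have "q x0 * (q y * g y) \<ge> 0" if y: "y \<in> ?\<Gamma>" for y
  proof (cases "y \<in> ball x r")
    case True
    then have "dist y x0 < r0" using r(3) dist_triangle[of y x0 x] by (simp add: dist_commute)
    then have "q y * q x0 > 0" using pos y by blast
    moreover have "q x0 * (q y * g y) = (q y * q x0) * (c * \<phi> y)" by (simp add: g_def)
    ultimately show ?thesis using c \<phi>(2)[of y] by (simp only: mult_nonneg_nonneg less_imp_le)
  next
    case False
    then show ?thesis using \<phi>(3)[of y] by (simp add: g_def)
  qed
  ultimately have "(\<lambda>x. q x0 * (q x * g x)) x = 0" using x(1) by (metis surface_integral_eq_0[of "\<lambda>x. q x0 * (q x * g x)"])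
  moreover have "q x * q x0 > 0" using pos[OF x(1)] x(2) by (simp add: dist_commute)
  moreover have "\<phi> x \<noteq> 0" using \<phi>(3)[of x] r(1) by simp
  ultimately show False using c by (auto simp: g_def)
qed

end

section \<open>Nondegenerate bilinear forms in finite dimension\<close>

text \<open>Makes \<open>subspace\<close>, \<open>span\<close> and \<open>independent\<close>
  available for spaces of functions and, by iteration, for families of functions.\<close>

instantiation "fun" :: (type, real_vector) real_vector
begin

definition "scaleR_fun c f = (\<lambda>x. c *\<^sub>R f x)"

instance
  by standard (auto simp: scaleR_fun_def fun_eq_iff scaleR_add_right scaleR_add_left)

end

text \<open>A square linear system: evaluating \<open>B u\<close> on a basis \<open>E\<close> of
  \<open>V\<close> maps \<open>V\<close> into the functions on \<open>E\<close>; nondegeneracy makes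
  this injective and equality of dimensions makes it surjective. Linearity is assumed on
  \<open>V\<close> only, because the forms in question are bilinear only there.\<close>

lemma nondegenerate_form_solvable:
  fixes V :: "'b::real_vector set" and B :: "'b \<Rightarrow> 'b \<Rightarrow> real"
  assumes V: "subspace V" and S: "finite S" "V \<subseteq> span S"
    and add1: "\<And>u v w. \<lbrakk>u \<in> V; v \<in> V; w \<in> V\<rbrakk> \<Longrightarrow> B (u + v) w = B u w + B v w"
    and scale1: "\<And>c u w. \<lbrakk>u \<in> V; w \<in> V\<rbrakk> \<Longrightarrow> B (c *\<^sub>R u) w = c * B u w"
    and add2: "\<And>u v w. \<lbrakk>u \<in> V; v \<in> V; w \<in> V\<rbrakk> \<Longrightarrow> B w (u + v) = B w u + B w v"
    and scale2: "\<And>c u w. \<lbrakk>u \<in> V; w \<in> V\<rbrakk> \<Longrightarrow> B w (c *\<^sub>R u) = c * B w u"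
    and Ladd: "\<And>u v. \<lbrakk>u \<in> V; v \<in> V\<rbrakk> \<Longrightarrow> L (u + v) = L u + L v"
    and Lscale: "\<And>c u. u \<in> V \<Longrightarrow> L (c *\<^sub>R u) = c * L u"
    and nondeg: "\<And>u. \<lbrakk>u \<in> V; \<And>v. v \<in> V \<Longrightarrow> B u v = 0\<rbrakk> \<Longrightarrow> u = 0"
  shows "\<exists>!u. u \<in> V \<and> (\<forall>v\<in>V. B u v = L v)"
proof -
  obtain E where E: "E \<subseteq> V" "independent E" "span E = V"
    using basis_exists[of V] span_minimal[OF _ V] by (metis subset_antisym)
  have finE: "finite E" and "card E \<le> card S"
    using independent_span_bound[OF S(1) E(2)] E(1) S(2) by auto
  define T where "T u = (\<lambda>e. if e \<in> E then B u e else 0)" for u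
  \<comment> \<open>\<open>T\<close> is linear on \<open>V\<close> only; \<open>g\<close> is linear
    on the whole type and agrees with \<open>T\<close> on \<open>V\<close>.\<close>
  obtain g where g: "linear g" and "\<forall>e\<in>E. g e = T e"
    using linear_independent_extend[OF E(2), of T] by (elim exE conjE)
  then have gE: "g e = T e" if "e \<in> E" for e using that by simp
  have B0: "B 0 w = 0" "B w 0 = 0" "L 0 = 0" if "w \<in> V" for w
    using scale1[OF that that, of 0] scale2[OF that that, of 0] Lscale[OF that, of 0] by simp_all
  have gT: "g u = T u" if "u \<in> V" for u
  proof -
    have "u \<in> V \<and> g u = T u"
    proof (rule span_induct_alt[of u E])
      show "u \<in> span E" using that E by simp
      show "0 \<in> V \<and> g 0 = T 0"
        using linear_0[OF g] subspace_0[OF V] E(1) by (auto simp: T_def fun_eq_iff B0 subset_iff)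
    next
      fix c x y assume "x \<in> E" and y: "y \<in> V \<and> g y = T y"
      then have x: "x \<in> V" "g x = T x" using E(1) gE by auto
      have "g (c *\<^sub>R x + y) = c *\<^sub>R T x + T y"
        using x y by (simp add: linear_add[OF g] linear_cmul[OF g])
      also have "\<dots> = T (c *\<^sub>R x + y)"
        using x(1) y E(1) V
        by (auto simp: T_def fun_eq_iff scaleR_fun_def add1 scale1 subset_iff subspace_scale)
      finally show "c *\<^sub>R x + y \<in> V \<and> g (c *\<^sub>R x + y) = T (c *\<^sub>R x + y)"
        using x(1) y V by (simp add: subspace_add subspace_scale)
    qed
    then show ?thesis by simp
  qed
  have extend: "\<forall>v\<in>V. F v = G v"
    if e: "\<And>e. e \<in> E \<Longrightarrow> F e = G e"
    and F: "\<And>u v. \<lbrakk>u \<in> V; v \<in> V\<rbrakk> \<Longrightarrow> F (u + v) = F u + F v" "\<And>c u. u \<in> V \<Longrightarrow> F (c *\<^sub>R u) = c * F u"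
    and G: "\<And>u v. \<lbrakk>u \<in> V; v \<in> V\<rbrakk> \<Longrightarrow> G (u + v) = G u + G v" "\<And>c u. u \<in> V \<Longrightarrow> G (c *\<^sub>R u) = c * G u"
    for F G :: "'b \<Rightarrow> real"
  proof
    fix v assume "v \<in> V"
    have z: "0 \<in> V" by (rule subspace_0[OF V])
    have "v \<in> V \<and> F v = G v"
    proof (rule span_induct_alt[of v E])
      show "v \<in> span E" using \<open>v \<in> V\<close> E by simp
      show "0 \<in> V \<and> F 0 = G 0" using F(2)[OF z, of 0] G(2)[OF z, of 0] z by simp
    next
      fix c x y assume "x \<in> E" "y \<in> V \<and> F y = G y"
      then show "c *\<^sub>R x + y \<in> V \<and> F (c *\<^sub>R x + y) = G (c *\<^sub>R x + y)"
        using E(1) V e F G by (auto simp: subspace_add subspace_scale subset_iff)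
    qed
    then show "F v = G v" by simp
  qed
  have inj: "inj_on g (span E)"
  proof (rule linear_injective_on_subspace_0[THEN iffD2])
    show "linear g" "subspace (span E)" using g by auto
    show "\<forall>x\<in>span E. g x = 0 \<longrightarrow> x = 0"
    proof (intro ballI impI)
      fix x assume "x \<in> span E" "g x = 0"
      then have x: "x \<in> V" "T x = 0" using E gT by auto
      have "B x e = 0" if "e \<in> E" for e
        using fun_cong[OF x(2), of e] that by (simp add: T_def)
      then have "\<forall>v\<in>V. B x v = 0"
        by (intro extend) (auto simp: x(1) add2 scale2)
      then show "x = 0" using nondeg x(1) by blast
    qed
  qed
  define \<delta> where "\<delta> e = (\<lambda>e'. if e' = e then 1 else (0::real))" for e :: 'b
  have spanT: "f \<in> span (\<delta> ` E)" if "\<And>e. e \<notin> E \<Longrightarrow> f e = 0" for f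
  proof -
    have "f = (\<Sum>e\<in>E. f e *\<^sub>R \<delta> e)"
    proof
      fix x
      have *: "(\<Sum>e\<in>E'. f e *\<^sub>R \<delta> e) x = (\<Sum>e\<in>E'. if x = e then f e else 0)" if "finite E'" for E'
        using that by induction (auto simp: \<delta>_def scaleR_fun_def)
      show "f x = (\<Sum>e\<in>E. f e *\<^sub>R \<delta> e) x"
        unfolding *[OF finE] using that finE by (auto simp: sum.delta')
    qed
    also have "\<dots> \<in> span (\<delta> ` E)"
      by (intro span_sum span_scale span_base) auto
    finally show ?thesis .
  qed
  define rhs where "rhs = (\<lambda>e. if e \<in> E then L e else 0)"
  have indep: "independent (g ` E)"
    by (rule linear_independent_injective_image[OF g E(2) inj])
  \<comment> \<open>Otherwise \<open>rhs\<close> and the images of the basis would be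
    \<open>card E + 1\<close> independent vectors in the span of at most \<open>card E\<close>
    coordinate vectors \<open>\<delta> e\<close>.\<close>
  have "rhs \<in> span (g ` E)"
  proof (rule ccontr)
    assume n: "rhs \<notin> span (g ` E)"
    then have i: "independent (insert rhs (g ` E))"
      using indep by (simp add: independent_insert)
    have "insert rhs (g ` E) \<subseteq> span (\<delta> ` E)"
      using gE by (auto intro!: spanT simp: rhs_def T_def)
    from independent_span_bound[OF _ i this] finE
    have "card (insert rhs (g ` E)) \<le> card (\<delta> ` E)" by auto
    moreover have "card (insert rhs (g ` E)) = Suc (card (g ` E))"
      using n finE by (subst card_insert_disjoint) (auto intro: span_base)
    moreover have "card (g ` E) = card E"
      by (rule card_image) (rule inj_on_subset[OF inj], rule span_superset)
    ultimately show False using card_image_le[OF finE, of \<delta>] by linarith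
  qed
  then have "rhs \<in> g ` span E" using linear_span_image[OF g] by blast
  then obtain u where u: "u \<in> V" "rhs = T u" using E gT by auto
  have "B u e = L e" if "e \<in> E" for e
    using fun_cong[OF u(2), of e] that by (simp add: rhs_def T_def)
  then have sol: "\<forall>v\<in>V. B u v = L v"
    by (intro extend) (auto simp: u(1) add2 scale2 Ladd Lscale)
  show ?thesis
  proof (rule ex1I[of _ u])
    show "u \<in> V \<and> (\<forall>v\<in>V. B u v = L v)" using u sol by blast
  next
    fix u' assume u': "u' \<in> V \<and> (\<forall>v\<in>V. B u' v = L v)"
    have m: "- u \<in> V" using u(1) V by (simp add: subspace_neg)
    have "u' - u = 0"
    proof (rule nondeg)
      show "u' - u \<in> V" using u u' V by (simp add: subspace_diff)
      fix v assume v: "v \<in> V"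
      have "B (u' + (-1) *\<^sub>R u) v = B u' v + (-1) * B u v"
        using add1[of u' "(-1) *\<^sub>R u" v] scale1[of u v "-1"] u u' v V by (simp add: subspace_scale m)
      then show "B (u' - u) v = 0" using u' sol v by simp
    qed
    then show "u' = u" by simp
  qed
qed

section \<open>Finite element spaces\<close>

definition fin_dim :: "'b::real_vector set \<Rightarrow> bool" where
  "fin_dim V \<longleftrightarrow> (\<exists>S. finite S \<and> V \<subseteq> span S)"

lemma fin_dim_subset: "fin_dim V \<Longrightarrow> U \<subseteq> V \<Longrightarrow> fin_dim U"
  unfolding fin_dim_def by (meson subset_trans)

lemma fin_dim_image: "linear g \<Longrightarrow> fin_dim V \<Longrightarrow> fin_dim (g ` V)"
  unfolding fin_dim_def by (metis finite_imageI image_mono linear_span_image)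

text \<open>The common tool for families, products and finite element spaces: each element is split
  into finitely many summands from finite-dimensional spaces.\<close>

lemma fin_dim_sums:
  assumes "finite I" "\<And>i. i \<in> I \<Longrightarrow> fin_dim (V i)"
    and U: "\<And>u. u \<in> U \<Longrightarrow> \<exists>v. (\<forall>i\<in>I. v i \<in> V i) \<and> u = (\<Sum>i\<in>I. v i)"
  shows "fin_dim U"
proof -
  obtain S where S: "\<And>i. i \<in> I \<Longrightarrow> finite (S i)" "\<And>i. i \<in> I \<Longrightarrow> V i \<subseteq> span (S i)"
    using assms(2) unfolding fin_dim_def by metis
  have "U \<subseteq> span (\<Union>i\<in>I. S i)"
  proof
    fix u assume "u \<in> U"
    then obtain v where v: "\<And>i. i \<in> I \<Longrightarrow> v i \<in> V i" "u = (\<Sum>i\<in>I. v i)" using U by blast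
    have "v i \<in> span (\<Union>i\<in>I. S i)" if "i \<in> I" for i
      using v(1)[OF that] S(2)[OF that] span_mono[of "S i" "\<Union>i\<in>I. S i"] that by blast
    then show "u \<in> span (\<Union>i\<in>I. S i)" unfolding v(2) by (rule span_sum)
  qed
  then show ?thesis unfolding fin_dim_def using assms(1) S(1) by (intro exI[of _ "\<Union>i\<in>I. S i"]) auto
qed

lemma sum_fun_apply: "(\<Sum>i\<in>I. f i) x = (\<Sum>i\<in>I. f i x)"
  by (induction I rule: infinite_finite_induct) auto

lemma fin_dim_Pi:
  fixes V :: "'k::finite \<Rightarrow> 'b::real_vector set"
  assumes "\<And>k. fin_dim (V k)"
  shows "fin_dim {u. \<forall>k. u k \<in> V k}"
proof (rule fin_dim_sums[where I = UNIV and V = "\<lambda>k. (\<lambda>v j. if j = k then v else 0) ` V k"])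
  show "fin_dim ((\<lambda>v j. if j = k then v else 0) ` V k)" for k
    by (intro fin_dim_image assms linearI) (auto simp: fun_eq_iff scaleR_fun_def)
  fix u assume u: "u \<in> {u. \<forall>k. u k \<in> V k}"
  show "\<exists>v. (\<forall>k\<in>UNIV. v k \<in> (\<lambda>v j. if j = k then v else 0) ` V k) \<and> u = (\<Sum>k\<in>UNIV. v k)"
  proof (intro exI[of _ "\<lambda>k j. if j = k then u k else 0"] conjI ballI)
    show "u = (\<Sum>k\<in>UNIV. (\<lambda>j. if j = k then u k else 0))"
      by (auto simp: fun_eq_iff sum_fun_apply)
  qed (use u in auto)
qed simp

lemma fin_dim_Times:
  fixes U :: "'b::real_vector set" and V :: "'c::real_vector set"
  assumes "fin_dim U" "fin_dim V" shows "fin_dim (U \<times> V)"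
proof (rule fin_dim_sums[where I = "UNIV :: bool set" and
      V = "\<lambda>b. if b then (\<lambda>u. (u, 0 :: 'c)) ` U else (\<lambda>v. (0 :: 'b, v)) ` V"])
  have "linear (\<lambda>u :: 'b. (u, 0 :: 'c))" "linear (\<lambda>v :: 'c. (0 :: 'b, v))"
    by (auto intro!: linearI)
  then show "fin_dim (if b then (\<lambda>u. (u, 0 :: 'c)) ` U else (\<lambda>v. (0 :: 'b, v)) ` V)" for b
    using fin_dim_image[of "\<lambda>u. (u, 0 :: 'c)" U] fin_dim_image[of "\<lambda>v. (0 :: 'b, v)" V] assms by simp
  fix w assume "w \<in> U \<times> V"
  then show "\<exists>v. (\<forall>b\<in>UNIV. v b \<in> (if b then (\<lambda>u. (u, 0 :: 'c)) ` U else (\<lambda>v. (0 :: 'b, v)) ` V)) \<and>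
      w = (\<Sum>b\<in>UNIV. v b)"
    by (intro exI[of _ "\<lambda>b. if b then (fst w, 0) else (0, snd w)"]) (auto simp: UNIV_bool)
qed simp

text \<open>
  An element of \<open>fe_space\<close> is determined by a polynomial on every cell of the partition of
  \<open>\<Union>\<M>\<close> according to which members of \<open>\<M>\<close> a point belongs to.
\<close>

lemma fin_dim_fe_space:
  fixes \<M> :: "'a::euclidean_space set set"
  assumes "finite \<M>" "S = \<Union>\<M>"
  shows "fin_dim (fe_space n S \<M>)"
proof -
  define M where "M = {m :: 'a \<Rightarrow> nat. m \<in> Basis \<rightarrow>\<^sub>E {..n} \<and> (\<Sum>b\<in>Basis. m b) \<le> n}"
  define mono where "mono m x = (\<Prod>b\<in>Basis. (x \<bullet> b) ^ m b)" for m and x :: 'a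
  \<comment> \<open>A monomial cut off to the points that lie in exactly the members
    \<open>J\<close> of \<open>\<M>\<close>.\<close>
  define e where "e J m x = (if {T \<in> \<M>. x \<in> T} = J then mono m x else 0)" for J m x
  have finM: "finite (M)"
    unfolding M_def by (rule finite_subset[of _ "Basis \<rightarrow>\<^sub>E {..n}"]) (auto intro: finite_PiE)
  let ?I = "(Pow \<M> - {{}}) \<times> M"
  show ?thesis
  proof (rule fin_dim_sums[where I = ?I and V = "\<lambda>(J, m). span {e J m}"])
    show "finite ?I" using assms(1) finM by simp
    show "fin_dim (case i of (J, m) \<Rightarrow> span {e J m})" for i
      unfolding fin_dim_def by (cases i) (auto intro!: exI[of _ "{e (fst i) (snd i)}"])
    fix v assume v: "v \<in> fe_space n S \<M>"
    have "\<forall>T\<in>\<M>. \<exists>c. \<forall>x\<in>T. v x = (\<Sum>m\<in>M. c m * mono m x)"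
    proof
      fix T assume "T \<in> \<M>"
      then obtain q where q: "q \<in> polys n" "\<forall>x\<in>T. v x = q x" using v unfolding fe_space_def by blast
      then obtain c where "\<forall>x. q x = (\<Sum>m\<in>M. c m * mono m x)"
        unfolding polys_def M_def mono_def by blast
      with q(2) show "\<exists>c. \<forall>x\<in>T. v x = (\<Sum>m\<in>M. c m * mono m x)" by auto
    qed
    then obtain c where c: "\<And>T x. T \<in> \<M> \<Longrightarrow> x \<in> T \<Longrightarrow> v x = (\<Sum>m\<in>M. c T m * mono m x)" by metis
    \<comment> \<open>On those points the polynomials of all members of \<open>J\<close> take the
      same value, that of \<open>v\<close>, so any choice of a member serves. \<open>J = {}\<close>
      is excluded because \<open>v\<close> vanishes off \<open>S\<close>.\<close>
    define w where "w = (\<lambda>(J, m). c (SOME T. T \<in> J) m *\<^sub>R e J m)"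
    have "v x = (\<Sum>i\<in>?I. w i) x" for x
    proof -
      let ?J = "{T \<in> \<M>. x \<in> T}"
      have "(\<Sum>i\<in>?I. w i) x = (\<Sum>(J, m)\<in>?I. c (SOME T. T \<in> J) m * e J m x)"
        by (simp add: sum_fun_apply w_def scaleR_fun_def case_prod_unfold)
      also have "\<dots> = (\<Sum>J\<in>Pow \<M> - {{}}. \<Sum>m\<in>M. c (SOME T. T \<in> J) m * e J m x)"
        by (rule sum.cartesian_product[symmetric])
      also have "\<dots> = (\<Sum>J\<in>Pow \<M> - {{}}. if J = ?J then \<Sum>m\<in>M. c (SOME T. T \<in> ?J) m * mono m x else 0)"
        by (intro sum.cong refl) (auto simp: e_def)
      also have "\<dots> = (if ?J = {} then 0 else \<Sum>m\<in>M. c (SOME T. T \<in> ?J) m * mono m x)"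
        using assms(1) by (subst sum.delta) auto
      also have "\<dots> = v x"
      proof (cases "?J = {}")
        case True
        then have "x \<notin> S" using assms(2) by auto
        then show ?thesis using True v by (simp add: fe_space_def)
      next
        case False
        define T where "T = (SOME T. T \<in> ?J)"
        have "T \<in> ?J" unfolding T_def by (rule someI_ex) (use False in blast)
        then have "v x = (\<Sum>m\<in>M. c T m * mono m x)" using c by blast
        then show ?thesis using False by (simp only: T_def if_False)
      qed
      finally show ?thesis ..
    qed
    then have "v = (\<Sum>i\<in>?I. w i)" by (rule ext)
    moreover have "\<forall>i\<in>?I. w i \<in> (case i of (J, m) \<Rightarrow> span {e J m})"
      by (auto simp: w_def intro: span_scale span_base)
    ultimately show "\<exists>w. (\<forall>i\<in>?I. w i \<in> (case i of (J, m) \<Rightarrow> span {e J m})) \<and> v = (\<Sum>i\<in>?I. w i)"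
      by blast
  qed
qed

lemma polys_add:
  assumes "p \<in> polys n" "q \<in> polys n" shows "(\<lambda>x. p x + q x) \<in> polys n"
proof -
  obtain c d where *: "\<And>x. p x = (\<Sum>m\<in>{m \<in> Basis \<rightarrow>\<^sub>E {..n}. (\<Sum>b\<in>Basis. m b) \<le> n}. c m * (\<Prod>b\<in>Basis. (x \<bullet> b) ^ m b))"
     "\<And>x. q x = (\<Sum>m\<in>{m \<in> Basis \<rightarrow>\<^sub>E {..n}. (\<Sum>b\<in>Basis. m b) \<le> n}. d m * (\<Prod>b\<in>Basis. (x \<bullet> b) ^ m b))"
    using assms unfolding polys_def by blast
  show ?thesis unfolding polys_def mem_Collect_eq
    by (rule exI[of _ "\<lambda>m. c m + d m"]) (simp add: * distrib_right sum.distrib)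
qed

lemma polys_scale:
  assumes "p \<in> polys n" shows "(\<lambda>x. a * p x) \<in> polys n"
proof -
  obtain c where *: "\<And>x. p x = (\<Sum>m\<in>{m \<in> Basis \<rightarrow>\<^sub>E {..n}. (\<Sum>b\<in>Basis. m b) \<le> n}. c m * (\<Prod>b\<in>Basis. (x \<bullet> b) ^ m b))"
    using assms unfolding polys_def by blast
  show ?thesis unfolding polys_def mem_Collect_eq
    by (rule exI[of _ "\<lambda>m. a * c m"]) (simp add: * sum_distrib_left mult.assoc)
qed

lemma fe_space_subspace:
  fixes S :: "'a::euclidean_space set"
  shows "subspace (fe_space n S \<M>)"
proof (rule subspaceI)
  have "(\<lambda>x::'a. 0) \<in> polys n"
    unfolding polys_def mem_Collect_eq by (rule exI[of _ "\<lambda>_. 0"]) simp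
  then show "0 \<in> fe_space n S \<M>" by (auto simp: fe_space_def zero_fun_def intro!: bexI[of _ "\<lambda>x. 0"])
next
  fix u v assume "u \<in> fe_space n S \<M>" "v \<in> fe_space n S \<M>"
  then have *: "continuous_on S u" "continuous_on S v" "\<And>x. x \<notin> S \<Longrightarrow> u x = 0" "\<And>x. x \<notin> S \<Longrightarrow> v x = 0"
      "\<And>T. T \<in> \<M> \<Longrightarrow> \<exists>q\<in>polys n. \<forall>x\<in>T. u x = q x" "\<And>T. T \<in> \<M> \<Longrightarrow> \<exists>q\<in>polys n. \<forall>x\<in>T. v x = q x"
    unfolding fe_space_def by simp_all
  have "\<exists>q\<in>polys n. \<forall>x\<in>T. u x + v x = q x" if T: "T \<in> \<M>" for T
  proof -
    obtain p q where "p \<in> polys n" "\<forall>x\<in>T. u x = p x" "q \<in> polys n" "\<forall>x\<in>T. v x = q x"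
      using *(5,6)[OF T] by blast
    then show ?thesis by (intro bexI[of _ "\<lambda>x. p x + q x"] polys_add) auto
  qed
  then show "u + v \<in> fe_space n S \<M>"
    using * by (simp add: fe_space_def plus_fun_def continuous_on_add)
next
  fix c and u :: "'a \<Rightarrow> real" assume "u \<in> fe_space n S \<M>"
  then have *: "continuous_on S u" "\<And>x. x \<notin> S \<Longrightarrow> u x = 0" "\<And>T. T \<in> \<M> \<Longrightarrow> \<exists>q\<in>polys n. \<forall>x\<in>T. u x = q x"
    unfolding fe_space_def by simp_all
  have "\<exists>q\<in>polys n. \<forall>x\<in>T. c * u x = q x" if T: "T \<in> \<M>" for T
  proof -
    obtain p where "p \<in> polys n" "\<forall>x\<in>T. u x = p x" using *(3)[OF T] by blast
    then show ?thesis by (intro bexI[of _ "\<lambda>x. c * p x"] polys_scale) auto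
  qed
  then show "c *\<^sub>R u \<in> fe_space n S \<M>"
    using * by (simp add: fe_space_def scaleR_fun_def continuous_on_mult_left)
qed

lemma Xh_subspace: "subspace (Xh n \<Omega> D \<T> k)"
  using fe_space_subspace[of n "closure (D k)" "\<T> k"]
  unfolding subspace_def Xh_def Yh_def
  by (auto simp: zero_fun_def plus_fun_def scaleR_fun_def)

lemma function_subspace_iff: "function_subspace S \<longleftrightarrow> subspace S"
  by (auto simp: function_subspace_def subspace_def zero_fun_def plus_fun_def scaleR_fun_def)

lemma Wh_subspace:
  assumes "\<And>l. adjacent D k l \<Longrightarrow> subspace (W k l)" shows "subspace (Wh D W k)"
  using assms unfolding subspace_def Wh_def
  by (auto simp: zero_fun_def plus_fun_def scaleR_fun_def)

lemma linear_restrict0: "linear (restrict0 \<Gamma>)"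
  by (rule linearI) (auto simp: restrict0_def fun_eq_iff scaleR_fun_def)

context conforming_mesh
begin

lemma fin_dim_Xh: "fin_dim (Xh n \<Omega> D \<T> k)"
proof (rule fin_dim_subset)
  show "fin_dim (Yh n D \<T> k)" unfolding Yh_def by (rule fin_dim_fe_space[OF mesh_finite mesh_closure])
qed (auto simp: Xh_def)

lemma fin_dim_trace_space: "fin_dim (trace_space n D \<T> k l)"
  unfolding trace_space_def Yh_def
  by (rule fin_dim_image[OF linear_restrict0 fin_dim_fe_space[OF mesh_finite mesh_closure]])

lemma fin_dim_Wh:
  assumes "\<And>l. adjacent D k l \<Longrightarrow> W k l \<subseteq> trace_space n D \<T> k l"
  shows "fin_dim (Wh D W k)"
proof (rule fin_dim_subset)
  show "fin_dim {q. \<forall>l. q l \<in> (if adjacent D k l then W k l else {0})}"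
  proof (rule fin_dim_Pi)
    fix l show "fin_dim (if adjacent D k l then W k l else {0})"
    proof (cases "adjacent D k l")
      case True
      then show ?thesis using fin_dim_subset[OF fin_dim_trace_space assms[OF True]] by simp
    next
      case False
      then show ?thesis unfolding fin_dim_def by (auto intro!: exI[of _ "{0}"] span_base)
    qed
  qed
qed (auto simp: Wh_def zero_fun_def)

end

section \<open>The energy estimate\<close>

lemma continuous_on_fun_plus: "continuous_on S f \<Longrightarrow> continuous_on S g \<Longrightarrow> continuous_on S (f + g)"
  for f g :: "'a::topological_space \<Rightarrow> real"
  by (simp add: plus_fun_def continuous_on_add)

lemma continuous_on_fun_scaleR: "continuous_on S f \<Longrightarrow> continuous_on S (c *\<^sub>R f)"
  for f :: "'a::topological_space \<Rightarrow> real"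
  by (simp add: scaleR_fun_def continuous_on_mult_left)

lemma continuous_on_fun_uminus: "continuous_on S f \<Longrightarrow> continuous_on S (- f)"
  for f :: "'a::topological_space \<Rightarrow> real"
  by (simp add: fun_Compl_def continuous_on_minus)

lemma continuous_on_fun_zero: "continuous_on S (0 :: 'a::topological_space \<Rightarrow> real)"
  by (simp add: zero_fun_def)

lemmas continuous_on_fun = continuous_on_fun_plus continuous_on_fun_scaleR continuous_on_fun_uminus

locale robin = conforming_mesh \<Omega> D n \<T> \<sigma> \<tau>
  for \<Omega> :: "'a::euclidean_space set" and D :: "'k::finite \<Rightarrow> 'a set" and n \<T> \<sigma> \<tau> +
  fixes W :: "'k \<Rightarrow> 'k \<Rightarrow> ('a \<Rightarrow> real) set" and \<alpha> cs C :: real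
  assumes mult: "multiplier_spaces n D \<T> W"
    and stab: "multiplier_stability cs n \<Omega> D \<T> W"
    and approx: "multiplier_approximation C n \<Omega> D \<T> W"
    and alpha_pos: "\<alpha> > 0"
begin

abbreviation "X k \<equiv> Xh n \<Omega> D \<T> k"
abbreviation "\<Gamma> k l \<equiv> interface D k l"
abbreviation "adj k l \<equiv> adjacent D k l"

definition ip :: "'k \<Rightarrow> 'k \<Rightarrow> ('a \<Rightarrow> real) \<Rightarrow> ('a \<Rightarrow> real) \<Rightarrow> real" where
  "ip k l f g = surface_integral (\<Gamma> k l) (\<lambda>x. f x * g x)"

lemma ip_commute: "ip k l f g = ip k l g f"
  by (simp add: ip_def mult.commute)

lemma ip_swap: "ip k l f g = ip l k f g"
  by (simp add: ip_def interface_commute)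

lemma ip_add:
  assumes "adj k l" "continuous_on (\<Gamma> k l) f" "continuous_on (\<Gamma> k l) g" "continuous_on (\<Gamma> k l) h"
  shows "ip k l (f + g) h = ip k l f h + ip k l g h" "ip k l h (f + g) = ip k l h f + ip k l h g"
proof -
  interpret surface_piece "\<Gamma> k l" by (rule surface_piece_interface[OF assms(1)])
  show *: "ip k l (f + g) h = ip k l f h + ip k l g h"
    unfolding ip_def plus_fun_apply distrib_right
    by (intro surface_integral_add continuous_on_mult assms)
  show "ip k l h (f + g) = ip k l h f + ip k l h g"
    using * by (simp only: ip_commute[of k l h])
qed

lemma ip_scale:
  "ip k l (c *\<^sub>R f) h = c * ip k l f h" "ip k l h (c *\<^sub>R f) = c * ip k l h f"
proof -
  show *: "ip k l (c *\<^sub>R f) h = c * ip k l f h"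
    by (simp add: ip_def scaleR_fun_def mult.assoc surface_integral_def)
  show "ip k l h (c *\<^sub>R f) = c * ip k l h f"
    using * by (simp only: ip_commute[of k l h])
qed

lemma ip_uminus: "ip k l (- f) h = - ip k l f h" "ip k l h (- f) = - ip k l h f"
  using ip_scale[where c = "-1"] by simp_all

lemma ip_zero [simp]: "ip k l 0 h = 0" "ip k l h 0 = 0"
  using ip_scale[where c = 0 and f = f for f :: "'a \<Rightarrow> real"] by simp_all

lemma ip_diff:
  assumes "adj k l" "continuous_on (\<Gamma> k l) f" "continuous_on (\<Gamma> k l) g" "continuous_on (\<Gamma> k l) h"
  shows "ip k l (f - g) h = ip k l f h - ip k l g h" "ip k l h (f - g) = ip k l h f - ip k l h g"
  using ip_add[OF assms(1,2) continuous_on_fun_uminus[OF assms(3)] assms(4)] by (simp_all add: ip_uminus)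

lemma ip_nonneg: "adj k l \<Longrightarrow> 0 \<le> ip k l f f"
  unfolding ip_def by (rule surface_piece.surface_integral_nonneg[OF surface_piece_interface]) auto

lemma ip_eq_0:
  assumes "adj k l" "continuous_on (\<Gamma> k l) f" "ip k l f f = 0" "x \<in> \<Gamma> k l"
  shows "f x = 0"
  using surface_piece.surface_integral_eq_0[OF surface_piece_interface[OF assms(1)], of "\<lambda>x. f x * f x" x] assms
  by (auto simp: ip_def intro: continuous_on_mult)

lemma ip_square:
  assumes "adj k l" "continuous_on (\<Gamma> k l) f" "continuous_on (\<Gamma> k l) g"
  shows "ip k l (f + c *\<^sub>R g) (f + c *\<^sub>R g) = ip k l f f + 2 * c * ip k l f g + c\<^sup>2 * ip k l g g"
proof -
  have c: "continuous_on (\<Gamma> k l) (c *\<^sub>R g)" "continuous_on (\<Gamma> k l) (f + c *\<^sub>R g)"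
    by (intro continuous_on_fun assms)+
  have "ip k l (f + c *\<^sub>R g) (f + c *\<^sub>R g) = ip k l f (f + c *\<^sub>R g) + c * ip k l g (f + c *\<^sub>R g)"
    by (simp only: ip_add(1)[OF assms(1,2) c] ip_scale)
  also have "\<dots> = ip k l f f + c * ip k l f g + c * (ip k l g f + c * ip k l g g)"
    by (simp only: ip_add(2)[OF assms(1,2) c(1) assms(2)] ip_add(2)[OF assms(1,2) c(1) assms(3)] ip_scale)
  also have "ip k l g f = ip k l f g" by (rule ip_commute)
  finally show ?thesis by algebra
qed

section \<open>Discrete functions, multipliers, projections and Robin traces\<close>

lemma X_subspace: "subspace (X k)" by (rule Xh_subspace)

lemma X_continuous: "v \<in> X k \<Longrightarrow> continuous_on (closure (D k)) v"
  and X_zero: "v \<in> X k \<Longrightarrow> x \<notin> closure (D k) \<Longrightarrow> v x = 0"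
  by (auto simp: Xh_def Yh_def fe_space_def)

lemma X_H1: "v \<in> X k \<Longrightarrow> v \<in> H1 (D k)"
  using Yh_H1 by (auto simp: Xh_def)

lemma X_continuous_interface:
  assumes "v \<in> X k" shows "continuous_on (\<Gamma> k l) v" "continuous_on (\<Gamma> l k) v"
  by (rule continuous_on_subset[OF X_continuous[OF assms]], simp add: interface_subset_closure)+

lemma form_add:
  assumes "u \<in> X k" "v \<in> X k" "w \<in> X k"
  shows "h1_form (D k) (u + v) w = h1_form (D k) u w + h1_form (D k) v w"
    "h1_form (D k) w (u + v) = h1_form (D k) w u + h1_form (D k) w v"
proof -
  show *: "h1_form (D k) (u + v) w = h1_form (D k) u w + h1_form (D k) v w"
    unfolding plus_fun_def by (intro h1_form_add_left D_open D_bounded X_H1 assms)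
  then show "h1_form (D k) w (u + v) = h1_form (D k) w u + h1_form (D k) w v"
    by (simp only: h1_form_commute[of _ w])
qed

lemma form_scale:
  assumes "u \<in> X k" "w \<in> X k"
  shows "h1_form (D k) (c *\<^sub>R u) w = c * h1_form (D k) u w" "h1_form (D k) w (c *\<^sub>R u) = c * h1_form (D k) w u"
proof -
  show *: "h1_form (D k) (c *\<^sub>R u) w = c * h1_form (D k) u w"
    using h1_form_scale_left[OF D_open D_bounded X_H1 X_H1, OF assms, of c] by (simp add: scaleR_fun_def)
  then show "h1_form (D k) w (c *\<^sub>R u) = c * h1_form (D k) w u"
    by (simp only: h1_form_commute[of _ w])
qed

lemma form_eq_0:
  assumes "u \<in> X k" "h1_form (D k) u u = 0" shows "u = 0"
proof
  fix x show "u x = 0 x"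
    using h1_norm_eq_0_continuous[OF D_open D_bounded X_H1[OF assms(1)] assms(2) X_continuous[OF assms(1)]]
      X_zero[OF assms(1), of x] by (cases "x \<in> closure (D k)") auto
qed

lemma W_subspace: "adj k l \<Longrightarrow> subspace (W k l)"
  using mult by (auto simp: multiplier_spaces_def function_subspace_iff)

lemma W_trace: "adj k l \<Longrightarrow> W k l \<subseteq> trace_space n D \<T> k l"
  using mult by (auto simp: multiplier_spaces_def)

lemma W_continuous:
  assumes "adj k l" "q \<in> W k l" shows "continuous_on (\<Gamma> k l) q"
proof -
  obtain y where y: "y \<in> Yh n D \<T> k" "q = restrict0 (\<Gamma> k l) y"
    using W_trace[OF assms(1)] assms(2) by (auto simp: trace_space_def)
  have "continuous_on (\<Gamma> k l) y"
    using y(1) interface_subset_closure by (auto simp: Yh_def fe_space_def intro: continuous_on_subset)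
  then show ?thesis by (rule continuous_on_eq) (simp add: y(2) restrict0_def)
qed

lemma W_zero: "adj k l \<Longrightarrow> q \<in> W k l \<Longrightarrow> x \<notin> \<Gamma> k l \<Longrightarrow> q x = 0"
  using W_trace by (fastforce simp: trace_space_def restrict0_def)

lemma W_eq_0:
  assumes "adj k l" "q \<in> W k l" "\<And>x. x \<in> \<Gamma> k l \<Longrightarrow> q x = 0" shows "q = 0"
  using W_zero[OF assms(1,2)] assms(3) by (auto simp: fun_eq_iff)

text \<open>The scalar product is definite on \<open>W k l\<close>, since multipliers are continuous
  on the interface and vanish elsewhere.\<close>

lemma projection_exists:
  assumes kl: "adj k l" and v: "continuous_on (\<Gamma> k l) v"
  shows "\<exists>!w. w \<in> W k l \<and> (\<forall>\<psi>\<in>W k l. ip k l w \<psi> = ip k l v \<psi>)"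
proof -
  obtain S where S: "finite S" "W k l \<subseteq> span S"
    using fin_dim_subset[OF fin_dim_trace_space W_trace[OF kl]] unfolding fin_dim_def by blast
  show ?thesis
  proof (rule nondegenerate_form_solvable[OF W_subspace[OF kl] S])
    fix u assume u: "u \<in> W k l" "\<And>v. v \<in> W k l \<Longrightarrow> ip k l u v = 0"
    show "u = 0"
      using ip_eq_0[OF kl W_continuous[OF kl u(1)] u(2)[OF u(1)]] by (intro W_eq_0[OF kl u(1)])
  qed (use kl v in \<open>auto simp: ip_add ip_scale W_continuous\<close>)
qed

definition proj :: "'k \<Rightarrow> 'k \<Rightarrow> ('a \<Rightarrow> real) \<Rightarrow> 'a \<Rightarrow> real" where
  "proj k l v = (THE w. w \<in> W k l \<and> (\<forall>\<psi>\<in>W k l. ip k l w \<psi> = ip k l v \<psi>))"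

lemma proj:
  assumes "adj k l" "continuous_on (\<Gamma> k l) v"
  shows "proj k l v \<in> W k l" "\<psi> \<in> W k l \<Longrightarrow> ip k l (proj k l v) \<psi> = ip k l v \<psi>"
    "continuous_on (\<Gamma> k l) (proj k l v)"
proof -
  have *: "proj k l v \<in> W k l \<and> (\<forall>\<psi>\<in>W k l. ip k l (proj k l v) \<psi> = ip k l v \<psi>)"
    unfolding proj_def by (rule theI'[OF projection_exists[OF assms]])
  then show "proj k l v \<in> W k l" "\<psi> \<in> W k l \<Longrightarrow> ip k l (proj k l v) \<psi> = ip k l v \<psi>" by auto
  then show "continuous_on (\<Gamma> k l) (proj k l v)" using W_continuous[OF assms(1)] by blast
qed

lemma mesh_size_nonneg: "0 \<le> mesh_size \<T>"
proof -
  obtain k :: 'k where True by blast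
  have "\<T> k \<noteq> {}" using mesh_closure[of k] D_nonempty[of k] closure_subset[of "D k"] by auto
  then obtain T where T: "T \<in> \<T> k" by blast
  have "0 \<le> diameter T" using mesh_cell(3)[OF T] by (intro diameter_ge_0 compact_imp_bounded)
  also have "\<dots> \<le> mesh_size \<T>"
    unfolding mesh_size_def by (rule Max_ge) (use T mesh_finite in auto)
  finally show ?thesis .
qed

text \<open>The approximation property with the trace norm replaced by the H1 norm of
  \<open>v\<close>, which is a competitor in the quotient norm. \<open>\<bar>C\<bar>\<close> keeps
  the bound nonnegative whatever the sign of \<open>C\<close>.\<close>

lemma proj_approx:
  assumes kl: "adj k l" and v: "v \<in> X k"
  shows "ip k l (v - proj k l v) (v - proj k l v) \<le> \<bar>C\<bar> * mesh_size \<T> * h1_form (D k) v v"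
proof -
  let ?w = "proj k l v"
  have c: "continuous_on (\<Gamma> k l) v" by (rule X_continuous_interface(1)[OF v])
  have F0: "0 \<le> h1_form (D k) v v" by (rule h1_form_nonneg)
  have "is_L2_projection (\<Gamma> k l) (W k l) v ?w"
    unfolding is_L2_projection_def
  proof (rule conjI[OF proj(1)[OF kl c]], rule ballI)
    fix \<psi> assume \<psi>: "\<psi> \<in> W k l"
    have "ip k l (?w - v) \<psi> = 0"
      using proj[OF kl c] \<psi> kl c by (simp add: ip_diff W_continuous)
    then show "surface_integral (\<Gamma> k l) (\<lambda>x. (?w x - v x) * \<psi> x) = 0" by (simp add: ip_def)
  qed
  then have "ennreal (surface_integral (\<Gamma> k l) (\<lambda>x. (?w x - v x)\<^sup>2))
      \<le> ennreal (C * mesh_size \<T>) * (h_half_norm (D k) (\<Gamma> k l) v)\<^sup>2"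
    using approx kl v unfolding multiplier_approximation_def by blast
  also have "\<dots> \<le> ennreal (\<bar>C\<bar> * mesh_size \<T>) * (ennreal (h1_norm (D k) v))\<^sup>2"
  proof (rule mult_mono[OF ennreal_leI power_mono])
    show "C * mesh_size \<T> \<le> \<bar>C\<bar> * mesh_size \<T>" using mesh_size_nonneg by (intro mult_right_mono) auto
    show "h_half_norm (D k) (\<Gamma> k l) v \<le> ennreal (h1_norm (D k) v)"
      by (rule h_half_norm_continuous_le[OF D_open D_bounded X_H1[OF v] X_continuous[OF v]])
        (auto simp: interface_def)
  qed auto
  also have "\<dots> = ennreal (\<bar>C\<bar> * mesh_size \<T> * h1_form (D k) v v)"
  proof -
    have "0 \<le> h1_norm (D k) v" using F0 by (simp add: h1_norm_def)
    then have "(ennreal (h1_norm (D k) v))\<^sup>2 = ennreal ((h1_norm (D k) v)\<^sup>2)" by (rule ennreal_power)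
    also have "(h1_norm (D k) v)\<^sup>2 = h1_form (D k) v v" using F0 by (simp add: h1_norm_def)
    finally show ?thesis using mesh_size_nonneg F0 by (simp add: ennreal_mult)
  qed
  finally have "surface_integral (\<Gamma> k l) (\<lambda>x. (?w x - v x)\<^sup>2) \<le> \<bar>C\<bar> * mesh_size \<T> * h1_form (D k) v v"
    using mesh_size_nonneg F0 by (subst (asm) ennreal_le_iff) auto
  then show ?thesis by (simp add: ip_def power2_eq_square algebra_simps)
qed

lemma Wh_D:
  assumes "p \<in> Wh D W k" shows "adj k l \<Longrightarrow> p l \<in> W k l" "\<not> adj k l \<Longrightarrow> p l = 0"
  using assms by (auto simp: Wh_def zero_fun_def split: if_splits)

lemma Wh_subspace': "subspace (Wh D W k)"
  using W_subspace by (rule Wh_subspace)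

text \<open>A squared norm. With the multiplier \<open>p\<close> it measures the Robin datum
  entering \<open>D k\<close>, with \<open>- p\<close> the one leaving it; projecting
  \<open>u\<close> puts both into \<open>W k l\<close>.\<close>

definition robin_norm :: "'k \<Rightarrow> 'k \<Rightarrow> ('a \<Rightarrow> real) \<Rightarrow> ('a \<Rightarrow> real) \<Rightarrow> real" where
  "robin_norm k l p u = ip k l (p + \<alpha> *\<^sub>R proj k l u) (p + \<alpha> *\<^sub>R proj k l u)"

lemma robin_norm_nonneg: "adj k l \<Longrightarrow> 0 \<le> robin_norm k l p u"
  unfolding robin_norm_def by (rule ip_nonneg)

text \<open>Polarisation; the projection may be inserted in the pairing with \<open>u\<close>
  because \<open>p\<close> is a multiplier.\<close>

lemma robin_norm_difference:
  assumes kl: "adj k l" and p: "p \<in> W k l" and u: "u \<in> X k"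
  shows "4 * \<alpha> * ip k l p u = robin_norm k l p u - robin_norm k l (- p) u"
proof -
  have c: "continuous_on (\<Gamma> k l) u" "continuous_on (\<Gamma> k l) p"
    using X_continuous_interface(1)[OF u] W_continuous[OF kl p] by auto
  have "ip k l p (proj k l u) = ip k l p u"
    using proj(2)[OF kl c(1) p] by (simp only: ip_commute[of k l p])
  then show ?thesis
    unfolding robin_norm_def ip_square[OF kl c(2) proj(3)[OF kl c(1)]]
      ip_square[OF kl continuous_on_fun_uminus[OF c(2)] proj(3)[OF kl c(1)]]
    by (simp add: ip_uminus)
qed

text \<open>\<open>z\<close>, the sum of \<open>p\<close> and \<alpha> times the projection of
  \<open>u\<close>, is the projection of the datum \<open>g\<close>, and projections do not increase
  the norm.\<close>

lemma robin_data_le: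
  assumes kl: "adj k l" and p: "p \<in> W k l" and u: "u \<in> X k" and g: "continuous_on (\<Gamma> k l) g"
    and eq: "\<And>\<psi>. \<psi> \<in> W k l \<Longrightarrow> ip k l (p + \<alpha> *\<^sub>R u) \<psi> = ip k l g \<psi>"
  shows "robin_norm k l p u \<le> ip k l g g"
proof -
  define z where "z = p + \<alpha> *\<^sub>R proj k l u"
  have c: "continuous_on (\<Gamma> k l) u" "continuous_on (\<Gamma> k l) p"
    using X_continuous_interface(1)[OF u] W_continuous[OF kl p] by auto
  note P = proj[OF kl c(1)]
  have z: "z \<in> W k l"
    unfolding z_def using W_subspace[OF kl] p P(1) by (intro subspace_add subspace_scale)
  have zc: "continuous_on (\<Gamma> k l) z" by (rule W_continuous[OF kl z])
  have "ip k l z z = ip k l (p + \<alpha> *\<^sub>R u) z"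
    unfolding z_def[symmetric] using P(2)[OF z] kl c P(3) zc
    by (subst z_def) (simp add: ip_add ip_scale continuous_on_fun)
  then have "ip k l z z = ip k l g z" using eq[OF z] by simp
  \<comment> \<open>Expanded, the square of \<open>g - z\<close> equals
    \<open>ip k l g g - ip k l z z\<close>.\<close>
  moreover have "0 \<le> ip k l (g + (-1) *\<^sub>R z) (g + (-1) *\<^sub>R z)" by (rule ip_nonneg[OF kl])
  ultimately have "ip k l z z \<le> ip k l g g" unfolding ip_square[OF kl g zc] by simp
  then show ?thesis by (simp add: robin_norm_def z_def)
qed

text \<open>Pythagoras: the datum sent by \<open>D l\<close> is its part in \<open>W l k\<close>,
  the space of the sender, plus \<alpha> times the projection error of \<open>u\<close>, which is
  orthogonal to that space.\<close>

lemma robin_data_split: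
  assumes kl: "adj k l" and p: "p \<in> W l k" and u: "u \<in> X l"
  shows "ip k l (- p + \<alpha> *\<^sub>R u) (- p + \<alpha> *\<^sub>R u)
    \<le> robin_norm l k (- p) u + \<alpha>\<^sup>2 * (\<bar>C\<bar> * mesh_size \<T> * h1_form (D l) u u)"
proof -
  have lk: "adj l k" using kl adjacent_sym[of D k l] by simp
  define y where "y = - p + \<alpha> *\<^sub>R proj l k u"
  define d where "d = u - proj l k u"
  have c: "continuous_on (\<Gamma> l k) u" "continuous_on (\<Gamma> l k) p"
    using X_continuous_interface(1)[OF u] W_continuous[OF lk p] by auto
  note P = proj[OF lk c(1)]
  have y: "y \<in> W l k"
    unfolding y_def using W_subspace[OF lk] p P(1) by (intro subspace_add subspace_scale subspace_neg)
  have yc: "continuous_on (\<Gamma> l k) y" by (rule W_continuous[OF lk y])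
  have d': "d = u + (-1) *\<^sub>R proj l k u" by (simp add: d_def)
  have dc: "continuous_on (\<Gamma> l k) d" unfolding d' using c P(3) by (intro continuous_on_fun)
  have "ip l k d y = 0"
    unfolding d_def using P(2)[OF y] lk c P(3) yc by (simp add: ip_diff)
  then have yd: "ip l k y d = 0" by (simp only: ip_commute[of l k y])
  have "- p + \<alpha> *\<^sub>R u = y + \<alpha> *\<^sub>R d" by (simp add: y_def d_def scaleR_diff_right)
  then have "ip k l (- p + \<alpha> *\<^sub>R u) (- p + \<alpha> *\<^sub>R u) = ip l k (y + \<alpha> *\<^sub>R d) (y + \<alpha> *\<^sub>R d)"
    using ip_swap by metis
  also have "\<dots> = ip l k y y + \<alpha>\<^sup>2 * ip l k d d" unfolding ip_square[OF lk yc dc] yd by simp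
  also have "\<dots> \<le> ip l k y y + \<alpha>\<^sup>2 * (\<bar>C\<bar> * mesh_size \<T> * h1_form (D l) u u)"
    using proj_approx[OF lk u] by (intro add_left_mono mult_left_mono) (auto simp: d_def)
  finally show ?thesis by (simp add: robin_norm_def y_def)
qed

section \<open>Local problems without source and the energy balance\<close>

lemma boundary_pairing_ip: "boundary_pairing D k p v = (\<Sum>l | adj k l. ip k l (p l) v)"
  by (simp add: boundary_pairing_def ip_def)

lemma pairing_add:
  shows "\<lbrakk>p \<in> Wh D W k; q \<in> Wh D W k; v \<in> X k\<rbrakk> \<Longrightarrow>
      boundary_pairing D k (p + q) v = boundary_pairing D k p v + boundary_pairing D k q v"
    "\<lbrakk>p \<in> Wh D W k; u \<in> X k; v \<in> X k\<rbrakk> \<Longrightarrow>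
      boundary_pairing D k p (u + v) = boundary_pairing D k p u + boundary_pairing D k p v"
  by (auto simp: boundary_pairing_ip sum.distrib[symmetric] ip_add Wh_D W_continuous X_continuous_interface
      intro!: sum.cong)

lemma pairing_scale:
  "boundary_pairing D k (c *\<^sub>R p) v = c * boundary_pairing D k p v"
  "boundary_pairing D k p (c *\<^sub>R v) = c * boundary_pairing D k p v"
proof -
  have "(c *\<^sub>R p) l = c *\<^sub>R p l" for l by (simp add: scaleR_fun_def)
  then show "boundary_pairing D k (c *\<^sub>R p) v = c * boundary_pairing D k p v"
    by (simp add: boundary_pairing_ip sum_distrib_left ip_scale)
  show "boundary_pairing D k p (c *\<^sub>R v) = c * boundary_pairing D k p v"
    by (simp add: boundary_pairing_ip sum_distrib_left ip_scale)
qed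

text \<open>Satisfied by the difference of two new iterates, since their sources cancel.\<close>

definition homogeneous :: "'k \<Rightarrow> ('a \<Rightarrow> real) \<Rightarrow> ('k \<Rightarrow> 'a \<Rightarrow> real) \<Rightarrow> bool" where
  "homogeneous k u p \<longleftrightarrow> u \<in> X k \<and> p \<in> Wh D W k \<and>
     (\<forall>v\<in>X k. h1_form (D k) u v = boundary_pairing D k p v)"

text \<open>Testing with the \<open>w\<close> of the stability property and Cauchy-Schwarz give
  \<open>N\<^sup>2 \<le> \<bar>cs\<bar> * h1_norm (D k) u * N\<close> for the dual norm
  \<open>N\<close>. It is finite, because its square is bounded by a real number, so one factor
  cancels.\<close>

lemma homogeneous_multiplier_bound:
  assumes h: "homogeneous k u p" and kl: "adj k l"
  shows "h_minus_half_norm (D k) (\<Gamma> k l) (p l) \<le> ennreal (\<bar>cs\<bar> * h1_norm (D k) u)"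
proof -
  have up: "u \<in> X k" "p \<in> Wh D W k" "\<And>v. v \<in> X k \<Longrightarrow> h1_form (D k) u v = boundary_pairing D k p v"
    using h by (auto simp: homogeneous_def)
  let ?N = "h_minus_half_norm (D k) (\<Gamma> k l) (p l)"
  have "p l \<in> W k l" using Wh_D(1)[OF up(2) kl] .
  then obtain w where w: "w \<in> X k" "\<And>x. x \<in> frontier (D k) - \<Gamma> k l \<Longrightarrow> w x = 0"
    "?N\<^sup>2 \<le> ennreal (surface_integral (\<Gamma> k l) (\<lambda>x. p l x * w x))"
    "ennreal (h1_norm (D k) w) \<le> ennreal cs * ?N"
    using stab kl unfolding multiplier_stability_def by blast
  \<comment> \<open>\<open>w\<close> vanishes on the boundary off the interface with
    \<open>D l\<close>, and the other interfaces meet that one only in the null set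
    \<open>skeleton\<close>.\<close>
  have "ip k m (p m) w = 0" if m: "adj k m" "m \<noteq> l" for m
  proof -
    have "AE x in surface_measure. indicator (\<Gamma> k m) x *\<^sub>R (p m x * w x) = 0"
      using AE_not_in[OF skeleton_null]
    proof eventually_elim
      case (elim x)
      have "x \<in> frontier (D k) - \<Gamma> k l" if "x \<in> \<Gamma> k m"
        using that elim interfaces_overlap_in_skeleton[OF kl m(1)] m(2) by (auto simp: interface_def)
      then show ?case using w(2)[of x] by (auto simp: indicator_def)
    qed
    then have "(LINT x|surface_measure. indicator (\<Gamma> k m) x *\<^sub>R (p m x * w x)) = 0"
      by (rule integral_eq_zero_AE)
    then show ?thesis by (simp add: ip_def surface_integral_def set_lebesgue_integral_def)
  qed
  then have "boundary_pairing D k p w = (\<Sum>m\<in>{l}. ip k m (p m) w)"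
    unfolding boundary_pairing_ip using kl by (intro sum.mono_neutral_right) auto
  then have form: "h1_form (D k) u w = surface_integral (\<Gamma> k l) (\<lambda>x. p l x * w x)"
    using up(3)[OF w(1)] by (simp add: ip_def)
  have N2: "?N\<^sup>2 \<le> ennreal (h1_form (D k) u w)" using w(3) form by simp
  then have "?N \<noteq> top" by (auto simp: top_unique power2_eq_square)
  then obtain r where r: "?N = ennreal r" "r \<ge> 0" by (cases ?N) auto
  have nn: "0 \<le> h1_norm (D k) v" for v using h1_form_nonneg[of "D k" v] by (simp add: h1_norm_def)
  have "h1_norm (D k) w \<le> \<bar>cs\<bar> * r"
  proof -
    have "ennreal (h1_norm (D k) w) \<le> ennreal (\<bar>cs\<bar> * r)"
      using order_trans[OF w(4)[unfolded r(1)] mult_right_mono[OF ennreal_leI[OF abs_ge_self]]] r(2)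
      by (simp add: ennreal_mult)
    then show ?thesis using r(2) by simp
  qed
  then have "h1_norm (D k) u * h1_norm (D k) w \<le> h1_norm (D k) u * (\<bar>cs\<bar> * r)"
    using nn by (intro mult_left_mono)
  moreover have "h1_form (D k) u w \<le> h1_norm (D k) u * h1_norm (D k) w"
    using h1_form_le_norm[OF D_open D_bounded X_H1 X_H1, OF up(1) w(1)] by simp
  ultimately have le: "h1_form (D k) u w \<le> h1_norm (D k) u * (\<bar>cs\<bar> * r)" by linarith
  have "ennreal (r\<^sup>2) \<le> ennreal (h1_norm (D k) u * (\<bar>cs\<bar> * r))"
    using N2 ennreal_leI[OF le] r by (simp add: ennreal_power)
  then have "r * r \<le> (\<bar>cs\<bar> * h1_norm (D k) u) * r"
    using r(2) nn[of u] by (simp add: power2_eq_square mult_ac)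
  then have "r \<le> \<bar>cs\<bar> * h1_norm (D k) u"
    using r(2) nn[of u] by (cases "r = 0") (auto simp: mult_le_cancel_right)
  then show ?thesis unfolding r(1) by (rule ennreal_leI)
qed

lemma homogeneous_zero:
  assumes h: "homogeneous k 0 p" shows "p = 0"
proof
  fix l show "p l = 0 l"
  proof (cases "adj k l")
    case False
    then show ?thesis using h Wh_D(2)[of p k l] by (simp add: homogeneous_def)
  next
    case True
    have pW: "p l \<in> W k l" using h Wh_D(1)[OF _ True] by (simp add: homogeneous_def)
    have "0 \<in> X k" using h by (simp add: homogeneous_def)
    then have "h1_norm (D k) 0 = 0" using form_scale(1)[of 0 k 0 0] by (simp add: h1_norm_def)
    then have "h_minus_half_norm (D k) (\<Gamma> k l) (p l) = 0"
      using homogeneous_multiplier_bound[OF h True] by simp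
    then have "p l = 0"
      using h_minus_half_norm_eq_0[OF True W_continuous[OF True pW]] by (intro W_eq_0[OF True pW])
    then show ?thesis by simp
  qed
qed

lemma homogeneous_energy:
  assumes h: "homogeneous k u p"
  shows "4 * \<alpha> * h1_form (D k) u u = (\<Sum>l | adj k l. robin_norm k l (p l) u - robin_norm k l (- p l) u)"
proof -
  have "h1_form (D k) u u = (\<Sum>l | adj k l. ip k l (p l) u)"
    using h by (simp add: homogeneous_def boundary_pairing_ip)
  then show ?thesis
    using h by (auto simp: sum_distrib_left homogeneous_def robin_norm_difference Wh_D(1) intro!: sum.cong)
qed

text \<open>Without incoming data the energy balance leaves only the outgoing data, with a negative
  sign, so the energy vanishes. This is the injectivity of a local step.\<close>

lemma homogeneous_no_data:
  assumes h: "homogeneous k u p"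
    and eq: "\<And>l \<psi>. adj k l \<Longrightarrow> \<psi> \<in> W k l \<Longrightarrow> ip k l (p l + \<alpha> *\<^sub>R u) \<psi> = 0"
  shows "u = 0 \<and> p = 0"
proof -
  have up: "u \<in> X k" "p \<in> Wh D W k" using h by (auto simp: homogeneous_def)
  have "robin_norm k l (p l) u - robin_norm k l (- p l) u \<le> 0" if l: "adj k l" for l
  proof -
    have "robin_norm k l (p l) u \<le> ip k l 0 0"
      using eq[OF l] by (intro robin_data_le[OF l Wh_D(1)[OF up(2) l] up(1)]) (auto intro: continuous_on_fun_zero)
    then show ?thesis using robin_norm_nonneg[OF l, of "- p l" u] by simp
  qed
  then have "4 * \<alpha> * h1_form (D k) u u \<le> 0"
    unfolding homogeneous_energy[OF h] by (intro sum_nonpos) auto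
  then have "h1_form (D k) u u = 0"
    using alpha_pos h1_form_nonneg[of "D k" u] by (simp add: mult_le_0_iff)
  then have u: "u = 0" by (rule form_eq_0[OF up(1)])
  then show ?thesis using homogeneous_zero h by blast
qed

definition energy :: "('k \<Rightarrow> 'a \<Rightarrow> real) \<Rightarrow> real" where
  "energy u = (\<Sum>k\<in>UNIV. h1_form (D k) (u k) (u k))"

definition outgoing :: "('k \<Rightarrow> 'a \<Rightarrow> real) \<Rightarrow> ('k \<Rightarrow> 'k \<Rightarrow> 'a \<Rightarrow> real) \<Rightarrow> real" where
  "outgoing u p = (\<Sum>k\<in>UNIV. \<Sum>l | adj k l. robin_norm k l (- p k l) (u k))"

lemma energy_nonneg: "0 \<le> energy u"
  unfolding energy_def by (intro sum_nonneg h1_form_nonneg)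

lemma outgoing_nonneg: "0 \<le> outgoing u p"
  unfolding outgoing_def by (intro sum_nonneg robin_norm_nonneg) auto

text \<open>
  The Robin data leaving \<open>D k\<close> through \<open>\<Gamma> k l\<close> are the data entering \<open>D l\<close>, up to the error of
  the projection, which the smallness of \<open>\<alpha> h\<close> lets the energy absorb.
\<close>

lemma energy_step:
  assumes old: "\<And>k. u k \<in> X k" "\<And>k. p k \<in> Wh D W k"
    and new: "\<And>k. homogeneous k (u' k) (p' k)"
    and eq: "\<And>k l \<psi>. adj k l \<Longrightarrow> \<psi> \<in> W k l \<Longrightarrow>
        ip k l (p' k l + \<alpha> *\<^sub>R u' k) \<psi> = ip k l (- p l k + \<alpha> *\<^sub>R u l) \<psi>"
  shows "4 * \<alpha> * energy u' + outgoing u' p'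
    \<le> outgoing u p + \<alpha>\<^sup>2 * (\<bar>C\<bar> * mesh_size \<T>) * real CARD('k) * energy u"
proof -
  let ?c = "\<alpha>\<^sup>2 * (\<bar>C\<bar> * mesh_size \<T>)"
  have c0: "0 \<le> ?c" using mesh_size_nonneg by simp
  have "robin_norm k l (p' k l) (u' k) \<le> robin_norm l k (- p l k) (u l) + ?c * h1_form (D l) (u l) (u l)"
    if kl: "adj k l" for k l
  proof -
    have lk: "adj l k" using kl adjacent_sym[of D k l] by simp
    have "continuous_on (\<Gamma> k l) (p l k)"
      using W_continuous[OF lk Wh_D(1)[OF old(2) lk]] by (simp only: interface_commute[of D k l])
    then have "continuous_on (\<Gamma> k l) (- p l k + \<alpha> *\<^sub>R u l)"
      using X_continuous_interface(2)[OF old(1)[of l], of k] by (intro continuous_on_fun)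
    then have "robin_norm k l (p' k l) (u' k) \<le> ip k l (- p l k + \<alpha> *\<^sub>R u l) (- p l k + \<alpha> *\<^sub>R u l)"
      using new[of k] eq[OF kl] by (intro robin_data_le[OF kl]) (auto simp: homogeneous_def Wh_D(1) kl)
    also have "\<dots> \<le> robin_norm l k (- p l k) (u l) + \<alpha>\<^sup>2 * (\<bar>C\<bar> * mesh_size \<T> * h1_form (D l) (u l) (u l))"
      by (rule robin_data_split[OF kl Wh_D(1)[OF old(2) lk] old(1)])
    finally show ?thesis by (simp add: mult.assoc)
  qed
  then have "(\<Sum>k\<in>UNIV. \<Sum>l | adj k l. robin_norm k l (p' k l) (u' k)) \<le>
      (\<Sum>k\<in>UNIV. \<Sum>l | adj k l. robin_norm l k (- p l k) (u l) + ?c * h1_form (D l) (u l) (u l))"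
    by (intro sum_mono) auto
  \<comment> \<open>Regrouping by the sender \<open>l\<close> produces \<open>outgoing u p\<close>
    and one error term for each neighbour, at most \<open>CARD('k)\<close> of them.\<close>
  also have "\<dots> = (\<Sum>l\<in>UNIV. \<Sum>k | adj k l. robin_norm l k (- p l k) (u l) + ?c * h1_form (D l) (u l) (u l))"
    using sum.swap_restrict[of "UNIV :: 'k set" "UNIV :: 'k set"
        "\<lambda>k l. robin_norm l k (- p l k) (u l) + ?c * h1_form (D l) (u l) (u l)" "\<lambda>k l. adj k l"] by simp
  also have "\<dots> = outgoing u p + (\<Sum>l\<in>UNIV. \<Sum>k | adj l k. ?c * h1_form (D l) (u l) (u l))"
  proof -
    have swap: "(\<Sum>k | adj k l. r k + c) = (\<Sum>k | adj l k. r k) + (\<Sum>k | adj l k. c)"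
      for l and r :: "'k \<Rightarrow> real" and c
    proof -
      have "adj k l = adj l k" for k by (rule adjacent_sym)
      then have S: "{k. adj k l} = {k. adj l k}" by (intro Collect_cong)
      show ?thesis unfolding S by (rule sum.distrib)
    qed
    show ?thesis
      unfolding outgoing_def by (subst sum.distrib[symmetric]) (intro sum.cong refl swap)
  qed
  also have "(\<Sum>l\<in>UNIV. \<Sum>k | adj l k. ?c * h1_form (D l) (u l) (u l)) \<le>
      (\<Sum>l\<in>UNIV. real CARD('k) * (?c * h1_form (D l) (u l) (u l)))"
  proof (rule sum_mono)
    fix l
    have "card {k. adj l k} \<le> CARD('k)" by (rule card_mono) auto
    then show "(\<Sum>k | adj l k. ?c * h1_form (D l) (u l) (u l)) \<le> real CARD('k) * (?c * h1_form (D l) (u l) (u l))"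
      using c0 h1_form_nonneg[of "D l" "u l"] by (simp add: mult_right_mono)
  qed
  also have "\<dots> = ?c * real CARD('k) * energy u"
    by (simp add: energy_def sum_distrib_left mult_ac)
  finally have "(\<Sum>k\<in>UNIV. \<Sum>l | adj k l. robin_norm k l (p' k l) (u' k)) \<le>
      outgoing u p + ?c * real CARD('k) * energy u" by simp
  moreover have "4 * \<alpha> * energy u' = (\<Sum>k\<in>UNIV. \<Sum>l | adj k l. robin_norm k l (p' k l) (u' k)) - outgoing u' p'"
    unfolding energy_def outgoing_def sum_distrib_left sum_subtractf[symmetric]
    by (intro sum.cong refl homogeneous_energy new)
  ultimately show ?thesis by simp
qed

end

section \<open>Well-posedness and convergence\<close>

lemma square_integrable_subdomain:
  fixes f :: "'a::euclidean_space \<Rightarrow> real"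
  assumes f: "square_integrable (lebesgue_on \<Omega>) f" and \<Omega>: "\<Omega>' \<in> sets lebesgue" "\<Omega> \<in> sets lebesgue" "\<Omega>' \<subseteq> \<Omega>"
  shows "square_integrable (lebesgue_on \<Omega>') f"
proof -
  have eq: "lebesgue_on \<Omega>' = restrict_space (lebesgue_on \<Omega>) \<Omega>'"
    using \<Omega> by (subst restrict_restrict_space) (auto simp: Int_absorb1)
  have S: "\<Omega>' \<in> sets (lebesgue_on \<Omega>)" using \<Omega> by (auto simp: sets_restrict_space image_iff intro!: bexI[of _ \<Omega>'])
  have i: "integrable (lebesgue_on \<Omega>) (\<lambda>x. (norm (f x))\<^sup>2)" and m: "f \<in> borel_measurable (lebesgue_on \<Omega>)"
    using f by (auto simp: square_integrable_def)
  have "integrable (lebesgue_on \<Omega>) (\<lambda>x. indicator \<Omega>' x *\<^sub>R (norm (f x))\<^sup>2)"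
    by (rule integrable_mult_indicator[OF S i])
  then have "integrable (restrict_space (lebesgue_on \<Omega>) \<Omega>') (\<lambda>x. (norm (f x))\<^sup>2)"
    using S \<Omega>(3) by (subst integrable_restrict_space) (auto simp: space_restrict_space Int_absorb2)
  then show ?thesis
    unfolding square_integrable_def eq using measurable_restrict_space1[OF m] by blast
qed

lemma subspace_Pi:
  fixes V :: "'k \<Rightarrow> 'b::real_vector set"
  assumes "\<And>k. subspace (V k)" shows "subspace {u. \<forall>k. u k \<in> V k}"
  using assms by (auto simp: subspace_def scaleR_fun_def)

context robin
begin

definition source :: "('a \<Rightarrow> real) \<Rightarrow> 'k \<Rightarrow> ('a \<Rightarrow> real) \<Rightarrow> real" where
  "source f k v = (LINT x|lebesgue_on (D k). f x * v x)"

lemma source_zero [simp]: "source 0 k v = 0" "source f k 0 = 0"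
  by (simp_all add: source_def)

lemma source_linear:
  assumes f: "square_integrable (lebesgue_on \<Omega>) f" and v: "v \<in> X k" "w \<in> X k"
  shows "source f k (v + w) = source f k v + source f k w" "source f k (c *\<^sub>R v) = c * source f k v"
proof -
  have "bounded_domain \<Omega>"
    using decomp by (auto simp: conforming_decomposition_def C11_domain_def polyhedral_domain_def)
  then have "open \<Omega>" by (simp add: bounded_domain_def)
  then have f': "square_integrable (lebesgue_on (D k)) f"
    using D_open[of k] D_domain(3)[of k] by (intro square_integrable_subdomain[OF f]) auto
  have "integrable (lebesgue_on (D k)) (\<lambda>x. f x * y x)" if "y \<in> X k" for y
    by (intro square_integrable_mult f' grad_H1(1)[OF D_open D_bounded] X_H1 that)
  then show "source f k (v + w) = source f k v + source f k w"
    using v by (simp add: source_def distrib_left)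
  show "source f k (c *\<^sub>R v) = c * source f k v"
    by (simp add: source_def scaleR_fun_def mult.left_commute)
qed

lemma next_iterates_iff:
  "(u', p') \<in> next_iterates n \<Omega> D \<T> W \<alpha> f u p k \<longleftrightarrow>
     u' \<in> X k \<and> p' \<in> Wh D W k \<and>
     (\<forall>v\<in>X k. h1_form (D k) u' v - boundary_pairing D k p' v = source f k v) \<and>
     (\<forall>l. adj k l \<longrightarrow> (\<forall>\<psi>\<in>W k l. ip k l (p' l + \<alpha> *\<^sub>R u') \<psi> = ip k l (- p l k + \<alpha> *\<^sub>R u l) \<psi>))"
  by (simp add: next_iterates_def ip_def source_def scaleR_fun_def)

lemma X_zero_mem: "0 \<in> X k" and Wh_zero_mem: "0 \<in> Wh D W k" and W_zero_mem: "adj k l \<Longrightarrow> 0 \<in> W k l"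
  by (simp_all add: subspace_0 X_subspace Wh_subspace' W_subspace)

lemma form_zero: "u \<in> X k \<Longrightarrow> h1_form (D k) u 0 = 0" "u \<in> X k \<Longrightarrow> h1_form (D k) 0 u = 0"
  using form_scale[of u k u 0] by auto

lemma pairing_zero: "boundary_pairing D k 0 v = 0" "boundary_pairing D k p 0 = 0"
  by (simp_all add: boundary_pairing_ip)

lemma robin_continuous:
  assumes kl: "adj k l" and "u \<in> X k" "p \<in> Wh D W k"
  shows "continuous_on (\<Gamma> k l) (p l + \<alpha> *\<^sub>R u)" "continuous_on (\<Gamma> l k) (- p l + \<alpha> *\<^sub>R u)"
proof -
  have c: "continuous_on (\<Gamma> k l) (p l)" by (rule W_continuous[OF kl Wh_D(1)[OF assms(3) kl]])
  show "continuous_on (\<Gamma> k l) (p l + \<alpha> *\<^sub>R u)"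
    by (intro continuous_on_fun c X_continuous_interface assms(2))
  have "continuous_on (\<Gamma> k l) (- p l + \<alpha> *\<^sub>R u)"
    by (intro continuous_on_fun c X_continuous_interface assms(2))
  then show "continuous_on (\<Gamma> l k) (- p l + \<alpha> *\<^sub>R u)" by (simp only: interface_commute[of D l k])
qed

text \<open>Test functions that vanish on all subdomains but one decouple the summed equation.
  Discrete solutions are thus fixed points of the iteration, so one energy estimate serves
  uniqueness and convergence.\<close>

lemma discrete_solutions_iff:
  "(u, p) \<in> discrete_solutions n \<Omega> D \<T> W \<alpha> f \<longleftrightarrow>
     (\<forall>k. (u k, p k) \<in> next_iterates n \<Omega> D \<T> W \<alpha> f u p k)" (is "?lhs \<longleftrightarrow> ?rhs")
proof
  assume ?lhs
  then have m: "\<And>k. u k \<in> X k" "\<And>k. p k \<in> Wh D W k"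
    and c: "\<And>k l \<psi>. \<lbrakk>adj k l; \<psi> \<in> W k l\<rbrakk> \<Longrightarrow> ip k l ((p k l + \<alpha> *\<^sub>R u k) - (- p l k + \<alpha> *\<^sub>R u l)) \<psi> = 0"
    and e: "\<And>v. (\<And>k. v k \<in> X k) \<Longrightarrow>
      (\<Sum>k\<in>UNIV. h1_form (D k) (u k) (v k)) - (\<Sum>k\<in>UNIV. boundary_pairing D k (p k) (v k)) = (\<Sum>k\<in>UNIV. source f k (v k))"
    by (auto simp: discrete_solutions_def Vh_def ip_def source_def scaleR_fun_def)
  show ?rhs
  proof
    fix k
    have "h1_form (D k) (u k) v - boundary_pairing D k (p k) v = source f k v" if v: "v \<in> X k" for v
    proof -
      define V where "V j = (if j = k then v else 0)" for j
      have "V j \<in> X j" for j using v X_zero_mem by (simp add: V_def)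
      note e[OF this]
      moreover have "(\<Sum>j\<in>UNIV. h1_form (D j) (u j) (V j)) = (\<Sum>j\<in>{k}. h1_form (D j) (u j) (V j))"
        by (intro sum.mono_neutral_right) (auto simp: V_def form_zero m)
      moreover have "(\<Sum>j\<in>UNIV. boundary_pairing D j (p j) (V j)) = (\<Sum>j\<in>{k}. boundary_pairing D j (p j) (V j))"
        by (intro sum.mono_neutral_right) (auto simp: V_def pairing_zero)
      moreover have "(\<Sum>j\<in>UNIV. source f j (V j)) = (\<Sum>j\<in>{k}. source f j (V j))"
        by (intro sum.mono_neutral_right) (auto simp: V_def)
      ultimately show ?thesis by (simp add: V_def)
    qed
    moreover have "ip k l (p k l + \<alpha> *\<^sub>R u k) \<psi> = ip k l (- p l k + \<alpha> *\<^sub>R u l) \<psi>" if kl: "adj k l" "\<psi> \<in> W k l" for l \<psi>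
    proof -
      have lk: "adj l k" using kl(1) adjacent_sym[of D k l] by simp
      show ?thesis
        using c[OF kl] ip_diff(1)[OF kl(1) robin_continuous(1)[OF kl(1) m(1,2)] robin_continuous(2)[OF lk m(1,2)]
            W_continuous[OF kl]] by simp
    qed
    ultimately show "(u k, p k) \<in> next_iterates n \<Omega> D \<T> W \<alpha> f u p k"
      using m by (simp add: next_iterates_iff)
  qed
next
  assume r: ?rhs
  then have m: "\<And>k. u k \<in> X k" "\<And>k. p k \<in> Wh D W k"
    and e: "\<And>k v. v \<in> X k \<Longrightarrow> h1_form (D k) (u k) v - boundary_pairing D k (p k) v = source f k v"
    and c: "\<And>k l \<psi>. \<lbrakk>adj k l; \<psi> \<in> W k l\<rbrakk> \<Longrightarrow> ip k l (p k l + \<alpha> *\<^sub>R u k) \<psi> = ip k l (- p l k + \<alpha> *\<^sub>R u l) \<psi>"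
    by (simp_all add: next_iterates_iff)
  have "ip k l ((p k l + \<alpha> *\<^sub>R u k) - (- p l k + \<alpha> *\<^sub>R u l)) \<psi> = 0" if kl: "adj k l" "\<psi> \<in> W k l" for k l \<psi>
  proof -
    have lk: "adj l k" using kl(1) adjacent_sym[of D k l] by simp
    show ?thesis
      using c[OF kl] ip_diff(1)[OF kl(1) robin_continuous(1)[OF kl(1) m(1,2)] robin_continuous(2)[OF lk m(1,2)]
          W_continuous[OF kl]] by simp
  qed
  moreover have "(\<Sum>k\<in>UNIV. h1_form (D k) (u k) (v k)) - (\<Sum>k\<in>UNIV. boundary_pairing D k (p k) (v k)) = (\<Sum>k\<in>UNIV. source f k (v k))"
    if "\<And>k. v k \<in> X k" for v
    unfolding sum_subtractf[symmetric] by (intro sum.cong refl e that)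
  ultimately show ?lhs
    using m by (auto simp: discrete_solutions_def Vh_def ip_def source_def scaleR_fun_def)
qed

lemma next_iterates_difference:
  assumes 1: "(u1', p1') \<in> next_iterates n \<Omega> D \<T> W \<alpha> f u1 p1 k" and 2: "(u2', p2') \<in> next_iterates n \<Omega> D \<T> W \<alpha> f u2 p2 k"
    and old: "\<And>l. u1 l \<in> X l" "\<And>l. p1 l \<in> Wh D W l" "\<And>l. u2 l \<in> X l" "\<And>l. p2 l \<in> Wh D W l"
  shows "homogeneous k (u1' - u2') (p1' - p2')"
    "\<lbrakk>adj k l; \<psi> \<in> W k l\<rbrakk> \<Longrightarrow>
      ip k l ((p1' - p2') l + \<alpha> *\<^sub>R (u1' - u2')) \<psi> = ip k l (- (p1 l - p2 l) k + \<alpha> *\<^sub>R (u1 l - u2 l)) \<psi>"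
proof -
  have m: "u1' \<in> X k" "u2' \<in> X k" "p1' \<in> Wh D W k" "p2' \<in> Wh D W k"
    using 1 2 by (auto simp: next_iterates_iff)
  have m': "u1' - u2' \<in> X k" "p1' - p2' \<in> Wh D W k" "- u2' \<in> X k" "- p2' \<in> Wh D W k"
    using m X_subspace Wh_subspace' by (auto intro: subspace_diff subspace_neg)
  have "h1_form (D k) (u1' - u2') v = boundary_pairing D k (p1' - p2') v" if v: "v \<in> X k" for v
  proof -
    have "h1_form (D k) (u1' - u2') v = h1_form (D k) u1' v - h1_form (D k) u2' v"
      using form_add(1)[OF m(1) m'(3) v] form_scale(1)[OF m(2) v, of "-1"] by simp
    moreover have "boundary_pairing D k (p1' - p2') v = boundary_pairing D k p1' v - boundary_pairing D k p2' v"
      using pairing_add(1)[OF m(3) m'(4) v] pairing_scale(1)[of k "-1" p2' v] by simp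
    moreover have "h1_form (D k) u1' v - boundary_pairing D k p1' v = h1_form (D k) u2' v - boundary_pairing D k p2' v"
      using 1 2 v by (simp add: next_iterates_iff)
    ultimately show ?thesis by linarith
  qed
  then show "homogeneous k (u1' - u2') (p1' - p2')" using m' by (simp add: homogeneous_def)
  assume kl: "adj k l" "\<psi> \<in> W k l"
  have lk: "adj l k" using kl(1) adjacent_sym[of D k l] by simp
  have e: "ip k l (p1' l + \<alpha> *\<^sub>R u1') \<psi> = ip k l (- p1 l k + \<alpha> *\<^sub>R u1 l) \<psi>"
    "ip k l (p2' l + \<alpha> *\<^sub>R u2') \<psi> = ip k l (- p2 l k + \<alpha> *\<^sub>R u2 l) \<psi>"
    using 1 2 kl by (auto simp: next_iterates_iff)
  have d1: "(p1' - p2') l + \<alpha> *\<^sub>R (u1' - u2') = (p1' l + \<alpha> *\<^sub>R u1') - (p2' l + \<alpha> *\<^sub>R u2')"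
    by (simp add: scaleR_diff_right)
  have d2: "- (p1 l - p2 l) k + \<alpha> *\<^sub>R (u1 l - u2 l) = (- p1 l k + \<alpha> *\<^sub>R u1 l) - (- p2 l k + \<alpha> *\<^sub>R u2 l)"
    by (simp add: scaleR_diff_right)
  show "ip k l ((p1' - p2') l + \<alpha> *\<^sub>R (u1' - u2')) \<psi> = ip k l (- (p1 l - p2 l) k + \<alpha> *\<^sub>R (u1 l - u2 l)) \<psi>"
    unfolding d1 d2 using e ip_diff(1)[OF kl(1) robin_continuous(1)[OF kl(1) m(1,3)] robin_continuous(1)[OF kl(1) m(2,4)] W_continuous[OF kl]]
      ip_diff(1)[OF kl(1) robin_continuous(2)[OF lk old(1,2)] robin_continuous(2)[OF lk old(3,4)] W_continuous[OF kl]]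
    by (simp only:)
qed

section \<open>Variational forms of a local step and of the coupled problem\<close>

definition single :: "'k \<Rightarrow> ('a \<Rightarrow> real) \<Rightarrow> 'k \<Rightarrow> 'a \<Rightarrow> real" where
  "single l \<psi> = (\<lambda>m. if m = l then \<psi> else 0)"

lemma single_mem: "adj k l \<Longrightarrow> \<psi> \<in> W k l \<Longrightarrow> single l \<psi> \<in> Wh D W k"
  by (auto simp: single_def Wh_def W_zero_mem zero_fun_def[symmetric])

lemma sum_single: "adj k l \<Longrightarrow> (\<Sum>m | adj k m. ip k m (g m) (single l \<psi> m)) = ip k l (g l) \<psi>"
proof -
  assume "adj k l"
  then have "(\<Sum>m | adj k m. ip k m (g m) (single l \<psi> m)) = (\<Sum>m\<in>{l}. ip k m (g m) (single l \<psi> m))"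
    by (intro sum.mono_neutral_right) (auto simp: single_def)
  then show ?thesis by (simp add: single_def)
qed

text \<open>The variational equation and the Robin conditions added into one form; the test pairs
  \<open>(v, 0)\<close> and \<open>(0, single l \<psi>)\<close> separate them again.\<close>

definition local_form ::
    "'k \<Rightarrow> ('a \<Rightarrow> real) \<times> ('k \<Rightarrow> 'a \<Rightarrow> real) \<Rightarrow> ('a \<Rightarrow> real) \<times> ('k \<Rightarrow> 'a \<Rightarrow> real) \<Rightarrow> real" where
  "local_form k s t = h1_form (D k) (fst s) (fst t) - boundary_pairing D k (snd s) (fst t) +
     (\<Sum>l | adj k l. ip k l (snd s l + \<alpha> *\<^sub>R fst s) (snd t l))"

lemma next_iterates_local_form:
  assumes s: "s \<in> X k \<times> Wh D W k"
  shows "s \<in> next_iterates n \<Omega> D \<T> W \<alpha> f u p k \<longleftrightarrow>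
     (\<forall>t \<in> X k \<times> Wh D W k. local_form k s t =
        source f k (fst t) + (\<Sum>l | adj k l. ip k l (- p l k + \<alpha> *\<^sub>R u l) (snd t l)))"
    (is "?lhs \<longleftrightarrow> ?rhs")
proof
  assume ?lhs
  then have "(fst s, snd s) \<in> next_iterates n \<Omega> D \<T> W \<alpha> f u p k" by simp
  then show ?rhs
    unfolding next_iterates_iff local_form_def
    by (auto intro!: sum.cong simp: Wh_D(1))
next
  assume r: ?rhs
  have "h1_form (D k) (fst s) v - boundary_pairing D k (snd s) v = source f k v" if "v \<in> X k" for v
    using r[rule_format, of "(v, 0)"] that Wh_zero_mem by (simp add: local_form_def)
  moreover have "ip k l (snd s l + \<alpha> *\<^sub>R fst s) \<psi> = ip k l (- p l k + \<alpha> *\<^sub>R u l) \<psi>"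
    if "adj k l" "\<psi> \<in> W k l" for l \<psi>
    using r[rule_format, of "(0, single l \<psi>)"] X_zero_mem single_mem[OF that] that s
    by (auto simp: local_form_def sum_single form_zero pairing_zero)
  ultimately have "(fst s, snd s) \<in> next_iterates n \<Omega> D \<T> W \<alpha> f u p k"
    unfolding next_iterates_iff using s by auto
  then show ?lhs by simp
qed

lemma sum_ip_add:
  assumes "p \<in> Wh D W k" "q \<in> Wh D W k" "\<And>l. adj k l \<Longrightarrow> continuous_on (\<Gamma> k l) (g l)"
  shows "(\<Sum>l | adj k l. ip k l (g l) ((p + q) l)) = (\<Sum>l | adj k l. ip k l (g l) (p l)) + (\<Sum>l | adj k l. ip k l (g l) (q l))"
  unfolding sum.distrib[symmetric]
proof (intro sum.cong refl)
  fix l assume "l \<in> {l. adj k l}"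
  then have kl: "adj k l" by simp
  have e: "(p + q) l = p l + q l" by simp
  show "ip k l (g l) ((p + q) l) = ip k l (g l) (p l) + ip k l (g l) (q l)"
    unfolding e
    by (rule ip_add(2)[OF kl W_continuous[OF kl Wh_D(1)[OF assms(1) kl]] W_continuous[OF kl Wh_D(1)[OF assms(2) kl]] assms(3)[OF kl]])
qed

lemma sum_ip_scale:
  "(\<Sum>l | adj k l. ip k l (g l) ((c *\<^sub>R p) l)) = c * (\<Sum>l | adj k l. ip k l (g l) (p l))"
  by (simp add: sum_distrib_left ip_scale scaleR_fun_def[of c p])

lemma local_form_add:
  assumes "s \<in> X k \<times> Wh D W k" "t \<in> X k \<times> Wh D W k" "w \<in> X k \<times> Wh D W k"
  shows "local_form k (s + t) w = local_form k s w + local_form k t w"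
    "local_form k w (s + t) = local_form k w s + local_form k w t"
proof -
  have m: "fst s \<in> X k" "snd s \<in> Wh D W k" "fst t \<in> X k" "snd t \<in> Wh D W k"
      "fst w \<in> X k" "snd w \<in> Wh D W k" using assms by auto
  have "(\<Sum>l | adj k l. ip k l ((snd s + snd t) l + \<alpha> *\<^sub>R (fst s + fst t)) (snd w l)) =
      (\<Sum>l | adj k l. ip k l (snd s l + \<alpha> *\<^sub>R fst s) (snd w l)) + (\<Sum>l | adj k l. ip k l (snd t l + \<alpha> *\<^sub>R fst t) (snd w l))"
    unfolding sum.distrib[symmetric]
  proof (intro sum.cong refl)
    fix l assume "l \<in> {l. adj k l}"
    then have kl: "adj k l" by simp
    have e: "(snd s + snd t) l + \<alpha> *\<^sub>R (fst s + fst t) = (snd s l + \<alpha> *\<^sub>R fst s) + (snd t l + \<alpha> *\<^sub>R fst t)"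
      by (simp add: scaleR_add_right)
    show "ip k l ((snd s + snd t) l + \<alpha> *\<^sub>R (fst s + fst t)) (snd w l) =
        ip k l (snd s l + \<alpha> *\<^sub>R fst s) (snd w l) + ip k l (snd t l + \<alpha> *\<^sub>R fst t) (snd w l)"
      unfolding e
      by (rule ip_add(1)[OF kl robin_continuous(1)[OF kl m(1,2)] robin_continuous(1)[OF kl m(3,4)]
            W_continuous[OF kl Wh_D(1)[OF m(6) kl]]])
  qed
  then show "local_form k (s + t) w = local_form k s w + local_form k t w"
    unfolding local_form_def fst_add snd_add form_add(1)[OF m(1,3,5)] pairing_add(1)[OF m(2,4,5)]
    by simp
  have "(\<Sum>l | adj k l. ip k l (snd w l + \<alpha> *\<^sub>R fst w) ((snd s + snd t) l)) =
      (\<Sum>l | adj k l. ip k l (snd w l + \<alpha> *\<^sub>R fst w) (snd s l)) + (\<Sum>l | adj k l. ip k l (snd w l + \<alpha> *\<^sub>R fst w) (snd t l))"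
    by (rule sum_ip_add[OF m(2,4) robin_continuous(1)[OF _ m(5,6)]])
  then show "local_form k w (s + t) = local_form k w s + local_form k w t"
    unfolding local_form_def fst_add snd_add form_add(2)[OF m(1,3,5)] pairing_add(2)[OF m(6,1,3)]
    by simp
qed

lemma local_form_scale:
  assumes "s \<in> X k \<times> Wh D W k" "w \<in> X k \<times> Wh D W k"
  shows "local_form k (c *\<^sub>R s) w = c * local_form k s w"
    "local_form k w (c *\<^sub>R s) = c * local_form k w s"
proof -
  have m: "fst s \<in> X k" "fst w \<in> X k" using assms by auto
  have e: "(c *\<^sub>R snd s) l + \<alpha> *\<^sub>R c *\<^sub>R fst s = c *\<^sub>R (snd s l + \<alpha> *\<^sub>R fst s)" for l
    by (simp add: scaleR_fun_def[of c "snd s"] scaleR_add_right scaleR_left_commute)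
  show "local_form k (c *\<^sub>R s) w = c * local_form k s w"
    unfolding local_form_def fst_scaleR snd_scaleR form_scale(1)[OF m] pairing_scale e ip_scale sum_distrib_left[symmetric]
    by (simp add: algebra_simps)
  show "local_form k w (c *\<^sub>R s) = c * local_form k w s"
    unfolding local_form_def fst_scaleR snd_scaleR form_scale(2)[OF m] pairing_scale sum_ip_scale
    by (simp add: algebra_simps)
qed

text \<open>A kernel element of \<open>local_form\<close> is an iterate without source and with zero
  previous data, so \<open>homogeneous_no_data\<close> applies.\<close>

theorem next_iterates_ex1:
  assumes f: "square_integrable (lebesgue_on \<Omega>) f"
    and old: "\<And>l. u l \<in> X l" "\<And>l. p l \<in> Wh D W l"
  shows "\<exists>!s. s \<in> next_iterates n \<Omega> D \<T> W \<alpha> f u p k"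
proof -
  let ?V = "X k \<times> Wh D W k"
  define L where "L t = source f k (fst t) + (\<Sum>l | adj k l. ip k l (- p l k + \<alpha> *\<^sub>R u l) (snd t l))"
    for t :: "('a \<Rightarrow> real) \<times> ('k \<Rightarrow> 'a \<Rightarrow> real)"
  obtain S where S: "finite S" "?V \<subseteq> span S"
    using fin_dim_Times[OF fin_dim_Xh fin_dim_Wh[where W = W, OF W_trace]] unfolding fin_dim_def by blast
  have oc: "continuous_on (\<Gamma> k l) (- p l k + \<alpha> *\<^sub>R u l)" if "adj k l" for l
  proof -
    have "adj l k" using that adjacent_sym[of D k l] by simp
    then show ?thesis by (rule robin_continuous(2)[OF _ old])
  qed
  have "\<exists>!s. s \<in> ?V \<and> (\<forall>t\<in>?V. local_form k s t = L t)"
  proof (rule nondegenerate_form_solvable[OF _ S])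
    show "subspace ?V" by (intro subspace_Times X_subspace Wh_subspace')
  next
    fix s t w assume m: "s \<in> ?V" "t \<in> ?V" "w \<in> ?V"
    show "local_form k (s + t) w = local_form k s w + local_form k t w"
      "local_form k w (s + t) = local_form k w s + local_form k w t"
      by (rule local_form_add[OF m])+
  next
    fix c s w assume m: "s \<in> ?V" "w \<in> ?V"
    show "local_form k (c *\<^sub>R s) w = c * local_form k s w" "local_form k w (c *\<^sub>R s) = c * local_form k w s"
      by (rule local_form_scale[OF m])+
  next
    fix s t assume "s \<in> ?V" "t \<in> ?V"
    then have m: "fst s \<in> X k" "snd s \<in> Wh D W k" "fst t \<in> X k" "snd t \<in> Wh D W k" by auto
    have "(\<Sum>l | adj k l. ip k l (- p l k + \<alpha> *\<^sub>R u l) ((snd s + snd t) l)) =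
        (\<Sum>l | adj k l. ip k l (- p l k + \<alpha> *\<^sub>R u l) (snd s l)) + (\<Sum>l | adj k l. ip k l (- p l k + \<alpha> *\<^sub>R u l) (snd t l))"
      by (rule sum_ip_add[OF m(2,4) oc])
    then show "L (s + t) = L s + L t"
      unfolding L_def fst_add snd_add source_linear(1)[OF f m(1,3)] by (simp only: add_ac)
  next
    fix c s assume "s \<in> ?V"
    then show "L (c *\<^sub>R s) = c * L s"
      unfolding L_def fst_scaleR snd_scaleR sum_ip_scale by (auto simp: source_linear[OF f] distrib_left)
  next
    fix s assume s: "s \<in> ?V" "\<And>t. t \<in> ?V \<Longrightarrow> local_form k s t = 0"
    have "s \<in> next_iterates n \<Omega> D \<T> W \<alpha> 0 0 0 k"
      unfolding next_iterates_local_form[OF s(1)] using s(2) by simp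
    then have "(fst s, snd s) \<in> next_iterates n \<Omega> D \<T> W \<alpha> 0 0 0 k" by simp
    then have "homogeneous k (fst s) (snd s)"
      "\<And>l \<psi>. adj k l \<Longrightarrow> \<psi> \<in> W k l \<Longrightarrow> ip k l (snd s l + \<alpha> *\<^sub>R fst s) \<psi> = 0"
      unfolding next_iterates_iff homogeneous_def by auto
    from homogeneous_no_data[OF this] show "s = 0" by (simp add: prod_eq_iff)
  qed
  moreover have "s \<in> next_iterates n \<Omega> D \<T> W \<alpha> f u p k \<longleftrightarrow> s \<in> ?V \<and> (\<forall>t\<in>?V. local_form k s t = L t)" for s
  proof -
    have "s \<in> ?V" if "s \<in> next_iterates n \<Omega> D \<T> W \<alpha> f u p k"
      using that by (cases s) (auto simp: next_iterates_iff)
    then show ?thesis using next_iterates_local_form[of s k f u p] unfolding L_def by blast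
  qed
  ultimately show ?thesis by simp
qed

text \<open>The local forms with the data of the neighbours moved to the left-hand side, since these
  are now unknowns too.\<close>

definition global_form ::
    "('k \<Rightarrow> 'a \<Rightarrow> real) \<times> ('k \<Rightarrow> 'k \<Rightarrow> 'a \<Rightarrow> real) \<Rightarrow> ('k \<Rightarrow> 'a \<Rightarrow> real) \<times> ('k \<Rightarrow> 'k \<Rightarrow> 'a \<Rightarrow> real) \<Rightarrow> real" where
  "global_form s t = (\<Sum>k\<in>UNIV. local_form k (fst s k, snd s k) (fst t k, snd t k)
     - (\<Sum>l | adj k l. ip k l (- snd s l k + \<alpha> *\<^sub>R fst s l) (snd t k l)))"

lemma discrete_solutions_global_form:
  assumes s: "\<And>k. fst s k \<in> X k" "\<And>k. snd s k \<in> Wh D W k"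
  shows "s \<in> discrete_solutions n \<Omega> D \<T> W \<alpha> f \<longleftrightarrow>
     (\<forall>t \<in> {u. \<forall>k. u k \<in> X k} \<times> {p. \<forall>k. p k \<in> Wh D W k}. global_form s t = (\<Sum>k\<in>UNIV. source f k (fst t k)))"
    (is "?lhs \<longleftrightarrow> ?rhs")
proof -
  have "?lhs \<longleftrightarrow> (\<forall>k. (fst s k, snd s k) \<in> next_iterates n \<Omega> D \<T> W \<alpha> f (fst s) (snd s) k)"
    using discrete_solutions_iff[of "fst s" "snd s" f] by simp
  also have "\<dots> \<longleftrightarrow> (\<forall>k. \<forall>t \<in> X k \<times> Wh D W k. local_form k (fst s k, snd s k) t =
        source f k (fst t) + (\<Sum>l | adj k l. ip k l (- snd s l k + \<alpha> *\<^sub>R fst s l) (snd t l)))"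
    using s by (intro all_cong1 next_iterates_local_form) simp
  also have "\<dots> \<longleftrightarrow> ?rhs"
  proof
    assume "\<forall>k. \<forall>t \<in> X k \<times> Wh D W k. local_form k (fst s k, snd s k) t =
        source f k (fst t) + (\<Sum>l | adj k l. ip k l (- snd s l k + \<alpha> *\<^sub>R fst s l) (snd t l))"
    then show ?rhs unfolding global_form_def by (auto intro!: sum.cong)
  next
    assume r: ?rhs
    show "\<forall>k. \<forall>t \<in> X k \<times> Wh D W k. local_form k (fst s k, snd s k) t =
        source f k (fst t) + (\<Sum>l | adj k l. ip k l (- snd s l k + \<alpha> *\<^sub>R fst s l) (snd t l))"
    proof (intro allI ballI)
      fix k t assume t: "t \<in> X k \<times> Wh D W k"
      define T :: "('k \<Rightarrow> 'a \<Rightarrow> real) \<times> ('k \<Rightarrow> 'k \<Rightarrow> 'a \<Rightarrow> real)"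
        where "T = (\<lambda>j. if j = k then fst t else 0, \<lambda>j. if j = k then snd t else 0)"
      have "T \<in> {u. \<forall>k. u k \<in> X k} \<times> {p. \<forall>k. p k \<in> Wh D W k}"
        using t X_zero_mem Wh_zero_mem by (auto simp: T_def)
      with r have "global_form s T = (\<Sum>k\<in>UNIV. source f k (fst T k))" by blast
      moreover have "global_form s T = (\<Sum>j\<in>{k}. local_form j (fst s j, snd s j) (fst T j, snd T j)
         - (\<Sum>l | adj j l. ip j l (- snd s l j + \<alpha> *\<^sub>R fst s l) (snd T j l)))"
        unfolding global_form_def
        by (intro sum.mono_neutral_right) (auto simp: T_def local_form_def form_zero pairing_zero s)
      moreover have "(\<Sum>j\<in>UNIV. source f j (fst T j)) = (\<Sum>j\<in>{k}. source f j (fst T j))"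
        by (intro sum.mono_neutral_right) (auto simp: T_def)
      ultimately show "local_form k (fst s k, snd s k) t =
          source f k (fst t) + (\<Sum>l | adj k l. ip k l (- snd s l k + \<alpha> *\<^sub>R fst s l) (snd t l))"
        by (simp add: T_def)
    qed
  qed
  finally show ?thesis .
qed

lemma Xs_subspace: "subspace {u. \<forall>k. u k \<in> X k}"
  by (intro subspace_Pi X_subspace)

lemma Whs_subspace: "subspace {p. \<forall>k. p k \<in> Wh D W k}"
  by (intro subspace_Pi Wh_subspace')

definition incoming_form where
  "incoming_form s t = (\<Sum>k\<in>UNIV. \<Sum>l | adj k l. ip k l (- snd s l k + \<alpha> *\<^sub>R fst s l) (snd t k l))"

lemma global_form_split:
  "global_form s t = (\<Sum>k\<in>UNIV. local_form k (fst s k, snd s k) (fst t k, snd t k)) - incoming_form s t"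
  by (simp add: global_form_def incoming_form_def sum_subtractf)

abbreviation "unknowns \<equiv> {u. \<forall>k. u k \<in> X k} \<times> {p. \<forall>k. p k \<in> Wh D W k}"

lemma incoming_form_add:
  assumes "s \<in> unknowns" "t \<in> unknowns" "w \<in> unknowns"
  shows "incoming_form (s + t) w = incoming_form s w + incoming_form t w"
    "incoming_form w (s + t) = incoming_form w s + incoming_form w t"
proof -
  have m: "fst s k \<in> X k" "snd s k \<in> Wh D W k" "fst t k \<in> X k" "snd t k \<in> Wh D W k"
      "fst w k \<in> X k" "snd w k \<in> Wh D W k" for k
    using assms by auto
  show "incoming_form (s + t) w = incoming_form s w + incoming_form t w"
    unfolding incoming_form_def sum.distrib[symmetric]
  proof (intro sum.cong refl)
    fix k l assume "l \<in> {l. adj k l}"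
    then have kl: "adj k l" by simp
    then have lk: "adj l k" using adjacent_sym[of D k l] by simp
    have e: "- snd (s + t) l k + \<alpha> *\<^sub>R fst (s + t) l = (- snd s l k + \<alpha> *\<^sub>R fst s l) + (- snd t l k + \<alpha> *\<^sub>R fst t l)"
      by (simp add: scaleR_add_right)
    show "ip k l (- snd (s + t) l k + \<alpha> *\<^sub>R fst (s + t) l) (snd w k l) =
        ip k l (- snd s l k + \<alpha> *\<^sub>R fst s l) (snd w k l) + ip k l (- snd t l k + \<alpha> *\<^sub>R fst t l) (snd w k l)"
      unfolding e
      by (rule ip_add(1)[OF kl robin_continuous(2)[OF lk m(1,2)] robin_continuous(2)[OF lk m(3,4)]
            W_continuous[OF kl Wh_D(1)[OF m(6) kl]]])
  qed
  show "incoming_form w (s + t) = incoming_form w s + incoming_form w t"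
    unfolding incoming_form_def sum.distrib[symmetric]
  proof (intro sum.cong refl)
    fix k l assume "l \<in> {l. adj k l}"
    then have kl: "adj k l" by simp
    then have lk: "adj l k" using adjacent_sym[of D k l] by simp
    have e: "snd (s + t) k l = snd s k l + snd t k l" by simp
    show "ip k l (- snd w l k + \<alpha> *\<^sub>R fst w l) (snd (s + t) k l) =
        ip k l (- snd w l k + \<alpha> *\<^sub>R fst w l) (snd s k l) + ip k l (- snd w l k + \<alpha> *\<^sub>R fst w l) (snd t k l)"
      unfolding e
      by (rule ip_add(2)[OF kl W_continuous[OF kl Wh_D(1)[OF m(2) kl]] W_continuous[OF kl Wh_D(1)[OF m(4) kl]]
            robin_continuous(2)[OF lk m(5,6)]])
  qed
qed

lemma incoming_form_scale:
  "incoming_form (c *\<^sub>R s) w = c * incoming_form s w" "incoming_form w (c *\<^sub>R s) = c * incoming_form w s"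
proof -
  have e: "- snd (c *\<^sub>R s) l k + \<alpha> *\<^sub>R fst (c *\<^sub>R s) l = c *\<^sub>R (- snd s l k + \<alpha> *\<^sub>R fst s l)" for k l
    by (simp add: scaleR_fun_def fun_eq_iff algebra_simps)
  have e': "snd (c *\<^sub>R s) k l = c *\<^sub>R snd s k l" for k l
    by (simp add: scaleR_fun_def)
  show "incoming_form (c *\<^sub>R s) w = c * incoming_form s w"
    by (simp only: incoming_form_def e ip_scale sum_distrib_left)
  show "incoming_form w (c *\<^sub>R s) = c * incoming_form w s"
    by (simp only: incoming_form_def e' ip_scale sum_distrib_left)
qed

text \<open>For a fixed point the outgoing data cancel in \<open>energy_step\<close>, which leaves
  \<open>4 * \<alpha> * energy u \<le> \<alpha> * energy u\<close>.\<close>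

lemma fixed_point_zero:
  assumes small: "\<alpha> * mesh_size \<T> * (\<bar>C\<bar> * real CARD('k)) \<le> 1"
    and h: "\<And>k. homogeneous k (u k) (p k)"
    and eq: "\<And>k l \<psi>. adj k l \<Longrightarrow> \<psi> \<in> W k l \<Longrightarrow>
        ip k l (p k l + \<alpha> *\<^sub>R u k) \<psi> = ip k l (- p l k + \<alpha> *\<^sub>R u l) \<psi>"
  shows "u k = 0 \<and> p k = 0"
proof -
  have m: "u k \<in> X k" "p k \<in> Wh D W k" for k using h by (auto simp: homogeneous_def)
  have "4 * \<alpha> * energy u + outgoing u p
      \<le> outgoing u p + \<alpha>\<^sup>2 * (\<bar>C\<bar> * mesh_size \<T>) * real CARD('k) * energy u"
    by (rule energy_step[OF m h eq])
  also have "\<alpha>\<^sup>2 * (\<bar>C\<bar> * mesh_size \<T>) * real CARD('k) * energy u =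
      (\<alpha> * mesh_size \<T> * (\<bar>C\<bar> * real CARD('k))) * (\<alpha> * energy u)"
    by (simp add: power2_eq_square)
  also have "\<dots> \<le> 1 * (\<alpha> * energy u)"
    using small alpha_pos energy_nonneg[of u] by (intro mult_right_mono) auto
  finally have "\<alpha> * energy u \<le> 0" by simp
  then have "energy u = 0" using alpha_pos energy_nonneg[of u] by (simp add: mult_le_0_iff)
  then have "h1_form (D k) (u k) (u k) = 0"
    unfolding energy_def by (subst (asm) sum_nonneg_eq_0_iff) (auto intro: h1_form_nonneg)
  then have "u k = 0" using form_eq_0 m by blast
  then show ?thesis using homogeneous_zero[of k "p k"] h[of k] by simp
qed

text \<open>A kernel element of \<open>global_form\<close> is a discrete solution without source,
  hence a homogeneous fixed point, to which \<open>fixed_point_zero\<close> applies.\<close>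

theorem discrete_solutions_ex1:
  assumes f: "square_integrable (lebesgue_on \<Omega>) f"
    and small: "\<alpha> * mesh_size \<T> * (\<bar>C\<bar> * real CARD('k)) \<le> 1"
  shows "\<exists>!s. s \<in> discrete_solutions n \<Omega> D \<T> W \<alpha> f"
proof -
  define L where "L t = (\<Sum>k\<in>UNIV. source f k (fst t k))"
    for t :: "('k \<Rightarrow> 'a \<Rightarrow> real) \<times> ('k \<Rightarrow> 'k \<Rightarrow> 'a \<Rightarrow> real)"
  have "fin_dim unknowns"
    by (intro fin_dim_Times fin_dim_Pi fin_dim_Xh fin_dim_Wh W_trace)
  then obtain S where S: "finite S" "unknowns \<subseteq> span S"
    unfolding fin_dim_def by (elim exE conjE)
  have mem: "fst s k \<in> X k" "snd s k \<in> Wh D W k" "(fst s k, snd s k) \<in> X k \<times> Wh D W k"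
    if "s \<in> unknowns" for s k
  proof -
    show 1: "fst s k \<in> X k" using that unfolding mem_Times_iff by blast
    show 2: "snd s k \<in> Wh D W k" using that unfolding mem_Times_iff by blast
    show "(fst s k, snd s k) \<in> X k \<times> Wh D W k" using 1 2 by (rule SigmaI)
  qed
  have "\<exists>!s. s \<in> unknowns \<and> (\<forall>t\<in>unknowns. global_form s t = L t)"
  proof (rule nondegenerate_form_solvable[OF _ S])
    show "subspace unknowns" by (intro subspace_Times Xs_subspace Whs_subspace)
  next
    fix s t w assume m: "s \<in> unknowns" "t \<in> unknowns" "w \<in> unknowns"
    have e: "(fst (s + t) k, snd (s + t) k) = (fst s k, snd s k) + (fst t k, snd t k)" for k by simp
    show "global_form (s + t) w = global_form s w + global_form t w"
      unfolding global_form_split incoming_form_add[OF m] e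
      by (simp only: local_form_add(1)[OF mem(3)[OF m(1)] mem(3)[OF m(2)] mem(3)[OF m(3)]] sum.distrib add_diff_add)
    show "global_form w (s + t) = global_form w s + global_form w t"
      unfolding global_form_split incoming_form_add[OF m] e
      by (simp only: local_form_add(2)[OF mem(3)[OF m(1)] mem(3)[OF m(2)] mem(3)[OF m(3)]] sum.distrib add_diff_add)
  next
    fix c s w assume m: "s \<in> unknowns" "w \<in> unknowns"
    have e: "(fst (c *\<^sub>R s) k, snd (c *\<^sub>R s) k) = c *\<^sub>R (fst s k, snd s k)" for k
      by (simp add: scaleR_fun_def)
    show "global_form (c *\<^sub>R s) w = c * global_form s w"
      unfolding global_form_split incoming_form_scale e
      by (simp only: local_form_scale(1)[OF mem(3)[OF m(1)] mem(3)[OF m(2)]] sum_distrib_left right_diff_distrib)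
    show "global_form w (c *\<^sub>R s) = c * global_form w s"
      unfolding global_form_split incoming_form_scale e
      by (simp only: local_form_scale(2)[OF mem(3)[OF m(1)] mem(3)[OF m(2)]] sum_distrib_left right_diff_distrib)
  next
    fix s t assume m: "s \<in> unknowns" "t \<in> unknowns"
    have e: "fst (s + t) k = fst s k + fst t k" for k by simp
    show "L (s + t) = L s + L t"
      unfolding L_def e
      by (simp only: source_linear(1)[OF f mem(1)[OF m(1)] mem(1)[OF m(2)]] sum.distrib)
  next
    fix c s assume m: "s \<in> unknowns"
    have e: "fst (c *\<^sub>R s) k = c *\<^sub>R fst s k" for k by (simp add: scaleR_fun_def)
    show "L (c *\<^sub>R s) = c * L s"
      unfolding L_def e by (simp only: source_linear(2)[OF f mem(1)[OF m] mem(1)[OF m]] sum_distrib_left)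
  next
    fix s assume s: "s \<in> unknowns" "\<And>t. t \<in> unknowns \<Longrightarrow> global_form s t = 0"
    have "s \<in> discrete_solutions n \<Omega> D \<T> W \<alpha> 0"
      unfolding discrete_solutions_global_form[OF mem(1,2)[OF s(1)]] using s(2) by simp
    then have nx: "(fst s k, snd s k) \<in> next_iterates n \<Omega> D \<T> W \<alpha> 0 (fst s) (snd s) k" for k
      using discrete_solutions_iff[of "fst s" "snd s" 0] by simp
    have "fst s k = 0 \<and> snd s k = 0" for k
    proof (rule fixed_point_zero[OF small])
      show "homogeneous k (fst s k) (snd s k)" for k
        using nx[of k] by (simp add: next_iterates_iff homogeneous_def)
      show "ip k l (snd s k l + \<alpha> *\<^sub>R fst s k) \<psi> = ip k l (- snd s l k + \<alpha> *\<^sub>R fst s l) \<psi>"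
        if "adj k l" "\<psi> \<in> W k l" for k l \<psi>
        using nx[of k] that by (simp add: next_iterates_iff)
    qed
    then show "s = 0" by (simp add: prod_eq_iff fun_eq_iff)
  qed
  moreover have "s \<in> discrete_solutions n \<Omega> D \<T> W \<alpha> f \<longleftrightarrow> s \<in> unknowns \<and> (\<forall>t\<in>unknowns. global_form s t = L t)" for s
  proof -
    have "s \<in> unknowns" if "s \<in> discrete_solutions n \<Omega> D \<T> W \<alpha> f"
      using that discrete_solutions_iff[of "fst s" "snd s" f] by (cases s) (auto simp: next_iterates_iff)
    moreover have "(s \<in> discrete_solutions n \<Omega> D \<T> W \<alpha> f) = (\<forall>t\<in>unknowns. global_form s t = L t)" if "s \<in> unknowns"
      unfolding L_def by (rule discrete_solutions_global_form[OF mem(1,2)[OF that]])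
    ultimately show ?thesis by blast
  qed
  ultimately show ?thesis by simp
qed

theorem iterates_converge:
  assumes small: "\<alpha> * mesh_size \<T> * (\<bar>C\<bar> * real CARD('k)) \<le> 1"
    and sol: "(u, p) \<in> discrete_solutions n \<Omega> D \<T> W \<alpha> f"
    and init: "\<And>k. un 0 k \<in> X k" "\<And>k. pn 0 k \<in> Wh D W k"
    and iter: "\<And>i k. (un (Suc i) k, pn (Suc i) k) \<in> next_iterates n \<Omega> D \<T> W \<alpha> f (un i) (pn i) k"
  shows "(\<lambda>i. ennreal (h1_norm (D k) (un i k - u k)) +
      (\<Sum>l | adj k l. h_minus_half_norm (D k) (\<Gamma> k l) (pn i k l - p k l))) \<longlonglongrightarrow> 0"
proof -
  have fixp: "(u k, p k) \<in> next_iterates n \<Omega> D \<T> W \<alpha> f u p k" for k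
    using sol discrete_solutions_iff by blast
  then have m: "u k \<in> X k" "p k \<in> Wh D W k" for k by (auto simp: next_iterates_iff)
  have mn: "un i k \<in> X k" "pn i k \<in> Wh D W k" for i k
    using init iter[of "i - 1" k] by (cases i; auto simp: next_iterates_iff)+
  define e where "e i = un i - u" for i
  define q where "q i = pn i - p" for i
  have me: "e i k \<in> X k" "q i k \<in> Wh D W k" for i k
    using mn m by (auto simp: e_def q_def intro!: subspace_diff X_subspace Wh_subspace')
  have hom: "homogeneous k (e (Suc i) k) (q (Suc i) k)" for i k
    using next_iterates_difference(1)[OF iter fixp mn m] by (simp add: e_def q_def)
  have eqn: "ip k l (q (Suc i) k l + \<alpha> *\<^sub>R e (Suc i) k) \<psi> = ip k l (- q i l k + \<alpha> *\<^sub>R e i l) \<psi>"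
    if "adj k l" "\<psi> \<in> W k l" for i k l \<psi>
    using next_iterates_difference(2)[OF iter fixp mn m that] by (simp add: e_def q_def)
  define E where "E i = energy (e i)" for i
  have E0: "0 \<le> E i" for i unfolding E_def by (rule energy_nonneg)
  have step: "4 * \<alpha> * E (Suc i) + outgoing (e (Suc i)) (q (Suc i)) \<le> outgoing (e i) (q i) + \<alpha> * E i" for i
  proof -
    have "4 * \<alpha> * E (Suc i) + outgoing (e (Suc i)) (q (Suc i))
        \<le> outgoing (e i) (q i) + \<alpha>\<^sup>2 * (\<bar>C\<bar> * mesh_size \<T>) * real CARD('k) * E i"
      unfolding E_def by (rule energy_step[OF me hom eqn])
    also have "\<alpha>\<^sup>2 * (\<bar>C\<bar> * mesh_size \<T>) * real CARD('k) * E i =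
        (\<alpha> * mesh_size \<T> * (\<bar>C\<bar> * real CARD('k))) * (\<alpha> * E i)"
      by (simp add: power2_eq_square)
    also have "\<dots> \<le> 1 * (\<alpha> * E i)"
      using small alpha_pos E0 by (intro mult_right_mono) auto
    finally show ?thesis by simp
  qed
  \<comment> \<open>Telescoping: of the available \<open>4 * \<alpha> * E N\<close>, one part
    \<open>\<alpha> * E N\<close> absorbs the projection error of the next step and the rest is
    accumulated in the sum.\<close>
  have "3 * \<alpha> * (\<Sum>i<N. E i) + (outgoing (e N) (q N) + 4 * \<alpha> * E N) \<le> outgoing (e 0) (q 0) + 4 * \<alpha> * E 0" for N
  proof (induction N)
    case (Suc N)
    then show ?case using step[of N] by (simp add: algebra_simps)
  qed simp
  then have "3 * \<alpha> * (\<Sum>i<N. E i) \<le> outgoing (e 0) (q 0) + 4 * \<alpha> * E 0" for N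
    using outgoing_nonneg[of "e N" "q N"] E0[of N] alpha_pos by (smt (verit) mult_nonneg_nonneg)
  then have "(\<Sum>i<N. E i) \<le> (outgoing (e 0) (q 0) + 4 * \<alpha> * E 0) / (3 * \<alpha>)" for N
    using alpha_pos by (simp add: pos_le_divide_eq mult.commute)
  then have "summable E" by (intro summableI_nonneg_bounded E0)
  then have "E \<longlonglongrightarrow> 0" by (rule summable_LIMSEQ_zero)
  then have sqrtE: "(\<lambda>i. sqrt (E i)) \<longlonglongrightarrow> 0" using tendsto_real_sqrt by fastforce
  have norm_le: "h1_norm (D k) (e i k) \<le> sqrt (E i)" for i
    unfolding h1_norm_def E_def energy_def
    by (intro real_sqrt_le_mono member_le_sum) (auto intro: h1_form_nonneg)
  \<comment> \<open>The 1 accounts for the function, and \<open>\<bar>cs\<bar>\<close> for the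
    multiplier on each interface.\<close>
  define B where "B = 1 + real (card {l. adj k l}) * \<bar>cs\<bar>"
  \<comment> \<open>The bound starts at index 1: the initial pair is arbitrary, so its error need
    not be homogeneous.\<close>
  have bound: "ennreal (h1_norm (D k) (e (Suc i) k)) +
      (\<Sum>l | adj k l. h_minus_half_norm (D k) (\<Gamma> k l) (q (Suc i) k l)) \<le> ennreal (B * sqrt (E (Suc i)))" for i
  proof -
    let ?N = "h1_norm (D k) (e (Suc i) k)"
    have N0: "0 \<le> ?N" using h1_form_nonneg[of "D k"] by (simp add: h1_norm_def)
    have "(\<Sum>l | adj k l. h_minus_half_norm (D k) (\<Gamma> k l) (q (Suc i) k l)) \<le> (\<Sum>l | adj k l. ennreal (\<bar>cs\<bar> * ?N))"
      by (intro sum_mono homogeneous_multiplier_bound[OF hom]) simp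
    also have "\<dots> = ennreal (real (card {l. adj k l}) * (\<bar>cs\<bar> * ?N))"
      using N0 by (simp add: ennreal_mult ennreal_of_nat_eq_real_of_nat)
    finally have "ennreal ?N + (\<Sum>l | adj k l. h_minus_half_norm (D k) (\<Gamma> k l) (q (Suc i) k l)) \<le>
        ennreal ?N + ennreal (real (card {l. adj k l}) * (\<bar>cs\<bar> * ?N))" by (rule add_left_mono)
    also have "\<dots> = ennreal (B * ?N)"
      using N0 by (simp add: B_def ennreal_plus[symmetric] algebra_simps del: ennreal_plus)
    also have "\<dots> \<le> ennreal (B * sqrt (E (Suc i)))"
      using norm_le[of "Suc i"] by (intro ennreal_leI mult_left_mono) (simp_all add: B_def)
    finally show ?thesis .
  qed
  have "(\<lambda>i. ennreal (h1_norm (D k) (e (Suc i) k)) +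
      (\<Sum>l | adj k l. h_minus_half_norm (D k) (\<Gamma> k l) (q (Suc i) k l))) \<longlonglongrightarrow> 0"
  proof (rule tendsto_sandwich[OF _ _ tendsto_const])
    have "(\<lambda>i. B * sqrt (E (Suc i))) \<longlonglongrightarrow> B * 0"
      by (intro tendsto_mult tendsto_const LIMSEQ_Suc sqrtE)
    then show "(\<lambda>i. ennreal (B * sqrt (E (Suc i)))) \<longlonglongrightarrow> 0"
      using tendsto_ennrealI by fastforce
  qed (use bound in auto)
  then have "(\<lambda>i. ennreal (h1_norm (D k) (e i k)) +
      (\<Sum>l | adj k l. h_minus_half_norm (D k) (\<Gamma> k l) (q i k l))) \<longlonglongrightarrow> 0"
    by (rule LIMSEQ_imp_Suc)
  then show ?thesis by (simp add: e_def q_def)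
qed

end

theorem theorem2:
  fixes \<Omega> :: "'a::euclidean_space set"
    and D :: "'k::finite \<Rightarrow> 'a set"
    and n :: nat
    and \<sigma> \<tau> cs C :: real
  assumes dim: "DIM('a) = 2 \<or> DIM('a) = 3"
    and deg: "n \<ge> 1" "DIM('a) = 3 \<longrightarrow> n = 1"
    and decomp: "conforming_decomposition \<Omega> D"
    and reg: "\<sigma> > 0" "\<tau> > 0"
  shows "\<exists>c>0. \<forall>(\<T> :: 'k \<Rightarrow> 'a set set) (W :: 'k \<Rightarrow> 'k \<Rightarrow> ('a \<Rightarrow> real) set) (\<alpha> :: real) (f :: 'a \<Rightarrow> real).
    uniformly_regular_meshes \<sigma> \<tau> D \<T> \<and> meshes_fit_interfaces n D \<T> \<and>
    multiplier_spaces n D \<T> W \<and>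
    multiplier_stability cs n \<Omega> D \<T> W \<and> multiplier_approximation C n \<Omega> D \<T> W \<and>
    \<alpha> > 0 \<and> \<alpha> * mesh_size \<T> \<le> c \<and> square_integrable (lebesgue_on \<Omega>) f \<longrightarrow>
      (\<exists>!s. s \<in> discrete_solutions n \<Omega> D \<T> W \<alpha> f) \<and>
      (\<forall>u p. (\<forall>k. u k \<in> Xh n \<Omega> D \<T> k \<and> p k \<in> Wh D W k) \<longrightarrow>
         (\<forall>k. \<exists>!s. s \<in> next_iterates n \<Omega> D \<T> W \<alpha> f u p k)) \<and>
      (\<forall>u p un pn.
         (u, p) \<in> discrete_solutions n \<Omega> D \<T> W \<alpha> f \<and>
         (\<forall>k. un 0 k \<in> Xh n \<Omega> D \<T> k \<and> pn 0 k \<in> Wh D W k) \<and>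
         (\<forall>i k. (un (Suc i) k, pn (Suc i) k) \<in> next_iterates n \<Omega> D \<T> W \<alpha> f (un i) (pn i) k) \<longrightarrow>
         (\<forall>k. (\<lambda>i. ennreal (h1_norm (D k) (\<lambda>x. un i k x - u k x)) +
                   (\<Sum>l\<in>{l. adjacent D k l}.
                      h_minus_half_norm (D k) (interface D k l) (\<lambda>x. pn i k l x - p k l x)))
              \<longlonglongrightarrow> 0))"
proof -
  \<comment> \<open>Each of at most \<open>CARD('k)\<close> neighbours costs
    \<open>\<bar>C\<bar>\<close> in the energy estimate; the added 1 keeps the denominator
    positive.\<close>
  define c where "c = 1 / (1 + \<bar>C\<bar> * real CARD('k))"
  have pos: "1 + \<bar>C\<bar> * real CARD('k) > 0" by (simp add: add_pos_nonneg)
  show ?thesis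
  proof (rule exI[of _ c], intro conjI allI impI)
    show "c > 0" using pos by (simp add: c_def)
  next
    fix \<T> :: "'k \<Rightarrow> 'a set set" and W :: "'k \<Rightarrow> 'k \<Rightarrow> ('a \<Rightarrow> real) set" and \<alpha> :: real and f :: "'a \<Rightarrow> real"
    assume *: "uniformly_regular_meshes \<sigma> \<tau> D \<T> \<and> meshes_fit_interfaces n D \<T> \<and>
      multiplier_spaces n D \<T> W \<and>
      multiplier_stability cs n \<Omega> D \<T> W \<and> multiplier_approximation C n \<Omega> D \<T> W \<and>
      \<alpha> > 0 \<and> \<alpha> * mesh_size \<T> \<le> c \<and> square_integrable (lebesgue_on \<Omega>) f"
    interpret robin \<Omega> D n \<T> \<sigma> \<tau> W \<alpha> cs C
      by unfold_locales (use * dim decomp in auto)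
    have "\<alpha> * mesh_size \<T> * (\<bar>C\<bar> * real CARD('k)) \<le> c * (\<bar>C\<bar> * real CARD('k))"
      using * by (intro mult_right_mono) auto
    also have "\<dots> \<le> 1" using pos by (simp add: c_def)
    finally have small: "\<alpha> * mesh_size \<T> * (\<bar>C\<bar> * real CARD('k)) \<le> 1" .
    show "\<exists>!s. s \<in> discrete_solutions n \<Omega> D \<T> W \<alpha> f"
      by (rule discrete_solutions_ex1[OF _ small]) (use * in simp)
    show "\<exists>!s. s \<in> next_iterates n \<Omega> D \<T> W \<alpha> f u p k"
      if "\<forall>k. u k \<in> Xh n \<Omega> D \<T> k \<and> p k \<in> Wh D W k" for u p k
      by (rule next_iterates_ex1) (use * that in auto)
    show "(\<lambda>i. ennreal (h1_norm (D k) (\<lambda>x. un i k x - u k x)) +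
                   (\<Sum>l\<in>{l. adjacent D k l}.
                      h_minus_half_norm (D k) (interface D k l) (\<lambda>x. pn i k l x - p k l x))) \<longlonglongrightarrow> 0"
      if "(u, p) \<in> discrete_solutions n \<Omega> D \<T> W \<alpha> f \<and>
         (\<forall>k. un 0 k \<in> Xh n \<Omega> D \<T> k \<and> pn 0 k \<in> Wh D W k) \<and>
         (\<forall>i k. (un (Suc i) k, pn (Suc i) k) \<in> next_iterates n \<Omega> D \<T> W \<alpha> f (un i) (pn i) k)"
      for u p un pn k
      using iterates_converge[OF small, of u p f un pn k] that by (simp add: fun_diff_def)
  qed
qed

end
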